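(* Let $\beta_0\in B_3$ be fixed. For every continuous function $f\colon\mathbb{C}\to\mathbb{R}$ with compact support, $$\sum_{\beta\in\mathbb{C}\colon\mathcal{Z}_N(\beta)=0} f\big(\sqrt n(\beta-\beta_0)\big)\;\longrightarrow\;\sum_{\beta\in\mathbb{C}\colon\mathbb{G}(\beta)=0} f(\beta)\qquad\text{in distribution, as }N\to\infty.$$
   Context: Let $X_1,X_2,\ldots$ be independent real standard normal random variables. For $N\in\mathbb{N}$ put $n=\log N$ (natural logarithm) and $\mathcal{Z}_N(\beta)=\sum_{k=1}^N e^{\beta\sqrt n X_k}$, $\beta\in\mathbb{C}$. Write $\beta=\sigma+i\tau$ with $\sigma,\tau\in\mathbb{R}$; $B_3=\{\beta\in\mathbb{C}\colon 2\sigma^2<1,\ \sigma^2+\tau^2>1\}$. $\mathbb{G}$ is the Gaussian analytic function $\mathbb{G}(t)=\sum_{k=0}^\infty \xi_k\, t^k/\sqrt{k!}$, $t\in\mathbb{C}$, where $\xi_0,\xi_1,\ldots$ are independent standard complex Gaussian random variables (density $z\mapsto\pi^{-1}e^{-|z|^2}$ with respect to Lebesgue measure on $\mathbb{C}$). Sums over zeros count multiplicities. *)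

theory Defs
  imports "HOL-Probability.Probability" "HOL-Complex_Analysis.Complex_Analysis"
begin

definition partition_function :: "(nat \<Rightarrow> 'a \<Rightarrow> real) \<Rightarrow> nat \<Rightarrow> 'a \<Rightarrow> complex \<Rightarrow> complex" where
  "partition_function X N \<omega> \<beta> =
     (\<Sum>k=1..N. exp (\<beta> * of_real (sqrt (ln (real N)) * X k \<omega>)))"

definition B3 :: "complex set" where
  "B3 = {\<beta>. 2 * (Re \<beta>)\<^sup>2 < 1 \<and> (Re \<beta>)\<^sup>2 + (Im \<beta>)\<^sup>2 > 1}"

definition std_complex_normal_density :: "complex \<Rightarrow> real" where
  "std_complex_normal_density z = exp (- (cmod z)\<^sup>2) / pi"

(* The series converges on the whole plane almost surely. On the exceptional null event the
   function is set to 0; without such a convention suminf would take unspecified values there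
   and functionals of the zero set need not be measurable. *)
definition gaussian_analytic_function ::
    "(nat \<Rightarrow> 'b \<Rightarrow> complex) \<Rightarrow> 'b \<Rightarrow> complex \<Rightarrow> complex" where
  "gaussian_analytic_function \<xi> \<omega> t =
     (if \<forall>s. summable (\<lambda>k. \<xi> k \<omega> * s ^ k / of_real (sqrt (fact k)))
      then (\<Sum>k. \<xi> k \<omega> * t ^ k / of_real (sqrt (fact k))) else 0)"

(* Zeros counted with multiplicity. For an entire F that is not identically zero and a compactly
   supported h only finitely many terms are non-zero. *)
definition sum_over_zeros :: "(complex \<Rightarrow> complex) \<Rightarrow> (complex \<Rightarrow> real) \<Rightarrow> real" where
  "sum_over_zeros F h = (\<Sum>\<^sub>\<infinity>\<beta>\<in>{\<beta>. F \<beta> = 0}. of_int (zorder F \<beta>) * h \<beta>)"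

(* Measurability is part of the definition because distr and cdf are only meaningful for random
   variables. The limit may live on a different probability space. *)
definition converges_in_distribution ::
    "'a measure \<Rightarrow> (nat \<Rightarrow> 'a \<Rightarrow> real) \<Rightarrow> 'b measure \<Rightarrow> ('b \<Rightarrow> real) \<Rightarrow> bool" where
  "converges_in_distribution M S M' T \<longleftrightarrow>
     (\<forall>N. S N \<in> borel_measurable M) \<and> T \<in> borel_measurable M' \<and>
     weak_conv_m (\<lambda>N. distr M borel (S N)) (distr M' borel T)"

end

theory Submission
  imports Defs
begin

text \<open>
  Write \<open>n = ln N\<close>, \<open>\<sigma> = Re \<beta>\<^sub>0\<close>, \<open>\<tau> = Im \<beta>\<^sub>0\<close> and \<open>b = 2 \<sigma> sqrt n\<close>. Multiplying \<open>Z_N(\<beta>\<^sub>0 + t / sqrt n)\<close>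
  by a factor without zeros, one obtains a random entire function of the zoomed variable \<open>t\<close>,
  \<open>G_N(t) = N^(-1/2 - \<sigma>\<^sup>2) exp(-b t - t\<^sup>2/2) \<Sum>j. exp((\<beta>\<^sub>0 sqrt n + t) X_j)\<close>
  \<open>= \<Sum>j. c_N exp(\<beta>\<^sub>0 sqrt n X_j) exp(t (X_j - b) - t\<^sup>2/2)\<close>,
  whose zeros are the zeros of the partition function near \<open>\<beta>\<^sub>0\<close>. The last exponential is the
  generating function of the Hermite polynomials, so \<open>G_N\<close> has the expansion
  \<open>\<Sum>k. A_k t^k / sqrt k!\<close> with \<open>A_k = \<Sum>j. c_N exp(\<beta>\<^sub>0 sqrt n X_j) He_k(X_j - b) / sqrt k!\<close>, which is to be
  compared with the coefficients \<open>\<xi>_k\<close> of the Gaussian analytic function. The weight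
  \<open>\<bar>exp(\<beta>\<^sub>0 sqrt n X)\<bar>\<^sup>2\<close> tilts the standard normal law to the normal law with mean \<open>b\<close>, under which
  the polynomials \<open>He_k(x - b) / sqrt k!\<close> are orthonormal: the summands of \<open>A_k\<close> and \<open>cnj A_l\<close> have
  exactly the mixed moment of \<open>\<xi>_k\<close> and \<open>cnj \<xi>_l\<close>, divided by \<open>N\<close>.

  Three Gaussian computations, all based on Stein's identity \<open>tilt_stein\<close>, give the central limit
  theorem for finitely many coefficients. The means tend to 0 because \<open>\<sigma>\<^sup>2 + \<tau>\<^sup>2 > 1\<close>
  (\<open>summand_hermite_mean\<close>), the pseudo-covariances tend to 0 because \<open>\<tau> \<noteq> 0\<close>
  (\<open>summand_square_mean\<close>), and Lyapunov's condition with exponent \<open>2 + \<delta>\<close> holds because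
  \<open>2 \<sigma>\<^sup>2 < 1\<close> (\<open>summand_lyapunov\<close>). The outcome is convergence of the characteristic functions
  of all real linear forms in the coefficients (\<open>rescaled_coeffs_cos_limit\<close>).

  The second moments of the \<open>A_k\<close> grow at most geometrically in \<open>k\<close>, uniformly in \<open>N\<close>, so the
  coefficient sequences stay with high probability in a compact box of the product space
  (\<open>coeff_box_tail\<close>). On such a box the Stone-Weierstrass theorem for trigonometric polynomials upgrades
  convergence of characteristic functions to convergence of expectations of all bounded functions
  that are continuous on every box (\<open>coeff_weak_convergence\<close>).

  On a box, coefficientwise convergence is locally uniform convergence of the power series, and by
  Rouche's theorem a linear statistic of the zeros depends continuously on the function as long as
  the function is not identically zero (\<open>sum_over_zeros_stable\<close>,
  \<open>continuous_on_zero_functional\<close>). The exceptional point, the zero sequence, has probability zero in the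
  limit and is removed by a cutoff in the coefficient \<open>A_0\<close> (\<open>zero_functional_convergence\<close>).
\<close>

section \<open>Zeros of nearby holomorphic functions\<close>

lemma finite_zeros_cball:
  fixes F :: "complex \<Rightarrow> complex"
  assumes "F holomorphic_on ball 0 R" "\<exists>z\<in>ball 0 R. F z \<noteq> 0" "r < R"
  shows "finite {z\<in>cball 0 r. F z = 0}"
proof (cases "F constant_on ball 0 R")
  case True
  then have "\<And>z. z \<in> ball 0 R \<Longrightarrow> F z \<noteq> 0" using assms(2) by (metis constant_on_def)
  then have "{z\<in>cball 0 r. F z = 0} = {}" using assms(3) by force
  then show ?thesis by (simp only: finite.emptyI)
next
  case False
  show ?thesis
    by (rule holomorphic_compact_finite_zeros[OF assms(1) open_ball connected_ball _ _ False])
       (use assms(3) in auto)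
qed

lemma zorder_pos_at_zero:
  assumes "F holomorphic_on ball 0 R" "\<exists>z\<in>ball 0 R. F z \<noteq> 0" "z \<in> ball 0 R" "F z = 0"
  shows "zorder F z > 0"
  using zorder_exist_zero[OF assms(1) open_ball connected_ball assms(3,2)] assms(4) by auto

lemma sum_over_zeros_finite:
  assumes "finite {z\<in>ball 0 r. F z = 0}" "\<And>z. norm z \<ge> r \<Longrightarrow> h z = 0"
  shows "sum_over_zeros F h = (\<Sum>z | z \<in> ball 0 r \<and> F z = 0. of_int (zorder F z) * h z)"
proof -
  have "sum_over_zeros F h = (\<Sum>\<^sub>\<infinity>z\<in>{z\<in>ball 0 r. F z = 0}. of_int (zorder F z) * h z)"
    unfolding sum_over_zeros_def by (rule infsum_cong_neutral) (auto intro!: assms(2))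
  then show ?thesis using assms(1) by simp
qed

text \<open>
  Rouche's theorem for a circle: the winding number is 1 inside and 0 outside, so the weighted sums
  over all zeros in the large disc \<open>ball 0 r\<close> reduce to sums over the zeros in \<open>ball c s\<close>.
\<close>
lemma sum_zorder_disc_stable:
  fixes F G :: "complex \<Rightarrow> complex"
  assumes F: "F holomorphic_on ball 0 R" and G: "G holomorphic_on ball 0 R" and "r < R"
    and finF: "finite {p\<in>ball 0 r. F p = 0}" and finG: "finite {p\<in>ball 0 r. G p = 0}"
    and "s > 0" and sub: "cball c s \<subseteq> ball 0 r"
    and close: "\<And>z. z \<in> sphere c s \<Longrightarrow> cmod (G z - F z) < cmod (F z)"
  shows "(\<Sum>p | p \<in> ball c s \<and> G p = 0. zorder G p) = (\<Sum>p | p \<in> ball c s \<and> F p = 0. zorder F p)"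
proof -
  let ?g = "circlepath c s"
  have nF: "F z \<noteq> 0" "G z \<noteq> 0" if "z \<in> sphere c s" for z
    using close[OF that] by auto
  have subR: "ball 0 r \<subseteq> ball 0 R" using \<open>r < R\<close> by auto
  have out: "winding_number ?g z = 0" if "z \<notin> cball c s" for z
    by (rule winding_number_zero_outside[of _ "cball c s"]) (use that \<open>s > 0\<close> in \<open>auto simp: sphere_def\<close>)
  have ins: "winding_number ?g z = 1" if "z \<in> ball c s" for z
    by (rule winding_number_circlepath) (use that in \<open>auto simp: dist_norm norm_minus_commute\<close>)
  have conv: "(\<Sum>p\<in>{p\<in>ball 0 r. H p = 0}. winding_number ?g p * zorder H p) = of_int (\<Sum>p | p \<in> ball c s \<and> H p = 0. zorder H p)"
    if fin: "finite {p\<in>ball 0 r. H p = 0}" and n: "\<And>z. z \<in> sphere c s \<Longrightarrow> H z \<noteq> 0" for H :: "complex \<Rightarrow> complex"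
  proof -
    have eq: "{p. p \<in> ball c s \<and> H p = 0} \<subseteq> {p\<in>ball 0 r. H p = 0}"
      using sub ball_subset_cball[of c s] by blast
    have "(\<Sum>p\<in>{p\<in>ball 0 r. H p = 0}. winding_number ?g p * zorder H p)
       = (\<Sum>p\<in>{p. p \<in> ball c s \<and> H p = 0}. winding_number ?g p * zorder H p)"
    proof (rule sum.mono_neutral_right[OF fin eq], rule ballI)
      fix p assume p: "p \<in> {p \<in> ball 0 r. H p = 0} - {p. p \<in> ball c s \<and> H p = 0}"
      then have "p \<notin> sphere c s" using n by auto
      with p have "p \<notin> cball c s" by auto
      then show "winding_number ?g p * zorder H p = 0" by (simp add: out)
    qed
    also have "\<dots> = (\<Sum>p\<in>{p. p \<in> ball c s \<and> H p = 0}. of_int (zorder H p))"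
      by (intro sum.cong) (auto simp: ins)
    finally show ?thesis by simp
  qed
  have G_eq: "(\<lambda>p. F p + (G p - F p)) = G" by auto
  have "(\<Sum>p\<in>{p\<in>ball 0 r. F p + (G p - F p) = 0}. winding_number ?g p * zorder (\<lambda>p. F p + (G p - F p)) p)
      = (\<Sum>p\<in>{p\<in>ball 0 r. F p = 0}. winding_number ?g p * zorder F p)"
  proof (rule Rouche_theorem)
    show "F holomorphic_on ball 0 r" "(\<lambda>p. G p - F p) holomorphic_on ball 0 r"
      using F G subR by (auto intro!: holomorphic_intros intro: holomorphic_on_subset)
    show "\<forall>z\<in>path_image ?g. cmod (G z - F z) < cmod (F z)"
      using close \<open>s > 0\<close> by auto
    show "path_image ?g \<subseteq> ball 0 r" using sub \<open>s > 0\<close> by (auto simp: subset_iff)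
    show "\<forall>z. z \<notin> ball 0 r \<longrightarrow> winding_number ?g z = 0" using out sub by blast
  qed (use finF finG in auto)
  then have "complex_of_int (\<Sum>p | p \<in> ball c s \<and> G p = 0. zorder G p) = of_int (\<Sum>p | p \<in> ball c s \<and> F p = 0. zorder F p)"
    using conv[OF finF nF(1)] conv[OF finG nF(2)] by (simp add: G_eq)
  then show ?thesis by (simp only: of_int_eq_iff)
qed

text \<open>
  Enclose each zero of \<open>F\<close> by a small disc on which \<open>h\<close> is almost constant. A function \<open>G\<close> close to
  \<open>F\<close> has in each of these discs as many zeros as \<open>F\<close>. It also has the same total number of zeros in a
  large disc containing the support of \<open>h\<close>, so no zero of \<open>G\<close> there lies outside the small discs.
\<close>
lemma sum_over_zeros_stable:
  fixes F :: "complex \<Rightarrow> complex" and h :: "complex \<Rightarrow> real"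
  assumes F: "F holomorphic_on ball 0 R2" and nz: "\<exists>z\<in>ball 0 R2. F z \<noteq> 0"
    and cont: "continuous_on UNIV h" and supp: "\<And>z. norm z \<ge> R \<Longrightarrow> h z = 0"
    and R: "0 < R" "R < R2" and e: "e > 0"
  shows "\<exists>\<delta>>0. \<exists>r<R2. \<forall>G. G holomorphic_on ball 0 R2 \<longrightarrow> (\<forall>z\<in>cball 0 r. cmod (G z - F z) < \<delta>) \<longrightarrow>
            \<bar>sum_over_zeros G h - sum_over_zeros F h\<bar> \<le> e"
proof -
  define r1 where "r1 = (R + R2) / 2"
  have r1: "R < r1" "r1 < R2" using R by (auto simp: r1_def)
  have finF: "finite {z\<in>cball 0 r1. F z = 0}" by (rule finite_zeros_cball[OF F nz r1(2)])
  \<comment> \<open>The finitely many zeros leave room for a circle that avoids them all.\<close>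
  then have "infinite ({R<..<r1} - norm ` {z\<in>cball 0 r1. F z = 0})"
    using r1 by (intro Diff_infinite_finite) auto
  then have "{R<..<r1} - norm ` {z\<in>cball 0 r1. F z = 0} \<noteq> {}"
    by (rule infinite_imp_nonempty)
  then obtain r where "r \<in> {R<..<r1} - norm ` {z\<in>cball 0 r1. F z = 0}"
    by blast
  then have r: "R < r" "r < r1" "r \<notin> norm ` {z\<in>cball 0 r1. F z = 0}"
    by (simp_all only: Diff_iff greaterThanLessThan_iff not_False_eq_True)
  have F_sphere: "F z \<noteq> 0" if "norm z = r" for z
    using r that by (auto simp: image_iff)
  define Z where "Z = {z. z \<in> ball 0 r \<and> F z = 0}"
  have finZ: "finite Z" by (rule finite_subset[OF _ finF]) (use r in \<open>auto simp: Z_def\<close>)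
  define m where "m = (\<Sum>z\<in>Z. zorder F z)"
  have zo: "zorder F z > 0" if "z \<in> Z" for z
    by (rule zorder_pos_at_zero[OF F nz]) (use that r r1 in \<open>auto simp: Z_def\<close>)
  have m: "m \<ge> 0" unfolding m_def by (intro sum_nonneg less_imp_le zo)
  define e' where "e' = e / (1 + of_int m)"
  have e': "e' > 0" using e m by (simp add: e'_def)
  \<comment> \<open>Each of the finitely many requirements on the common radius holds for all small radii.\<close>
  have "\<forall>\<^sub>F \<rho> in at_right 0. \<forall>z\<in>Z. cball z \<rho> \<subseteq> ball 0 r \<and> (\<forall>w\<in>ball z \<rho>. \<bar>h w - h z\<bar> < e') \<and> (\<forall>z'\<in>Z. z' \<noteq> z \<longrightarrow> 2 * \<rho> < dist z z')"
  proof (intro eventually_ball_finite finZ ballI eventually_conj)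
    fix z assume z: "z \<in> Z"
    have "0 < r - norm z" using z by (auto simp: Z_def)
    then have "\<forall>\<^sub>F \<rho> in at_right 0. \<rho> < r - norm z"
      by (intro eventually_at_rightI[of 0 "r - norm z"]) auto
    then show "\<forall>\<^sub>F \<rho> in at_right 0. cball z \<rho> \<subseteq> ball 0 r"
    proof eventually_elim
      case (elim \<rho>)
      show ?case
      proof
        fix w assume "w \<in> cball z \<rho>"
        then have "norm (w - z) \<le> \<rho>" by (simp add: dist_norm norm_minus_commute)
        then have "norm w \<le> norm z + \<rho>" using norm_triangle_sub[of w z] by linarith
        then show "w \<in> ball 0 r" using elim by simp
      qed
    qed
    obtain d where d: "d > 0" "\<And>w. dist w z < d \<Longrightarrow> dist (h w) (h z) < e'"
      using cont e' unfolding continuous_on_iff by (metis UNIV_I)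
    show "\<forall>\<^sub>F \<rho> in at_right 0. \<forall>w\<in>ball z \<rho>. \<bar>h w - h z\<bar> < e'"
      by (rule eventually_at_rightI[OF _ d(1)]) (use d(2) in \<open>auto simp: dist_real_def dist_commute\<close>)
    fix z' assume "z' \<in> Z"
    show "\<forall>\<^sub>F \<rho> in at_right 0. z' \<noteq> z \<longrightarrow> 2 * \<rho> < dist z z'"
    proof (cases "z' = z")
      case False
      show ?thesis by (rule eventually_at_rightI[of 0 "dist z z' / 2"]) (use False in auto)
    qed simp
  qed
  then have "\<forall>\<^sub>F \<rho> in at_right 0. \<rho> > (0::real) \<and> (\<forall>z\<in>Z. cball z \<rho> \<subseteq> ball 0 r \<and> (\<forall>w\<in>ball z \<rho>. \<bar>h w - h z\<bar> < e') \<and> (\<forall>z'\<in>Z. z' \<noteq> z \<longrightarrow> 2 * \<rho> < dist z z'))"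
    by (intro eventually_conj eventually_at_right_less)
  then obtain \<rho> where \<rho>: "\<rho> > 0" "\<And>z. z \<in> Z \<Longrightarrow> cball z \<rho> \<subseteq> ball 0 r"
      "\<And>z w. z \<in> Z \<Longrightarrow> w \<in> ball z \<rho> \<Longrightarrow> \<bar>h w - h z\<bar> < e'"
      "\<And>z z'. z \<in> Z \<Longrightarrow> z' \<in> Z \<Longrightarrow> z' \<noteq> z \<Longrightarrow> 2 * \<rho> < dist z z'"
    using eventually_happens'[OF trivial_limit_at_right_real] by blast
  define C where "C = sphere 0 r \<union> (\<Union>z\<in>Z. sphere z \<rho>)"
  have C: "compact C" unfolding C_def by (intro compact_Un compact_sphere compact_UN finZ)
  have Csub: "C \<subseteq> cball 0 r" using \<rho>(2) by (fastforce simp: C_def)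
  have "C \<noteq> {}" using r R by (auto simp: C_def)
  have nC: "F w \<noteq> 0" if "w \<in> C" for w
  proof
    assume "F w = 0"
    then have "w \<notin> sphere 0 r" using F_sphere by auto
    then have "w \<in> (\<Union>z\<in>Z. sphere z \<rho>)" using that unfolding C_def by blast
    then obtain z where "z \<in> Z" "w \<in> sphere z \<rho>" by blast
    then have z: "z \<in> Z" "dist z w = \<rho>" by simp_all
    then have "w \<in> cball z \<rho>" by simp
    then have "w \<in> Z" using \<rho>(2)[OF z(1)] \<open>F w = 0\<close> by (auto simp: Z_def simp del: mem_cball)
    moreover have "w \<noteq> z" using z \<rho>(1) by auto
    ultimately show False using \<rho>(4)[OF z(1), of w] z(2) \<rho>(1) by auto
  qed
  have "continuous_on C (\<lambda>w. cmod (F w))"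
    using Csub r r1 by (intro continuous_intros holomorphic_on_imp_continuous_on[OF holomorphic_on_subset[OF F]]) auto
  then obtain w0 where w0: "w0 \<in> C" "\<And>w. w \<in> C \<Longrightarrow> cmod (F w0) \<le> cmod (F w)"
    using continuous_attains_inf[OF C \<open>C \<noteq> {}\<close>] by blast
  define \<delta> where "\<delta> = cmod (F w0)"
  have \<delta>: "\<delta> > 0" using nC[OF w0(1)] by (simp add: \<delta>_def)
  have SF: "sum_over_zeros F h = (\<Sum>z\<in>Z. of_int (zorder F z) * h z)"
    unfolding Z_def by (rule sum_over_zeros_finite) (use finZ supp r in \<open>auto simp: Z_def\<close>)
  have "\<bar>sum_over_zeros G h - sum_over_zeros F h\<bar> \<le> e"
    if G: "G holomorphic_on ball 0 R2" and close: "\<forall>z\<in>cball 0 r. cmod (G z - F z) < \<delta>" for G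
  proof -
    have closeC: "cmod (G z - F z) < cmod (F z)" if "z \<in> C" for z
    proof -
      have "cmod (G z - F z) < \<delta>" using close that Csub by blast
      then show ?thesis using w0(2)[OF that] by (simp add: \<delta>_def)
    qed
    have nzG: "\<exists>z\<in>ball 0 R2. G z \<noteq> 0"
    proof
      show "G w0 \<noteq> 0" using closeC[OF w0(1)] by auto
      have "w0 \<in> cball 0 r" using w0(1) Csub by blast
      then show "w0 \<in> ball 0 R2" using r r1 by simp
    qed
    have finG: "finite {z\<in>cball 0 r1. G z = 0}" by (rule finite_zeros_cball[OF G nzG r1(2)])
    define ZG where "ZG = {z. z \<in> ball 0 r \<and> G z = 0}"
    have finZG: "finite ZG" by (rule finite_subset[OF _ finG]) (use r in \<open>auto simp: ZG_def\<close>)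
    have zoG: "zorder G z > 0" if "z \<in> ZG" for z
      by (rule zorder_pos_at_zero[OF G nzG]) (use that r r1 in \<open>auto simp: ZG_def\<close>)
    have fins: "finite {p\<in>ball 0 r1. F p = 0}" "finite {p\<in>ball 0 r1. G p = 0}"
      by (rule finite_subset[OF _ finF], force, rule finite_subset[OF _ finG], force)
    have "0 < r" using r R by linarith
    have big: "(\<Sum>p\<in>ZG. zorder G p) = m"
      unfolding ZG_def m_def Z_def
    proof (rule sum_zorder_disc_stable[OF F G r1(2) fins \<open>0 < r\<close>])
      show "cball 0 r \<subseteq> ball (0::complex) r1" using r by auto
      show "cmod (G z - F z) < cmod (F z)" if "z \<in> sphere 0 r" for z
        using that by (intro closeC) (unfold C_def, blast)
    qed
    define D where "D z = {p. p \<in> ball z \<rho> \<and> G p = 0}" for z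
    have small: "(\<Sum>p\<in>D z. zorder G p) = zorder F z" if z: "z \<in> Z" for z
    proof -
      have "(\<Sum>p\<in>D z. zorder G p) = (\<Sum>p | p \<in> ball z \<rho> \<and> F p = 0. zorder F p)"
        unfolding D_def
      proof (rule sum_zorder_disc_stable[OF F G r1(2) fins \<rho>(1)])
        show "cball z \<rho> \<subseteq> ball 0 r1" using \<rho>(2)[OF z] r by (intro order.trans[OF _ subset_ball[of r r1]]) auto
        show "cmod (G w - F w) < cmod (F w)" if "w \<in> sphere z \<rho>" for w
          using that z by (intro closeC) (unfold C_def, blast)
      qed
      also have "{p. p \<in> ball z \<rho> \<and> F p = 0} = {z}"
      proof -
        have "p = z" if "p \<in> ball z \<rho>" "F p = 0" for p
        proof (rule ccontr)
          assume "p \<noteq> z"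
          moreover have "p \<in> Z" using that \<rho>(2)[OF z] ball_subset_cball[of z \<rho>] unfolding Z_def by blast
          ultimately show False using \<rho>(4)[OF z, of p] that \<rho>(1) by auto
        qed
        then show ?thesis using z \<rho>(1) by (auto simp: Z_def)
      qed
      finally show ?thesis by simp
    qed
    have Dsub: "D z \<subseteq> ZG" if "z \<in> Z" for z
      using \<rho>(2)[OF that] ball_subset_cball[of z \<rho>] unfolding D_def ZG_def by blast
    have finD: "finite (D z)" if "z \<in> Z" for z using finite_subset[OF Dsub[OF that] finZG] .
    have disj: "D z \<inter> D z' = {}" if "z \<in> Z" "z' \<in> Z" "z \<noteq> z'" for z z'
    proof -
      have False if "p \<in> ball z \<rho>" "p \<in> ball z' \<rho>" for p
        using dist_triangle[of z z' p] that \<rho>(4)[OF \<open>z \<in> Z\<close> \<open>z' \<in> Z\<close>] \<open>z \<noteq> z'\<close> by (auto simp: dist_commute)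
      then show ?thesis by (auto simp: D_def)
    qed
    have sumU: "(\<Sum>p\<in>(\<Union>z\<in>Z. D z). k p) = (\<Sum>z\<in>Z. \<Sum>p\<in>D z. k p)" for k :: "complex \<Rightarrow> 'x::comm_monoid_add"
      by (rule sum.UNION_disjoint) (use finZ finD disj in auto)
    \<comment> \<open>All orders are positive, so a zero outside the small discs would make the total too large.\<close>
    have "(\<Union>z\<in>Z. D z) = ZG"
    proof (rule ccontr)
      assume ne: "(\<Union>z\<in>Z. D z) \<noteq> ZG"
      have sub: "(\<Union>z\<in>Z. D z) \<subseteq> ZG" using Dsub by blast
      obtain q where q: "q \<in> ZG - (\<Union>z\<in>Z. D z)" using ne sub by blast
      have "(\<Sum>p\<in>(\<Union>z\<in>Z. D z). zorder G p) < (\<Sum>p\<in>ZG. zorder G p)"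
        by (rule sum_strict_mono2[OF finZG sub q]) (use q zoG in \<open>auto intro: less_imp_le\<close>)
      also have "\<dots> = (\<Sum>p\<in>(\<Union>z\<in>Z. D z). zorder G p)"
        unfolding big sumU m_def by (intro sum.cong) (auto simp: small)
      finally show False by simp
    qed
    have "sum_over_zeros G h = (\<Sum>p\<in>ZG. of_int (zorder G p) * h p)"
      unfolding ZG_def by (rule sum_over_zeros_finite) (use finZG supp r in \<open>auto simp: ZG_def\<close>)
    also have "\<dots> = (\<Sum>z\<in>Z. \<Sum>p\<in>D z. of_int (zorder G p) * h p)"
      using sumU \<open>(\<Union>z\<in>Z. D z) = ZG\<close> by metis
    finally have SG: "sum_over_zeros G h = (\<Sum>z\<in>Z. \<Sum>p\<in>D z. of_int (zorder G p) * h p)" .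
    have SF': "sum_over_zeros F h = (\<Sum>z\<in>Z. \<Sum>p\<in>D z. of_int (zorder G p) * h z)"
      unfolding SF by (intro sum.cong refl) (simp add: sum_distrib_right[symmetric] small flip: of_int_sum)
    have "sum_over_zeros G h - sum_over_zeros F h = (\<Sum>z\<in>Z. \<Sum>p\<in>D z. of_int (zorder G p) * (h p - h z))"
      unfolding SG SF' by (simp add: sum_subtractf right_diff_distrib)
    also have "\<bar>\<dots>\<bar> \<le> (\<Sum>z\<in>Z. \<Sum>p\<in>D z. of_int (zorder G p) * e')"
    proof (intro order.trans[OF sum_abs] sum_mono)
      fix z p assume zp: "z \<in> Z" "p \<in> D z"
      then have "p \<in> ball z \<rho>" "p \<in> ZG" using Dsub[OF zp(1)] unfolding D_def by blast+
      then have "\<bar>h p - h z\<bar> < e'" "zorder G p > 0" using \<rho>(3)[OF zp(1)] zoG by blast+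
      then show "\<bar>of_int (zorder G p) * (h p - h z)\<bar> \<le> of_int (zorder G p) * e'"
        by (auto simp: abs_mult intro!: mult_left_mono)
    qed
    also have "\<dots> = of_int m * e'"
      unfolding m_def by (simp add: sum_distrib_right[symmetric] small flip: of_int_sum)
    also have "\<dots> \<le> e" using m e by (simp add: e'_def field_simps)
    finally show ?thesis .
  qed
  then show ?thesis using \<delta> r r1 by (intro exI[of _ \<delta>] conjI exI[of _ r]) auto
qed

section \<open>Sequences of power series coefficients\<close>

text \<open>
  The power series with the normalisation of the Gaussian analytic function: standard complex normal
  coefficients correspond to that function.
\<close>
definition weighted_series :: "(nat \<Rightarrow> complex) \<Rightarrow> complex \<Rightarrow> complex" where
  "weighted_series a t = (\<Sum>k. a k * t ^ k / of_real (sqrt (fact k)))"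

text \<open>
  The Cauchy estimates on the circle of radius \<open>R\<close>. Every power series converging beyond \<open>R\<close> satisfies
  them for some \<open>L\<close>, and conversely they force uniform convergence on all smaller discs; at the same
  time they only bound the individual coordinates.
\<close>
definition coeff_box :: "real \<Rightarrow> real \<Rightarrow> (nat \<Rightarrow> complex) set" where
  "coeff_box R L = {a. \<forall>k. cmod (a k) * R ^ k / sqrt (fact k) \<le> L}"

lemma coeff_box_mono: "L \<le> L' \<Longrightarrow> coeff_box R L \<subseteq> coeff_box R L'"
  unfolding coeff_box_def by (auto intro: order.trans)

text \<open>
  Tychonoff's theorem, since the box is a product of closed discs.
\<close>
lemma compact_coeff_box:
  assumes "R > 0"
  shows "compact (coeff_box R L)"
proof -
  have eq: "coeff_box R L = PiE UNIV (\<lambda>k. cball 0 (L * sqrt (fact k) / R ^ k))"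
    using assms by (auto simp: coeff_box_def PiE_def field_simps)
  have "compactin (product_topology (\<lambda>_. euclidean) UNIV) (coeff_box R L)"
    unfolding eq compactin_PiE by auto
  then show ?thesis unfolding euclidean_product_topology by simp
qed

lemma weighted_series_term_bound:
  assumes "a \<in> coeff_box R L" "R > 0" "norm t \<le> r"
  shows "norm (a k * t ^ k / of_real (sqrt (fact k))) \<le> L * (r / R) ^ k"
proof -
  have "r \<ge> 0" using assms(3) norm_ge_zero order.trans by blast
  have "norm (a k * t ^ k / of_real (sqrt (fact k))) = (cmod (a k) / sqrt (fact k)) * norm t ^ k"
    by (simp add: norm_mult norm_divide norm_power)
  also have "\<dots> \<le> (cmod (a k) / sqrt (fact k)) * r ^ k"
    by (intro mult_left_mono power_mono assms) auto
  also have "\<dots> = (cmod (a k) * R ^ k / sqrt (fact k)) * (r / R) ^ k"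
    using assms(2) by (simp add: power_divide)
  also have "\<dots> \<le> L * (r / R) ^ k"
    using assms \<open>r \<ge> 0\<close> by (intro mult_right_mono) (auto simp: coeff_box_def)
  finally show ?thesis .
qed

lemma summable_weighted_series:
  assumes "a \<in> coeff_box R L" "R > 0" "norm t < R"
  shows "summable (\<lambda>k. a k * t ^ k / of_real (sqrt (fact k)))"
proof (rule summable_comparison_test)
  show "\<exists>N. \<forall>n\<ge>N. norm (a n * t ^ n / of_real (sqrt (fact n))) \<le> L * (norm t / R) ^ n"
    using weighted_series_term_bound[OF assms(1,2) order.refl] by blast
  show "summable (\<lambda>n. L * (norm t / R) ^ n)"
    using assms by (intro summable_mult summable_geometric) simp
qed

lemma weighted_series_sums:
  assumes "a \<in> coeff_box R L" "R > 0" "norm t < R"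
  shows "(\<lambda>k. a k / of_real (sqrt (fact k)) * t ^ k) sums weighted_series a t"
  using summable_sums[OF summable_weighted_series[OF assms]] by (simp add: weighted_series_def)

lemma holomorphic_weighted_series:
  assumes "a \<in> coeff_box R L" "R > 0"
  shows "weighted_series a holomorphic_on ball 0 R"
proof (rule power_series_holomorphic)
  show "(\<lambda>k. a k / of_real (sqrt (fact k)) * (w - 0) ^ k) sums weighted_series a w" if "w \<in> ball 0 R" for w
    using weighted_series_sums[OF assms, of w] that by simp
qed

lemma weighted_series_nonzero:
  assumes "a \<in> coeff_box R L" "R > 0" "a \<noteq> (\<lambda>_. 0)"
  shows "\<exists>z\<in>ball 0 R. weighted_series a z \<noteq> 0"
proof (rule ccontr)
  assume "\<not> ?thesis"
  then have z: "weighted_series a z = 0" if "norm z < R" for z using that by auto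
  define c where "c k = a k / of_real (sqrt (fact k))" for k
  have c: "(\<lambda>k. c k * (t - 0) ^ k) sums 0" if "norm (t - 0) < R" for t
    using weighted_series_sums[OF assms(1,2), of t] z that by (simp add: c_def)
  obtain m where m: "a m \<noteq> 0" using assms(3) by auto
  show False
  proof (cases "m = 0")
    case True
    have "c 0 = 0" using c[of 0] assms(2) by simp
    then show ?thesis using m True by (simp add: c_def)
  next
    case False
    have cm: "c m \<noteq> 0" "m > 0" using m False by (auto simp: c_def)
    show ?thesis
    proof (rule powser_0_nonzero[OF assms(2) c refl cm])
      fix s :: real assume s: "0 < s" and n: "\<And>z. z \<in> cball 0 s - {0::complex} \<Longrightarrow> (0::complex) \<noteq> 0"
      show False using n[of "of_real s"] s by simp
    qed
  qed
qed

text \<open>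
  On the box the series has a geometric majorant, so it is jointly continuous in the coefficients and
  in \<open>t\<close>. Compactness makes the continuity in the coefficients uniform in \<open>t\<close>, although the metric
  of the product space controls only finitely many coefficients at a time.
\<close>
lemma weighted_series_close:
  assumes "R > 0" "r < R" "a0 \<in> coeff_box R L" "e > 0"
  shows "\<exists>d>0. \<forall>a\<in>coeff_box R L. dist a a0 < d \<longrightarrow>
           (\<forall>t\<in>cball 0 r. cmod (weighted_series a t - weighted_series a0 t) < e)"
proof (cases "r \<ge> 0")
  case True
  let ?S = "coeff_box R L \<times> cball (0::complex) r"
  have "uniform_limit ?S (\<lambda>n (a,t). \<Sum>k<n. a k * t ^ k / of_real (sqrt (fact k)))
          (\<lambda>(a,t). weighted_series a t) sequentially"
    unfolding weighted_series_def case_prod_unfold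
  proof (rule Weierstrass_m_test)
    fix k and x :: "(nat \<Rightarrow> complex) \<times> complex" assume "x \<in> ?S"
    then show "norm (fst x k * snd x ^ k / of_real (sqrt (fact k))) \<le> L * (r / R) ^ k"
      using assms(1) by (intro weighted_series_term_bound) auto
  next
    show "summable (\<lambda>k. L * (r / R) ^ k)"
      using assms True by (intro summable_mult summable_geometric) simp
  qed
  moreover have "continuous_on ?S (\<lambda>(a,t). \<Sum>k<n. a k * t ^ k / of_real (sqrt (fact k)))" for n
  proof -
    have "continuous_on ?S (\<lambda>x. (fst x) k)" for k
      by (rule continuous_on_compose2[OF continuous_on_product_coordinates continuous_on_fst[OF continuous_on_id]]) auto
    then show ?thesis unfolding case_prod_unfold by (intro continuous_intros) auto
  qed
  ultimately have "continuous_on ?S (\<lambda>(a,t). weighted_series a t)"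
    by (intro uniform_limit_theorem[where F = sequentially]) auto
  moreover have "compact ?S" by (intro compact_Times compact_coeff_box assms compact_cball)
  ultimately have "uniformly_continuous_on ?S (\<lambda>(a,t). weighted_series a t)"
    by (rule compact_uniformly_continuous)
  then obtain d where d: "d > 0" "\<And>x y. x \<in> ?S \<Longrightarrow> y \<in> ?S \<Longrightarrow> dist y x < d \<Longrightarrow>
      dist (case y of (a,t) \<Rightarrow> weighted_series a t) (case x of (a,t) \<Rightarrow> weighted_series a t) < e"
    using assms(4) unfolding uniformly_continuous_on_def by metis
  have "cmod (weighted_series a t - weighted_series a0 t) < e"
    if "a \<in> coeff_box R L" "dist a a0 < d" "t \<in> cball 0 r" for a t
    using d(2)[of "(a0,t)" "(a,t)"] that assms(3) by (simp add: dist_Pair_Pair dist_norm)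
  then show ?thesis using d(1) by blast
qed (use assms in \<open>auto intro: exI[of _ 1]\<close>)

text \<open>
  The zero sequence must be left out: its series vanishes identically, and nearby sequences can have
  zeros anywhere.
\<close>
lemma continuous_on_zero_functional:
  fixes h :: "complex \<Rightarrow> real"
  assumes "continuous_on UNIV h" "\<And>z. norm z \<ge> R0 \<Longrightarrow> h z = 0" "0 < R0" "R0 < R"
  shows "continuous_on (coeff_box R L - {\<lambda>_. 0}) (\<lambda>a. sum_over_zeros (weighted_series a) h)"
  unfolding continuous_on_iff
proof (intro ballI allI impI)
  fix a0 and e :: real assume a0: "a0 \<in> coeff_box R L - {\<lambda>_. 0}" and e: "e > 0"
  have R: "R > 0" using assms by linarith
  have a0': "a0 \<in> coeff_box R L" "a0 \<noteq> (\<lambda>_. 0)" using a0 by auto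
  obtain \<delta> r where \<delta>: "\<delta> > 0" "r < R"
    "\<And>G. G holomorphic_on ball 0 R \<Longrightarrow> (\<forall>z\<in>cball 0 r. cmod (G z - weighted_series a0 z) < \<delta>) \<Longrightarrow>
        \<bar>sum_over_zeros G h - sum_over_zeros (weighted_series a0) h\<bar> \<le> e / 2"
    using sum_over_zeros_stable[OF holomorphic_weighted_series[OF a0'(1) R] weighted_series_nonzero[OF a0'(1) R a0'(2)] assms, of "e / 2"] e
    by auto
  obtain d where "d > 0" "\<And>a t. a \<in> coeff_box R L \<Longrightarrow> dist a a0 < d \<Longrightarrow>
      t \<in> cball 0 r \<Longrightarrow> cmod (weighted_series a t - weighted_series a0 t) < \<delta>"
    using weighted_series_close[OF R \<delta>(2) a0'(1) \<delta>(1)] by blast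
  then have "dist (sum_over_zeros (weighted_series a) h) (sum_over_zeros (weighted_series a0) h) < e"
    if "a \<in> coeff_box R L" "dist a a0 < d" for a
    using \<delta>(3)[OF holomorphic_weighted_series[OF that(1) R]] that e by (simp add: dist_real_def del: mem_cball)
  then show "\<exists>d>0. \<forall>a\<in>coeff_box R L - {\<lambda>_. 0}. dist a a0 < d \<longrightarrow>
       dist (sum_over_zeros (weighted_series a) h) (sum_over_zeros (weighted_series a0) h) < e"
    using \<open>d > 0\<close> by blast
qed

text \<open>
  The region in which linear statistics supported inside the disc of radius \<open>R\<close> are well behaved. As a
  countable union of compact sets it is measurable.
\<close>
definition coeff_tame :: "real \<Rightarrow> (nat \<Rightarrow> complex) set" where
  "coeff_tame R = (\<Union>n::nat. coeff_box R (real n))"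

lemma coeff_box_subset_tame: "coeff_box R L \<subseteq> coeff_tame R"
proof -
  obtain n :: nat where "L \<le> real n" using real_arch_simple by blast
  then show ?thesis using coeff_box_mono[of L "real n" R] by (auto simp: coeff_tame_def)
qed

lemma coeff_box_sets [measurable]: "coeff_box R L \<in> sets borel"
proof -
  have "coeff_box R L = (\<Inter>k. {a. cmod (a k) * R ^ k / sqrt (fact k) \<le> L})"
    by (auto simp: coeff_box_def)
  also have "\<dots> \<in> sets borel" by measurable
  finally show ?thesis .
qed

lemma coeff_tame_sets [measurable]: "coeff_tame R \<in> sets borel"
  unfolding coeff_tame_def by measurable

text \<open>
  The functional is continuous on each of the countably many measurable pieces \<open>coeff_box R n\<close> without
  the zero sequence, and constant on the remaining two pieces.
\<close>
lemma measurable_zero_functional: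
  fixes h :: "complex \<Rightarrow> real"
  assumes "continuous_on UNIV h" "\<And>z. norm z \<ge> R0 \<Longrightarrow> h z = 0" "0 < R0" "R0 < R"
  shows "(\<lambda>a. if a \<in> coeff_tame R then sum_over_zeros (weighted_series a) h else 0) \<in> borel_measurable borel"
    (is "?f \<in> _")
proof (rule measurable_piecewise_restrict)
  let ?C = "{- coeff_tame R, {\<lambda>_. 0}} \<union> range (\<lambda>n::nat. coeff_box R (real n) - {\<lambda>_. 0})"
  show "countable ?C" by (intro countable_Un countable_image) auto
  have sing: "{\<lambda>_. 0} \<in> sets (borel :: (nat \<Rightarrow> complex) measure)" by (rule borel_closed) simp
  show "\<Omega> \<inter> space borel \<in> sets borel" if "\<Omega> \<in> ?C" for \<Omega>
    using that sing by (auto intro!: sets.Diff)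
  show "space borel \<subseteq> \<Union>?C" by (auto simp: coeff_tame_def)
  show "?f \<in> borel_measurable (restrict_space borel \<Omega>)" if \<Omega>: "\<Omega> \<in> ?C" for \<Omega>
  proof (rule borel_measurable_continuous_on_restrict)
    consider "\<Omega> = - coeff_tame R" | "\<Omega> = {\<lambda>_. 0}" | n :: nat where "\<Omega> = coeff_box R (real n) - {\<lambda>_. 0}"
      using \<Omega> by blast
    then show "continuous_on \<Omega> ?f"
    proof cases
      case 1
      have "continuous_on \<Omega> (\<lambda>_. 0::real)" by simp
      then show ?thesis by (rule continuous_on_eq) (use 1 in auto)
    next
      case 2
      then show ?thesis by simp
    next
      case (3 n)
      show ?thesis unfolding 3
        by (rule continuous_on_eq[OF continuous_on_zero_functional[OF assms]])
           (use coeff_box_subset_tame in auto)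
    qed
  qed
qed

definition entire_coeffs :: "(nat \<Rightarrow> complex) set" where
  "entire_coeffs = {a. \<forall>s. summable (\<lambda>k. a k * s ^ k / of_real (sqrt (fact k)))}"

lemma summable_imp_tame:
  assumes "summable (\<lambda>k. a k * of_real R ^ k / of_real (sqrt (fact k)) :: complex)" "R > 0"
  shows "a \<in> coeff_tame R"
proof -
  have "Bseq (\<lambda>k. a k * of_real R ^ k / of_real (sqrt (fact k)) :: complex)"
    by (rule convergent_imp_Bseq[OF convergentI[OF summable_LIMSEQ_zero[OF assms(1)]]])
  then obtain K where K: "\<And>k. norm (a k * of_real R ^ k / of_real (sqrt (fact k)) :: complex) \<le> K"
    unfolding Bseq_def by blast
  have "a \<in> coeff_box R K"
    using K assms(2) by (simp add: coeff_box_def norm_mult norm_divide norm_power)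
  then show ?thesis using coeff_box_subset_tame by blast
qed

text \<open>
  Convergence at every point is a condition on uncountably many arguments; this description by
  countably many boxes makes it measurable.
\<close>
lemma entire_coeffs_eq: "entire_coeffs = (\<Inter>n::nat. coeff_tame (real (Suc n)))"
proof (intro equalityI subsetI)
  fix a assume a: "a \<in> entire_coeffs"
  have "a \<in> coeff_tame (real (Suc n))" for n
    by (rule summable_imp_tame) (use a in \<open>simp_all add: entire_coeffs_def del: of_nat_Suc\<close>)
  then show "a \<in> (\<Inter>n::nat. coeff_tame (real (Suc n)))" by blast
next
  fix a assume a: "a \<in> (\<Inter>n::nat. coeff_tame (real (Suc n)))"
  have "summable (\<lambda>k. a k * s ^ k / of_real (sqrt (fact k)))" for s
  proof -
    obtain n where n: "norm s < real n" using reals_Archimedean2 by blast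
    obtain L where "a \<in> coeff_box (real (Suc n)) L" using a by (auto simp: coeff_tame_def)
    then show ?thesis by (rule summable_weighted_series) (use n in auto)
  qed
  then show "a \<in> entire_coeffs" by (simp add: entire_coeffs_def)
qed

lemma entire_coeffs_sets [measurable]: "entire_coeffs \<in> sets borel"
  unfolding entire_coeffs_eq by measurable

lemma entire_coeffs_subset_tame: "R > 0 \<Longrightarrow> entire_coeffs \<subseteq> coeff_tame R"
  using summable_imp_tame by (auto simp: entire_coeffs_def)

section \<open>Weak convergence of random coefficient sequences\<close>

text \<open>
  Real linear forms in finitely many coordinates, the arguments of the multivariate characteristic
  function.
\<close>
definition lin_form :: "nat \<Rightarrow> (nat \<Rightarrow> complex) \<Rightarrow> (nat \<Rightarrow> complex) \<Rightarrow> real" where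
  "lin_form m v a = Re (\<Sum>k<m. v k * a k)"

lemma lin_form_combine:
  "\<exists>w. \<forall>a. lin_form m v a + c * lin_form m' v' a = lin_form (max m m') w a"
proof -
  define u where "u m v k = (if k < m then v k else (0::complex))" for m :: nat and v k
  have pad: "(\<Sum>k<m. v k * a k) = (\<Sum>k<n. u m v k * a k)" if "m \<le> n" for m n v and a :: "nat \<Rightarrow> complex"
  proof -
    have "(\<Sum>k<m. v k * a k) = (\<Sum>k<m. u m v k * a k)" by (intro sum.cong) (auto simp: u_def)
    also have "\<dots> = (\<Sum>k<n. u m v k * a k)"
      using that by (intro sum.mono_neutral_left) (auto simp: u_def)
    finally show ?thesis .
  qed
  have "lin_form m v a + c * lin_form m' v' a = lin_form (max m m') (\<lambda>k. u m v k + of_real c * u m' v' k) a" for a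
  proof -
    have "lin_form m v a + c * lin_form m' v' a = Re ((\<Sum>k<max m m'. u m v k * a k) + of_real c * (\<Sum>k<max m m'. u m' v' k * a k))"
      unfolding lin_form_def by (simp add: pad[of m "max m m'"] pad[of m' "max m m'"])
    also have "\<dots> = lin_form (max m m') (\<lambda>k. u m v k + of_real c * u m' v' k) a"
      unfolding lin_form_def by (simp add: sum_distrib_left sum.distrib[symmetric] algebra_simps)
    finally show ?thesis .
  qed
  then show ?thesis by blast
qed

lemma continuous_on_lin_form [continuous_intros]: "continuous_on S (lin_form m v)"
proof -
  have "continuous_on S (\<lambda>a. a k)" for k :: nat
    by (rule continuous_on_subset[OF continuous_on_product_coordinates]) simp
  then show ?thesis unfolding lin_form_def by (intro continuous_intros)
qed

text \<open>
  Real trigonometric polynomials. Their expectations are determined by the characteristic function,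
  and the addition theorem for the cosine makes them an algebra.
\<close>
inductive_set trig_functions :: "((nat \<Rightarrow> complex) \<Rightarrow> real) set" where
  cos: "(\<lambda>a. cos (lin_form m v a + \<theta>)) \<in> trig_functions"
| scale: "p \<in> trig_functions \<Longrightarrow> (\<lambda>a. c * p a) \<in> trig_functions"
| add: "p \<in> trig_functions \<Longrightarrow> q \<in> trig_functions \<Longrightarrow> (\<lambda>a. p a + q a) \<in> trig_functions"

lemma trig_const: "(\<lambda>_. c) \<in> trig_functions"
  using trig_functions.scale[OF trig_functions.cos[of 0 _ 0], of c] by (simp add: lin_form_def)

lemma trig_mult:
  assumes "p \<in> trig_functions" "q \<in> trig_functions"
  shows "(\<lambda>a. p a * q a) \<in> trig_functions"
  using assms(1)
proof induction
  case (cos m v \<theta>)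
  show ?case using assms(2)
  proof induction
    case (cos m' v' \<theta>')
    obtain w1 where w1: "\<And>a. lin_form m v a + (-1) * lin_form m' v' a = lin_form (max m m') w1 a"
      using lin_form_combine by blast
    obtain w2 where w2: "\<And>a. lin_form m v a + 1 * lin_form m' v' a = lin_form (max m m') w2 a"
      using lin_form_combine by blast
    have "(\<lambda>a. cos (lin_form m v a + \<theta>) * cos (lin_form m' v' a + \<theta>')) =
        (\<lambda>a. 1/2 * cos (lin_form (max m m') w1 a + (\<theta> - \<theta>')) + 1/2 * cos (lin_form (max m m') w2 a + (\<theta> + \<theta>')))"
      by (rule ext, subst cos_times_cos) (simp add: w1[symmetric] w2[symmetric] algebra_simps add_divide_distrib)
    then show ?case by (simp only:) (intro trig_functions.intros)
  next
    case (scale q c)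
    then show ?case using trig_functions.scale[of _ c] by (simp add: mult.left_commute)
  next
    case (add q1 q2)
    then show ?case using trig_functions.add by (simp add: distrib_left)
  qed
next
  case (scale p c)
  then show ?case using trig_functions.scale[of _ c] by (simp add: mult.assoc)
next
  case (add p1 p2)
  then show ?case using trig_functions.add by (simp add: distrib_right)
qed

lemma trig_continuous: "p \<in> trig_functions \<Longrightarrow> continuous_on S p"
  by (induction rule: trig_functions.induct) (auto intro!: continuous_intros)

lemma trig_bounded: "p \<in> trig_functions \<Longrightarrow> \<exists>B. \<forall>a. \<bar>p a\<bar> \<le> B"
proof (induction rule: trig_functions.induct)
  case (cos m v \<theta>)
  then show ?case by (intro exI[of _ 1]) simp
next
  case (scale p c)
  then obtain B where "\<And>a. \<bar>p a\<bar> \<le> B" by blast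
  then show ?case by (intro exI[of _ "\<bar>c\<bar> * B"]) (auto simp: abs_mult intro: mult_left_mono)
next
  case (add p q)
  then obtain B C where "\<And>a. \<bar>p a\<bar> \<le> B" "\<And>a. \<bar>q a\<bar> \<le> C" by blast
  then show ?case by (intro exI[of _ "B + C"]) (meson abs_triangle_ineq add_mono order_trans)
qed

lemma trig_measurable [measurable]: "p \<in> trig_functions \<Longrightarrow> p \<in> borel_measurable borel"
  by (intro borel_measurable_continuous_onI trig_continuous)

lemma trig_separates:
  assumes "a \<noteq> b"
  shows "\<exists>p\<in>trig_functions. p a \<noteq> p b"
proof -
  obtain k where k: "a k \<noteq> b k" using assms by auto
  define d where "d = a k - b k"
  have d: "d \<noteq> 0" using k by (simp add: d_def)
  \<comment> \<open>Scaled so that the linear form takes values at \<open>a\<close> and \<open>b\<close> that differ by exactly 1.\<close>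
  define v where "v j = (if j = k then cnj d / of_real ((cmod d)\<^sup>2) else 0)" for j
  have lf: "lin_form (Suc k) v x = Re (cnj d / of_real ((cmod d)\<^sup>2) * x k)" for x
  proof -
    have "(\<Sum>j<Suc k. v j * x j) = v k * x k" by (simp add: v_def)
    then show ?thesis by (simp add: lin_form_def v_def)
  qed
  have "lin_form (Suc k) v a - lin_form (Suc k) v b = Re (cnj d / of_real ((cmod d)\<^sup>2) * d)"
    unfolding lf by (simp only: minus_complex.sel(1)[symmetric] right_diff_distrib[symmetric] d_def)
  also have "cnj d / of_real ((cmod d)\<^sup>2) * d = 1"
    unfolding complex_norm_square using d by simp
  finally have diff: "lin_form (Suc k) v a - lin_form (Suc k) v b = 1" by simp
  show ?thesis
  proof (rule bexI)
    let ?p = "\<lambda>x. cos (lin_form (Suc k) v x + - lin_form (Suc k) v b)"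
    show "?p \<in> trig_functions" by (rule trig_functions.cos)
    show "?p a \<noteq> ?p b" using cos_monotone_0_pi[of 0 1] pi_gt3 diff by simp
  qed
qed

lemma trig_dense:
  assumes "R > 0" "continuous_on (coeff_box R L) h" "e > 0"
  shows "\<exists>p\<in>trig_functions. \<forall>a\<in>coeff_box R L. \<bar>h a - p a\<bar> < e"
proof -
  interpret function_ring_on trig_functions "coeff_box R L"
    by unfold_locales
       (auto intro: compact_coeff_box assms trig_continuous trig_functions.add trig_mult trig_const trig_separates)
  show ?thesis by (rule Stone_Weierstrass_basic[OF assms(2,3)])
qed

lemma trig_polynomial_compose:
  assumes "p \<in> trig_functions" "real_polynomial_function q"
  shows "(\<lambda>a. q (p a)) \<in> trig_functions"
  using assms(2)
proof induction
  case (linear f)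
  then obtain c where "f = (\<lambda>x. x * c)" using real_bounded_linear by blast
  then show ?case using trig_functions.scale[OF assms(1), of c] by (simp add: mult.commute)
next
  case (const c)
  then show ?case by (rule trig_const)
next
  case (add f g)
  then show ?case by (intro trig_functions.add)
next
  case (mult f g)
  then show ?case by (intro trig_mult)
qed

text \<open>
  Stone-Weierstrass controls the approximant only on the box. Off the box it could be much larger than
  \<open>h\<close>, which would spoil the tail estimate. Composing it with a polynomial that is close to the
  truncation at level \<open>B\<close> repairs this: the range of the first approximant is bounded, so Weierstrass
  approximation of the truncation on that range suffices.
\<close>
lemma trig_dense_bounded:
  assumes "R > 0" "continuous_on (coeff_box R L) h" "e > 0" "\<And>a. \<bar>h a\<bar> \<le> B"
  shows "\<exists>p\<in>trig_functions. (\<forall>a\<in>coeff_box R L. \<bar>h a - p a\<bar> \<le> 2 * e) \<and> (\<forall>a. \<bar>p a\<bar> \<le> B + e)"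
proof -
  have B: "B \<ge> 0" by (rule order.trans[OF abs_ge_zero[of "h undefined"] assms(4)])
  obtain p where p: "p \<in> trig_functions" "\<And>a. a \<in> coeff_box R L \<Longrightarrow> \<bar>h a - p a\<bar> < e"
    using trig_dense[OF assms(1-3)] by blast
  obtain C where C: "\<And>a. \<bar>p a\<bar> \<le> C" using trig_bounded[OF p(1)] by blast
  define clamp where "clamp y = max (- B) (min B y)" for y :: real
  have "continuous_on {-C..C} clamp" unfolding clamp_def by (intro continuous_intros)
  then obtain q where q: "real_polynomial_function q" "\<And>y. y \<in> {-C..C} \<Longrightarrow> \<bar>clamp y - q y\<bar> < e"
    using Stone_Weierstrass_real_polynomial_function[OF compact_Icc _ assms(3)] by blast
  show ?thesis
  proof (intro bexI[of _ "\<lambda>a. q (p a)"] conjI ballI allI)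
    show "(\<lambda>a. q (p a)) \<in> trig_functions" by (rule trig_polynomial_compose[OF p(1) q(1)])
    have qp: "\<bar>clamp (p a) - q (p a)\<bar> < e" for a
      using q(2)[of "p a"] C[of a] by (simp add: abs_le_iff)
    show "\<bar>q (p a)\<bar> \<le> B + e" for a
      using qp[of a] B by (auto simp: clamp_def max_def min_def split: if_splits)
    show "\<bar>h a - q (p a)\<bar> \<le> 2 * e" if "a \<in> coeff_box R L" for a
      using qp[of a] p(2)[OF that] assms(4)[of a] B by (auto simp: clamp_def max_def min_def split: if_splits)
  qed
qed

lemma (in prob_space) expectation_approx_off_event:
  fixes Y :: "'a \<Rightarrow> 'b::topological_space" and h p :: "'b \<Rightarrow> real"
  assumes [measurable]: "Y \<in> borel_measurable M" "S \<in> sets borel"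
    and [measurable]: "h \<in> borel_measurable borel" "p \<in> borel_measurable borel"
    and "\<And>a. \<bar>h a\<bar> \<le> B" "\<And>a. \<bar>p a\<bar> \<le> C" "\<And>a. a \<in> S \<Longrightarrow> \<bar>h a - p a\<bar> \<le> d" "d \<ge> 0"
    and "prob {\<omega>\<in>space M. Y \<omega> \<notin> S} \<le> \<epsilon>"
  shows "\<bar>expectation (\<lambda>\<omega>. h (Y \<omega>)) - expectation (\<lambda>\<omega>. p (Y \<omega>))\<bar> \<le> d + (B + C) * \<epsilon>"
proof -
  have BC: "B + C \<ge> 0" using assms(5)[of undefined] assms(6)[of undefined] by linarith
  have i: "integrable M (\<lambda>\<omega>. h (Y \<omega>))" "integrable M (\<lambda>\<omega>. p (Y \<omega>))"
    by (rule integrable_const_bound[of _ B]; use assms in auto) (rule integrable_const_bound[of _ C]; use assms in auto)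
  let ?E = "{\<omega>\<in>space M. Y \<omega> \<notin> S}"
  have E: "?E \<in> sets M" by measurable
  have "\<bar>expectation (\<lambda>\<omega>. h (Y \<omega>)) - expectation (\<lambda>\<omega>. p (Y \<omega>))\<bar> = \<bar>expectation (\<lambda>\<omega>. h (Y \<omega>) - p (Y \<omega>))\<bar>"
    using i by simp
  also have "\<dots> \<le> expectation (\<lambda>\<omega>. \<bar>h (Y \<omega>) - p (Y \<omega>)\<bar>)"
    by (rule integral_abs_bound)
  also have "\<dots> \<le> expectation (\<lambda>\<omega>. d + (B + C) * indicator ?E \<omega>)"
  proof (rule integral_mono)
    show "integrable M (\<lambda>\<omega>. \<bar>h (Y \<omega>) - p (Y \<omega>)\<bar>)" using i by auto
    show "integrable M (\<lambda>\<omega>. d + (B + C) * indicator ?E \<omega>)"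
      by (intro Bochner_Integration.integrable_add integrable_mult_right integrable_real_indicator E) (auto simp: emeasure_eq_measure)
    fix \<omega> assume "\<omega> \<in> space M"
    then show "\<bar>h (Y \<omega>) - p (Y \<omega>)\<bar> \<le> d + (B + C) * indicator ?E \<omega>"
      using assms(7)[of "Y \<omega>"] assms(5)[of "Y \<omega>"] assms(6)[of "Y \<omega>"] assms(8) by (auto split: split_indicator)
  qed
  also have "\<dots> = d + (B + C) * prob ?E"
    using E by (subst Bochner_Integration.integral_add) (auto simp: prob_space emeasure_eq_measure)
  also have "\<dots> \<le> d + (B + C) * \<epsilon>" using BC assms(9) by (intro add_left_mono mult_left_mono)
  finally show ?thesis .
qed

text \<open>
  Levy's continuity theorem in the product space of sequences. Tightness is assumed in the form of
  compact boxes, which is why continuity of \<open>h\<close> on the boxes is the right hypothesis.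
\<close>
lemma coeff_weak_convergence:
  fixes M :: "'a measure" and M' :: "'b measure" and h :: "(nat \<Rightarrow> complex) \<Rightarrow> real"
  assumes M: "prob_space M" and M': "prob_space M'"
    and A[measurable]: "\<And>N. A N \<in> borel_measurable M" and B[measurable]: "B \<in> borel_measurable M'"
    and char: "\<And>m v \<theta>. (\<lambda>N. LINT \<omega>|M. cos (lin_form m v (A N \<omega>) + \<theta>)) \<longlonglongrightarrow> (LINT \<omega>|M'. cos (lin_form m v (B \<omega>) + \<theta>))"
    and R: "R > 0"
    and tight: "\<And>\<epsilon>. \<epsilon> > 0 \<Longrightarrow> \<exists>L. (\<forall>N. measure M {\<omega>\<in>space M. A N \<omega> \<notin> coeff_box R L} \<le> \<epsilon>)
                  \<and> measure M' {\<omega>\<in>space M'. B \<omega> \<notin> coeff_box R L} \<le> \<epsilon>"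
    and h[measurable]: "h \<in> borel_measurable borel" and bdd: "\<And>a. \<bar>h a\<bar> \<le> C"
    and cont: "\<And>L. continuous_on (coeff_box R L) h"
  shows "(\<lambda>N. LINT \<omega>|M. h (A N \<omega>)) \<longlonglongrightarrow> (LINT \<omega>|M'. h (B \<omega>))"
proof -
  interpret M: prob_space M by fact
  interpret M': prob_space M' by fact
  have trig: "(\<lambda>N. LINT \<omega>|M. p (A N \<omega>)) \<longlonglongrightarrow> (LINT \<omega>|M'. p (B \<omega>))" if "p \<in> trig_functions" for p
    using that
  proof induction
    case (cos m v \<theta>)
    then show ?case by (rule char)
  next
    case (scale p c)
    then show ?case by (auto intro: tendsto_mult_left)
  next
    case (add p q)
    have int: "integrable M (\<lambda>\<omega>. p (A N \<omega>))" "integrable M' (\<lambda>\<omega>. p (B \<omega>))" if p[measurable]: "p \<in> trig_functions" for p N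
    proof -
      obtain K where K: "\<And>a. \<bar>p a\<bar> \<le> K" using trig_bounded[OF p] by blast
      have [measurable]: "p \<in> borel_measurable borel" using p by (rule trig_measurable)
      show "integrable M (\<lambda>\<omega>. p (A N \<omega>))" by (rule M.integrable_const_bound[of _ K]) (use K in auto)
      show "integrable M' (\<lambda>\<omega>. p (B \<omega>))" by (rule M'.integrable_const_bound[of _ K]) (use K in auto)
    qed
    have "(\<lambda>N. (LINT \<omega>|M. p (A N \<omega>)) + (LINT \<omega>|M. q (A N \<omega>)))
        \<longlonglongrightarrow> (LINT \<omega>|M'. p (B \<omega>)) + (LINT \<omega>|M'. q (B \<omega>))"
      by (rule tendsto_add[OF add.IH])
    then show ?case
      using int[OF add.hyps(1)] int[OF add.hyps(2)] by (simp only: Bochner_Integration.integral_add)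
  qed
  have C: "C \<ge> 0" by (rule order.trans[OF abs_ge_zero[of "h undefined"] bdd])
  show ?thesis
  proof (rule LIMSEQ_I)
    fix e :: real assume e: "e > 0"
    \<comment> \<open>Chosen so that two approximation errors and one error from the limit add up to at most \<open>e\<close>.\<close>
    define \<eta> where "\<eta> = min 1 (e / (2 * (2 * C + 1) + 5))"
    have \<eta>: "0 < \<eta>" "\<eta> \<le> 1" "\<eta> * (2 * (2 * C + 1) + 5) \<le> e"
    proof -
      have "0 < 4 * C + 7" using C by linarith
      then have pos: "2 * (2 * C + 1) + 5 > 0" by (simp add: algebra_simps)
      then show "0 < \<eta>" "\<eta> \<le> 1" using e by (auto simp: \<eta>_def)
      have "\<eta> \<le> e / (2 * (2 * C + 1) + 5)" by (simp add: \<eta>_def)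
      then show "\<eta> * (2 * (2 * C + 1) + 5) \<le> e" using pos by (simp add: field_simps)
    qed
    obtain L where L: "\<And>N. measure M {\<omega>\<in>space M. A N \<omega> \<notin> coeff_box R L} \<le> \<eta>"
         "measure M' {\<omega>\<in>space M'. B \<omega> \<notin> coeff_box R L} \<le> \<eta>"
      using tight[OF \<eta>(1)] by blast
    obtain p where p: "p \<in> trig_functions" "\<And>a. a \<in> coeff_box R L \<Longrightarrow> \<bar>h a - p a\<bar> \<le> 2 * \<eta>" "\<And>a. \<bar>p a\<bar> \<le> C + \<eta>"
      using trig_dense_bounded[OF R cont \<eta>(1) bdd] by blast
    have pm: "p \<in> borel_measurable borel" by (rule trig_measurable[OF p(1)])
    have 1: "\<bar>(LINT \<omega>|M. h (A N \<omega>)) - (LINT \<omega>|M. p (A N \<omega>))\<bar> \<le> 2 * \<eta> + (C + (C + \<eta>)) * \<eta>" for N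
      by (rule M.expectation_approx_off_event[OF A coeff_box_sets h pm bdd p(3,2) _ L(1)]) (use \<eta> in auto)
    have 2: "\<bar>(LINT \<omega>|M'. h (B \<omega>)) - (LINT \<omega>|M'. p (B \<omega>))\<bar> \<le> 2 * \<eta> + (C + (C + \<eta>)) * \<eta>"
      by (rule M'.expectation_approx_off_event[OF B coeff_box_sets h pm bdd p(3,2) _ L(2)]) (use \<eta> in auto)
    have "(C + (C + \<eta>)) * \<eta> \<le> (2 * C + 1) * \<eta>" using \<eta> C by (intro mult_right_mono) auto
    then have le: "2 * (2 * \<eta> + (C + (C + \<eta>)) * \<eta>) + \<eta> \<le> e"
      using \<eta>(3) by (simp add: algebra_simps)
    obtain N0 where N0: "\<And>N. N \<ge> N0 \<Longrightarrow> \<bar>(LINT \<omega>|M. p (A N \<omega>)) - (LINT \<omega>|M'. p (B \<omega>))\<bar> < \<eta>"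
      using LIMSEQ_D[OF trig[OF p(1)] \<eta>(1)] by auto
    show "\<exists>no. \<forall>N\<ge>no. norm ((LINT \<omega>|M. h (A N \<omega>)) - (LINT \<omega>|M'. h (B \<omega>))) < e"
    proof (intro exI allI impI)
      fix N assume "N \<ge> N0"
      have tri: "\<bar>x - y\<bar> < e" if "\<bar>u - v\<bar> < \<eta>" "\<bar>x - u\<bar> \<le> K" "\<bar>y - v\<bar> \<le> K" "2 * K + \<eta> \<le> e" for x y u v K
        using that by linarith
      show "norm ((LINT \<omega>|M. h (A N \<omega>)) - (LINT \<omega>|M'. h (B \<omega>))) < e"
        unfolding real_norm_def by (rule tri[OF N0[OF \<open>N \<ge> N0\<close>] 1 2 le])
    qed
  qed
qed

section \<open>Hermite polynomials and tilted Gaussian expectations\<close>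

text \<open>
  The integrand of the expectation of \<open>exp (a X) p(X)\<close> for a standard normal \<open>X\<close>. For real \<open>a\<close>
  that expectation is, up to the factor \<open>exp (a\<^sup>2 / 2)\<close>, the expectation of \<open>p\<close> under the normal law
  with mean \<open>a\<close> and variance 1; complex \<open>a\<close> is needed for the means and pseudo-covariances.
\<close>
abbreviation tilted :: "complex \<Rightarrow> complex poly \<Rightarrow> real \<Rightarrow> complex" where
  "tilted a p x \<equiv> std_normal_density x *\<^sub>R (exp (a * of_real x) * poly p (of_real x))"

definition tilt :: "complex \<Rightarrow> complex poly \<Rightarrow> complex" where
  "tilt a p = (LINT x|lborel. tilted a p x)"

lemma std_normal_tilt:
  "std_normal_density x * exp (s * x) = exp (s\<^sup>2 / 2) * normal_density s 1 x"
proof -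
  have "- x\<^sup>2 / 2 + s * x = s\<^sup>2 / 2 + - (x - s)\<^sup>2 / 2"
    by (simp add: power2_eq_square field_simps)
  then have "exp (- x\<^sup>2 / 2) * exp (s * x) = exp (s\<^sup>2 / 2) * exp (- (x - s)\<^sup>2 / 2)"
    by (metis exp_add)
  then show ?thesis by (simp add: normal_density_def)
qed

text \<open>
  Completing the square absorbs the real part of the exponent into a shift of the normal density, after
  which only absolute moments about the new mean remain.
\<close>
lemma integrable_tilt:
  "integrable lborel (\<lambda>x. tilted a p x)"
proof -
  define s where "s = Re a"
  define q where "q = pcompose p [:of_real s, 1:]"
  have pq: "poly p (of_real x) = poly q (of_real (x - s))" for x
    by (simp add: q_def poly_pcompose)
  have "integrable lborel (\<lambda>x. exp (s\<^sup>2 / 2) * (\<Sum>i\<le>degree q. norm (coeff q i) * (normal_density s 1 x * \<bar>x - s\<bar> ^ i)))"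
    by (intro integrable_mult_right Bochner_Integration.integrable_sum integrable_normal_moment_abs) auto
  then show ?thesis
  proof (rule Bochner_Integration.integrable_bound)
    show "AE x in lborel. norm (tilted a p x)
      \<le> norm (exp (s\<^sup>2 / 2) * (\<Sum>i\<le>degree q. norm (coeff q i) * (normal_density s 1 x * \<bar>x - s\<bar> ^ i)))"
    proof (rule AE_I2)
      fix x :: real
      have "norm (tilted a p x)
        = (std_normal_density x * exp (s * x)) * norm (poly q (of_real (x - s)))"
        by (simp add: norm_mult s_def pq)
      also have "\<dots> \<le> (std_normal_density x * exp (s * x)) * (\<Sum>i\<le>degree q. norm (coeff q i) * \<bar>x - s\<bar> ^ i)"
        unfolding poly_altdef
        by (intro mult_left_mono order.trans[OF norm_sum] sum_mono)
           (auto simp: norm_mult norm_power simp del: of_real_diff)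
      also have "\<dots> = exp (s\<^sup>2 / 2) * (\<Sum>i\<le>degree q. norm (coeff q i) * (normal_density s 1 x * \<bar>x - s\<bar> ^ i))"
        unfolding std_normal_tilt by (simp add: sum_distrib_left mult_ac)
      also have "\<dots> \<le> norm \<dots>" by simp
      finally show "norm (tilted a p x)
      \<le> norm (exp (s\<^sup>2 / 2) * (\<Sum>i\<le>degree q. norm (coeff q i) * (normal_density s 1 x * \<bar>x - s\<bar> ^ i)))" .
    qed
  next
    have [measurable]: "(\<lambda>x. poly p (complex_of_real x)) \<in> borel_measurable borel"
      by (intro borel_measurable_continuous_onI continuous_intros)
    show "(\<lambda>x. tilted a p x) \<in> borel_measurable lborel"
      by measurable
  qed
qed

lemma tilt_add: "tilt a (p + q) = tilt a p + tilt a q"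
proof -
  have "tilt a (p + q) = (LINT x|lborel. tilted a p x
       + tilted a q x)"
    unfolding tilt_def by (intro Bochner_Integration.integral_cong) (auto simp: algebra_simps scaleR_add_right)
  also have "\<dots> = tilt a p + tilt a q"
    unfolding tilt_def by (intro Bochner_Integration.integral_add integrable_tilt)
  finally show ?thesis .
qed

lemma tilt_smult: "tilt a (smult c p) = c * tilt a p"
proof -
  have "tilt a (smult c p) = (LINT x|lborel. c * (tilted a p x))"
    unfolding tilt_def by (intro Bochner_Integration.integral_cong) (auto simp: algebra_simps)
  also have "\<dots> = c * tilt a p"
    unfolding tilt_def by (rule integral_mult_right_zero)
  finally show ?thesis .
qed

lemma tilt_0 [simp]: "tilt a 0 = 0"
  by (simp add: tilt_def)

lemma tilt_diff: "tilt a (p - q) = tilt a p - tilt a q"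
  using tilt_add[of a p "smult (-1) q"] tilt_smult[of a "-1" q] by simp

lemma tilt_sum: "tilt a (\<Sum>i\<in>I. p i) = (\<Sum>i\<in>I. tilt a (p i))"
  by (induction I rule: infinite_finite_induct) (auto simp: tilt_add)

lemma tilt_1: "tilt a 1 = exp (a\<^sup>2 / 2)"
proof -
  define s t where "s = Re a" and "t = Im a"
  have a: "a = of_real s + \<i> * of_real t" by (simp add: s_def t_def complex_eq)
  have "tilt a 1 = (LINT x|lborel. of_real (exp (s\<^sup>2 / 2)) * (normal_density s 1 x *\<^sub>R iexp (t * x)))"
    unfolding tilt_def
  proof (intro Bochner_Integration.integral_cong refl)
    fix x :: real
    have "exp (a * of_real x) = of_real (exp (s * x)) * iexp (t * x)"
      by (simp add: a algebra_simps exp_add exp_of_real[symmetric])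
    then have "std_normal_density x *\<^sub>R (exp (a * of_real x) * poly 1 (of_real x :: complex))
      = of_real (std_normal_density x * exp (s * x)) * iexp (t * x)"
      by (simp add: scaleR_conv_of_real)
    also have "\<dots> = of_real (exp (s\<^sup>2 / 2)) * (normal_density s 1 x *\<^sub>R iexp (t * x))"
      unfolding std_normal_tilt by (simp add: scaleR_conv_of_real)
    finally show "std_normal_density x *\<^sub>R (exp (a * of_real x) * poly 1 (of_real x :: complex)) =
       of_real (exp (s\<^sup>2 / 2)) * (normal_density s 1 x *\<^sub>R iexp (t * x))" .
  qed
  also have "\<dots> = of_real (exp (s\<^sup>2 / 2)) * (LINT x|lborel. normal_density s 1 x *\<^sub>R iexp (t * x))"
    by (rule integral_mult_right_zero)
  also have "(LINT x|lborel. normal_density s 1 x *\<^sub>R iexp (t * x)) =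
      (LINT x|lborel. normal_density s 1 (s + 1 * x) *\<^sub>R iexp (t * (s + 1 * x)))"
    by (subst lborel_integral_real_affine[where c = 1 and t = s]) auto
  also have "\<dots> = (LINT x|lborel. iexp (t * s) * (std_normal_density x *\<^sub>R iexp (t * x)))"
    by (intro Bochner_Integration.integral_cong) (auto simp: normal_density_def algebra_simps exp_add)
  also have "\<dots> = iexp (t * s) * (LINT x|lborel. std_normal_density x *\<^sub>R iexp (t * x))"
    by (rule integral_mult_right_zero)
  also have "(LINT x|lborel. std_normal_density x *\<^sub>R iexp (t * x)) = char std_normal_distribution t"
    unfolding char_def by (subst integral_density) auto
  also have "\<dots> = of_real (exp (- (t^2) / 2))"
    by (simp add: char_std_normal_distribution)
  also have "of_real (exp (s\<^sup>2 / 2)) * (iexp (t * s) * of_real (exp (- (t^2) / 2))) = exp (a\<^sup>2 / 2)"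
    unfolding exp_of_real[symmetric] exp_add[symmetric]
    by (rule arg_cong[where f = exp]) (simp add: a power2_eq_square algebra_simps add_divide_distrib diff_divide_distrib)
  finally show ?thesis .
qed

lemma gauss_exp_power_tendsto_0:
  fixes a :: complex
  shows "((\<lambda>x. std_normal_density x *\<^sub>R (exp (a * of_real x) * of_real x ^ k)) \<longlongrightarrow> 0) at_top"
    and "((\<lambda>x. std_normal_density x *\<^sub>R (exp (a * of_real x) * of_real x ^ k)) \<longlongrightarrow> 0) at_bot"
proof -
  have main: "((\<lambda>x. std_normal_density x *\<^sub>R (exp (a * of_real x) * of_real x ^ k)) \<longlongrightarrow> 0) at_top" for a :: complex
  proof (rule Lim_null_comparison)
    define s where "s = Re a"
    show "\<forall>\<^sub>F x in at_top. norm (std_normal_density x *\<^sub>R (exp (a * of_real x) * of_real x ^ k))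
          \<le> exp ((s+1)\<^sup>2 / 2) * (x ^ k / exp x)"
    proof (rule eventually_at_top_linorderI[of 0])
      fix x :: real assume x: "x \<ge> 0"
      have le1: "normal_density (s+1) 1 x \<le> 1"
      proof -
        have "1 \<le> sqrt (2 * pi)" using pi_gt3 by (simp add: real_le_rsqrt)
        moreover have "exp (- (x - (s+1))\<^sup>2 / 2) \<le> 1" by simp
        ultimately have "exp (- (x - (s+1))\<^sup>2 / 2) \<le> sqrt (2 * pi)"
          by (rule order.trans[rotated])
        then show ?thesis
          using pi_gt_zero unfolding normal_density_def by (simp add: divide_simps)
      qed
      have "norm (std_normal_density x *\<^sub>R (exp (a * of_real x) * of_real x ^ k))
        = std_normal_density x * exp (s * x) * x ^ k"
        using x by (simp add: norm_mult norm_power s_def)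
      also have "\<dots> = (std_normal_density x * exp ((s+1) * x)) * (x ^ k / exp x)"
        by (simp add: algebra_simps exp_add)
      also have "\<dots> = exp ((s+1)\<^sup>2 / 2) * (x ^ k / exp x) * normal_density (s+1) 1 x"
        unfolding std_normal_tilt by simp
      also have "\<dots> \<le> exp ((s+1)\<^sup>2 / 2) * (x ^ k / exp x) * 1"
        by (intro mult_left_mono le1) (use x in auto)
      finally show "norm (std_normal_density x *\<^sub>R (exp (a * of_real x) * of_real x ^ k))
          \<le> exp ((s+1)\<^sup>2 / 2) * (x ^ k / exp x)" by simp
    qed
    show "((\<lambda>x. exp ((s+1)\<^sup>2 / 2) * (x ^ k / exp x)) \<longlongrightarrow> 0) at_top"
      by (rule tendsto_mult_right_zero[OF tendsto_power_div_exp_0])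
  qed
  show "((\<lambda>x. std_normal_density x *\<^sub>R (exp (a * of_real x) * of_real x ^ k)) \<longlongrightarrow> 0) at_top"
    by (rule main)
  have "((\<lambda>x. (-1)^k * (std_normal_density x *\<^sub>R (exp (- a * of_real x) * of_real x ^ k))) \<longlongrightarrow> 0) at_top"
    by (rule tendsto_mult_right_zero[OF main])
  then show "((\<lambda>x. std_normal_density x *\<^sub>R (exp (a * of_real x) * of_real x ^ k)) \<longlongrightarrow> 0) at_bot"
    unfolding at_bot_mirror filterlim_filtermap
    by (rule Lim_transform_eventually)
       (auto simp: normal_density_def power_minus[of "of_real _"] intro!: always_eventually)
qed

text \<open>
  Stein's identity for the tilted law: \<open>pderiv p - (x - a) p\<close> times the weight \<open>exp (a x - x\<^sup>2/2)\<close> is the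
  derivative of \<open>p\<close> times that weight, and the latter vanishes at both ends of the line.
\<close>
lemma tilt_stein: "tilt a ([:- a, 1:] * p) = tilt a (pderiv p)"
proof -
  define F where "F x = tilted a p x" for x
  define f where "f x = tilted a (pderiv p - [:- a, 1:] * p) x" for x
  have F_alt: "F = (\<lambda>x. of_real (1 / sqrt (2 * pi)) * (exp (- (of_real x)\<^sup>2 / 2) * (exp (a * of_real x) * poly p (of_real x))))"
    by (auto simp: F_def std_normal_density_def scaleR_conv_of_real exp_of_real[symmetric] fun_eq_iff)
  have f_alt: "f = (\<lambda>x. of_real (1 / sqrt (2 * pi)) * (exp (- (of_real x)\<^sup>2 / 2) * (exp (a * of_real x) * poly (pderiv p - [:- a, 1:] * p) (of_real x))))"
    by (auto simp: f_def std_normal_density_def scaleR_conv_of_real exp_of_real[symmetric] fun_eq_iff)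
  have deriv: "(F has_vector_derivative f x) (at x)" for x
  proof -
    define G where "G z = of_real (1 / sqrt (2 * pi)) * (exp (- z\<^sup>2 / 2) * (exp (a * z) * poly p z))" for z
    define g where "g z = of_real (1 / sqrt (2 * pi)) * (exp (- z\<^sup>2 / 2) * (exp (a * z) * poly (pderiv p - [:- a, 1:] * p) z))" for z
    have "(G has_field_derivative g z) (at z)" for z
      unfolding G_def g_def by (auto intro!: derivative_eq_intros simp: field_simps)
    then have "((\<lambda>x. G (of_real x)) has_vector_derivative g (of_real x)) (at x)"
      by (rule has_vector_derivative_real_field)
    then show ?thesis by (simp add: F_alt f_alt G_def g_def)
  qed
  have cont: "isCont f x" for x
    unfolding f_alt by (intro continuous_intros) auto
  have lim: "(F \<longlongrightarrow> 0) at_top" "(F \<longlongrightarrow> 0) at_bot"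
  proof -
    have F_sum: "F = (\<lambda>x. \<Sum>i\<le>degree p. coeff p i * (std_normal_density x *\<^sub>R (exp (a * of_real x) * of_real x ^ i)))"
      by (auto simp: F_def poly_altdef fun_eq_iff sum_distrib_left scaleR_sum_right mult_ac intro!: sum.cong)
    show "(F \<longlongrightarrow> 0) at_top" "(F \<longlongrightarrow> 0) at_bot"
      unfolding F_sum by (intro tendsto_null_sum tendsto_mult_right_zero gauss_exp_power_tendsto_0)+
  qed
  have int: "integrable lborel f" unfolding f_def by (rule integrable_tilt)
  have "(LBINT x=-\<infinity>..\<infinity>. f x) = 0 - 0"
  proof (rule interval_integral_FTC_integrable)
    show "set_integrable lborel (einterval (-\<infinity>) \<infinity>) f"
      using int by (simp add: set_integrable_def)
    show "((F \<circ> real_of_ereal) \<longlongrightarrow> 0) (at_right (-\<infinity>))" "((F \<circ> real_of_ereal) \<longlongrightarrow> 0) (at_left \<infinity>)"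
      using lim by (simp_all add: ereal_tendsto_simps)
  qed (use deriv cont in auto)
  then have "(LINT x|lborel. f x) = 0"
    by (simp add: interval_lebesgue_integral_def set_lebesgue_integral_def)
  then have "tilt a (pderiv p - [:- a, 1:] * p) = 0"
    by (simp add: tilt_def f_def)
  then show ?thesis by (simp add: tilt_diff)
qed

text \<open>
  The probabilists' Hermite polynomials. The recursion is the form to which Stein's identity applies
  directly.
\<close>
fun hermite :: "nat \<Rightarrow> complex poly" where
  "hermite 0 = 1"
| "hermite (Suc k) = [:0, 1:] * hermite k - pderiv (hermite k)"

lemma pderiv_hermite_Suc: "pderiv (hermite (Suc k)) = smult (of_nat (Suc k)) (hermite k)"
proof (induction k)
  case 0
  then show ?case by (simp add: pderiv_pCons)
next
  case (Suc k)
  have "pderiv (hermite (Suc (Suc k))) = hermite (Suc k) + [:0,1:] * pderiv (hermite (Suc k)) - pderiv (pderiv (hermite (Suc k)))"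
    by (subst hermite.simps(2)) (simp only: pderiv_diff pderiv_mult, simp add: pderiv_pCons)
  also have "\<dots> = hermite (Suc k) + smult (of_nat (Suc k)) ([:0,1:] * hermite k - pderiv (hermite k))"
    by (simp only: Suc pderiv_smult) (simp add: smult_diff_right)
  also have "\<dots> = smult (of_nat (Suc (Suc k))) (hermite (Suc k))"
    by (simp only: hermite.simps(2)[symmetric]) (simp only: of_nat_Suc[of "Suc k"] smult_add_left smult_1_left)
  finally show ?case .
qed

definition shifted_hermite :: "complex \<Rightarrow> nat \<Rightarrow> complex poly" where
  "shifted_hermite b k = pcompose (hermite k) [:- b, 1:]"

lemma shifted_hermite_0 [simp]: "shifted_hermite b 0 = 1"
  by (simp add: shifted_hermite_def pcompose_1)

lemma shifted_hermite_Suc: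
  "shifted_hermite b (Suc k) = [:- b, 1:] * shifted_hermite b k - pderiv (shifted_hermite b k)"
  by (simp add: shifted_hermite_def pcompose_diff pcompose_mult pcompose_pCons pderiv_pcompose pderiv_pCons)

lemma pderiv_shifted_hermite_Suc:
  "pderiv (shifted_hermite b (Suc k)) = smult (of_nat (Suc k)) (shifted_hermite b k)"
  unfolding shifted_hermite_def pderiv_pcompose pderiv_hermite_Suc
  by (simp add: pcompose_smult pderiv_pCons)

text \<open>
  Under the tilted law, multiplication by \<open>x - a\<close> is adjoint to differentiation. Raising the index of the
  Hermite factor therefore differentiates the other factor, up to the mismatch \<open>a - b\<close> between the tilt
  and the centre of the polynomials. The next two lemmas are the cases \<open>q = 1\<close> and \<open>a = b\<close>.
\<close>
lemma tilt_shifted_hermite_Suc_mult: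
  "tilt a (shifted_hermite b (Suc k) * q)
     = (a - b) * tilt a (shifted_hermite b k * q) + tilt a (shifted_hermite b k * pderiv q)"
proof -
  let ?h = "shifted_hermite b k"
  have "[:- b, 1:] = [:- a, 1:] + [:a - b:]" by simp
  then have "shifted_hermite b (Suc k) * q = [:- a, 1:] * (?h * q) + smult (a - b) (?h * q) - pderiv (?h * q) + ?h * pderiv q"
    by (simp only: shifted_hermite_Suc pderiv_mult) (simp add: algebra_simps smult_diff_left)
  then show ?thesis
    by (simp only: tilt_add tilt_diff tilt_smult tilt_stein) simp
qed

lemma tilt_shifted_hermite: "tilt a (shifted_hermite b k) = (a - b) ^ k * exp (a\<^sup>2 / 2)"
proof (induction k)
  case (Suc k)
  then show ?case using tilt_shifted_hermite_Suc_mult[of a b k 1] by simp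
qed (simp add: tilt_1)

lemma tilt_shifted_hermite_orthogonal:
  "tilt b (shifted_hermite b k * shifted_hermite b l) = (if k = l then fact k * exp (b\<^sup>2 / 2) else 0)"
proof (induction k arbitrary: l)
  case 0
  then show ?case by (simp add: tilt_shifted_hermite)
next
  case (Suc k)
  show ?case
  proof (cases l)
    case 0
    then show ?thesis by (simp add: tilt_shifted_hermite)
  next
    case (Suc l')
    have "tilt b (shifted_hermite b (Suc k) * shifted_hermite b (Suc l'))
      = of_nat (Suc l') * tilt b (shifted_hermite b k * shifted_hermite b l')"
      unfolding tilt_shifted_hermite_Suc_mult[of b b k] pderiv_shifted_hermite_Suc
      by (simp only: mult_smult_right tilt_smult) simp
    then show ?thesis unfolding Suc Suc.IH by (simp add: algebra_simps)
  qed
qed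

text \<open>
  Each application of Stein's identity lowers the degree at the price of at most one factor \<open>a - b\<close>.
\<close>
lemma tilt_polynomial_bound:
  "\<exists>C\<ge>0. \<exists>d. \<forall>a b. cmod (tilt a (pcompose Q [:- b, 1:])) \<le> C * cmod (exp (a\<^sup>2 / 2)) * (1 + cmod (a - b)) ^ d"
proof (induction "degree Q" arbitrary: Q rule: less_induct)
  case less
  show ?case
  proof (cases "degree Q = 0")
    case True
    then obtain c where Q: "Q = [:c:]" using degree_eq_zeroE by blast
    have "[:c:] = smult c 1" by simp
    then have "cmod (tilt a (pcompose Q [:- b, 1:])) \<le> cmod c * cmod (exp (a\<^sup>2 / 2)) * (1 + cmod (a - b)) ^ 0" for a b
      unfolding Q pcompose_const by (simp only: tilt_smult tilt_1) (simp add: norm_mult)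
    then show ?thesis using norm_ge_zero by blast
  next
    case False
    obtain c q where Q: "Q = pCons c q" by (cases Q)
    have dq: "degree q < degree Q" "degree (pderiv q) < degree Q"
      using False by (auto simp: Q degree_pderiv split: if_splits)
    obtain C1 d1 where 1: "C1 \<ge> 0" "\<And>a b. cmod (tilt a (pcompose q [:- b, 1:])) \<le> C1 * cmod (exp (a\<^sup>2 / 2)) * (1 + cmod (a - b)) ^ d1"
      using less[OF dq(1)] by blast
    obtain C2 d2 where 2: "C2 \<ge> 0" "\<And>a b. cmod (tilt a (pcompose (pderiv q) [:- b, 1:])) \<le> C2 * cmod (exp (a\<^sup>2 / 2)) * (1 + cmod (a - b)) ^ d2"
      using less[OF dq(2)] by blast
    define d where "d = Suc d1 + d2"
    have "cmod (tilt a (pcompose Q [:- b, 1:])) \<le> (cmod c + C1 + C2) * cmod (exp (a\<^sup>2 / 2)) * (1 + cmod (a - b)) ^ d" for a b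
    proof -
      define E D where "E = cmod (exp (a\<^sup>2 / 2))" and "D = 1 + cmod (a - b)"
      have E: "E \<ge> 0" and D: "D \<ge> 1" by (auto simp: E_def D_def)
      let ?q = "pcompose q [:- b, 1:]"
      have "pcompose Q [:- b, 1:] = smult c 1 + smult (a - b) ?q + [:- a, 1:] * ?q"
        unfolding Q pcompose_pCons by (simp add: algebra_simps smult_diff_left)
      then have "tilt a (pcompose Q [:- b, 1:]) = c * exp (a\<^sup>2 / 2) + (a - b) * tilt a ?q + tilt a (pcompose (pderiv q) [:- b, 1:])"
        by (simp only: tilt_add tilt_smult tilt_stein tilt_1 pderiv_pcompose) (simp add: pderiv_pCons)
      then have "cmod (tilt a (pcompose Q [:- b, 1:])) \<le> cmod c * E + cmod (a - b) * cmod (tilt a ?q) + cmod (tilt a (pcompose (pderiv q) [:- b, 1:]))"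
        unfolding E_def norm_mult[symmetric]
        by (metis norm_triangle_ineq norm_triangle_le add_mono order_refl)
      also have "\<dots> \<le> cmod c * E * 1 + D * (C1 * E * D ^ d1) + C2 * E * D ^ d2"
      proof (intro add_mono)
        show "cmod (a - b) * cmod (tilt a ?q) \<le> D * (C1 * E * D ^ d1)"
          using 1(2)[of a b] D by (intro mult_mono) (auto simp: E_def D_def)
        show "cmod (tilt a (pcompose (pderiv q) [:- b, 1:])) \<le> C2 * E * D ^ d2"
          using 2(2)[of a b] by (simp add: E_def D_def)
      qed simp
      also have "\<dots> = cmod c * E * 1 + C1 * E * D ^ Suc d1 + C2 * E * D ^ d2" by simp
      also have "\<dots> \<le> cmod c * E * D ^ d + C1 * E * D ^ d + C2 * E * D ^ d"
        using 1(1) 2(1) E D by (intro add_mono mult_left_mono power_increasing one_le_power) (auto simp: d_def)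
      finally show ?thesis by (simp add: E_def D_def algebra_simps)
    qed
    then show ?thesis using 1(1) 2(1) by (intro exI[of _ "cmod c + C1 + C2"] conjI exI[of _ d]) auto
  qed
qed

section \<open>Moments of a single summand\<close>

abbreviation gauss :: "real measure" where
  "gauss \<equiv> std_normal_distribution"

lemma gauss_integral_tilt:
  shows gauss_integrable: "integrable gauss (\<lambda>x. exp (a * of_real x) * poly p (of_real x :: complex))" (is ?A)
    and gauss_integral: "(LINT x|gauss. exp (a * of_real x) * poly p (of_real x :: complex)) = tilt a p" (is ?B)
proof -
  have [measurable]: "(\<lambda>x. poly p (complex_of_real x)) \<in> borel_measurable borel"
    by (intro borel_measurable_continuous_onI continuous_intros)
  have m: "(\<lambda>x. exp (a * of_real x) * poly p (of_real x :: complex)) \<in> borel_measurable lborel" by measurable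
  show ?A
    using integrable_tilt[of a p] m by (subst integrable_density) auto
  show ?B
    unfolding tilt_def using m by (subst integral_density) auto
qed

lemma cnj_poly_hermite: "cnj (poly (hermite k) z) = poly (hermite k) (cnj z)"
proof -
  have "cnj (poly (hermite k) z) = poly (hermite k) (cnj z) \<and>
        cnj (poly (hermite (Suc k)) z) = poly (hermite (Suc k)) (cnj z)"
  proof (induction k)
    case 0
    then show ?case by simp
  next
    case (Suc k)
    have "hermite (Suc (Suc k)) = [:0, 1:] * hermite (Suc k) - smult (of_nat (Suc k)) (hermite k)"
      by (simp only: hermite.simps(2)[of "Suc k"] pderiv_hermite_Suc)
    then have "poly (hermite (Suc (Suc k))) w = w * poly (hermite (Suc k)) w - of_nat (Suc k) * poly (hermite k) w" for w
      by simp
    then show ?case using Suc by (simp del: hermite.simps)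
  qed
  then show ?thesis by (simp del: hermite.simps)
qed

text \<open>
  The normalised Hermite polynomials are orthonormal for the standard normal law, so \<open>v\<close> is the
  coordinate vector of this polynomial in an orthonormal basis.
\<close>
definition hermite_combination :: "nat \<Rightarrow> (nat \<Rightarrow> complex) \<Rightarrow> complex poly" where
  "hermite_combination m v = (\<Sum>k<m. smult (v k / of_real (sqrt (fact k))) (hermite k))"

lemma hermite_combination_shift:
  "pcompose (hermite_combination m v) [:- b, 1:] = (\<Sum>k<m. smult (v k / of_real (sqrt (fact k))) (shifted_hermite b k))"
  by (simp add: hermite_combination_def pcompose_sum pcompose_smult shifted_hermite_def)

lemma cnj_hermite_combination:
  "cnj (poly (hermite_combination m v) z) = poly (hermite_combination m (\<lambda>k. cnj (v k))) (cnj z)"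
  by (simp add: hermite_combination_def poly_sum cnj_poly_hermite)

lemma hermite_combination_norm:
  "tilt b (pcompose (hermite_combination m v * hermite_combination m (\<lambda>k. cnj (v k))) [:- b, 1:])
     = exp (b\<^sup>2 / 2) * of_real (\<Sum>k<m. (cmod (v k))\<^sup>2)"
proof -
  let ?w = "\<lambda>k. of_real (sqrt (fact k)) :: complex"
  have "pcompose (hermite_combination m v * hermite_combination m (\<lambda>k. cnj (v k))) [:- b, 1:]
    = (\<Sum>k<m. \<Sum>l<m. smult (v k / ?w k * (cnj (v l) / ?w l)) (shifted_hermite b k * shifted_hermite b l))"
    unfolding pcompose_mult hermite_combination_shift sum_product
    by (intro sum.cong refl) (simp add: mult.commute)
  then have "tilt b (pcompose (hermite_combination m v * hermite_combination m (\<lambda>k. cnj (v k))) [:- b, 1:])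
    = (\<Sum>k<m. \<Sum>l<m. v k / ?w k * (cnj (v l) / ?w l) * (if k = l then fact k * exp (b\<^sup>2 / 2) else 0))"
    by (simp only: tilt_sum tilt_smult tilt_shifted_hermite_orthogonal)
  also have "\<dots> = (\<Sum>k<m. v k / ?w k * (cnj (v k) / ?w k) * (fact k * exp (b\<^sup>2 / 2)))"
    by (intro sum.cong refl) (simp add: if_distrib[where f = "\<lambda>x. _ * x"] cong: if_cong)
  also have "\<dots> = (\<Sum>k<m. exp (b\<^sup>2 / 2) * of_real ((cmod (v k))\<^sup>2))"
  proof (intro sum.cong refl)
    fix k
    have "?w k * ?w k = of_real (sqrt (fact k) * sqrt (fact k))" by (simp only: of_real_mult)
    also have "\<dots> = fact k" by simp
    finally have "?w k * ?w k = fact k" .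
    then have "v k / ?w k * (cnj (v k) / ?w k) * (fact k * exp (b\<^sup>2 / 2)) = exp (b\<^sup>2 / 2) * (v k * cnj (v k))"
      by simp
    then show "v k / ?w k * (cnj (v k) / ?w k) * (fact k * exp (b\<^sup>2 / 2)) = exp (b\<^sup>2 / 2) * of_real ((cmod (v k))\<^sup>2)"
      by (simp only: complex_norm_square)
  qed
  finally show ?thesis by (simp add: sum_distrib_left)
qed

text \<open>
  The mean of \<open>X\<close> under the law tilted by \<open>\<bar>exp (\<beta> sqrt n X)\<bar>\<^sup>2\<close>, where \<open>n = ln N\<close>.
\<close>
definition drift :: "complex \<Rightarrow> nat \<Rightarrow> real" where
  "drift \<beta> N = 2 * Re \<beta> * sqrt (ln (real N))"

text \<open>
  The contribution of one variable \<open>X_j = x\<close> to a linear combination of the Taylor coefficients of the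
  zoomed partition function. The leading constant is \<open>N^(-1/2 - (Re \<beta>)\<^sup>2)\<close>, which makes the second
  moment equal to \<open>1 / N\<close> when \<open>Q\<close> is a normalised Hermite polynomial.
\<close>
definition summand :: "complex \<Rightarrow> nat \<Rightarrow> complex poly \<Rightarrow> real \<Rightarrow> complex" where
  "summand \<beta> N Q x = of_real (exp (- (1/2 + (Re \<beta>)\<^sup>2) * ln (real N))) *
     (exp (\<beta> * of_real (sqrt (ln (real N))) * of_real x) * poly Q (of_real (x - drift \<beta> N)))"

lemma summand_alt:
  "summand \<beta> N Q x = of_real (exp (- (1/2 + (Re \<beta>)\<^sup>2) * ln (real N))) *
     (exp (\<beta> * of_real (sqrt (ln (real N))) * of_real x) * poly (pcompose Q [:- of_real (drift \<beta> N), 1:]) (of_real x))"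
  by (simp add: summand_def poly_pcompose)

lemma summand_measurable [measurable]: "summand \<beta> N Q \<in> borel_measurable borel"
  unfolding summand_alt by (intro borel_measurable_continuous_onI continuous_intros)

lemma summand_integral:
  shows summand_integrable: "integrable gauss (summand \<beta> N Q)"
    and summand_mean: "(LINT x|gauss. summand \<beta> N Q x)
      = of_real (exp (- (1/2 + (Re \<beta>)\<^sup>2) * ln (real N))) *
        tilt (\<beta> * of_real (sqrt (ln (real N)))) (pcompose Q [:- of_real (drift \<beta> N), 1:])"
  unfolding summand_alt
  by (intro integrable_mult_right gauss_integrable) (subst integral_mult_right_zero, subst gauss_integral, rule refl)

lemma cmod_exp_half_square:
  assumes "N \<ge> 1"
  shows "cmod (exp ((z * of_real (sqrt (ln (real N))))\<^sup>2 / 2)) = exp (((Re z)\<^sup>2 - (Im z)\<^sup>2) / 2 * ln (real N))"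
proof -
  have "Re ((z * of_real r)\<^sup>2 / 2) = ((Re z)\<^sup>2 - (Im z)\<^sup>2) / 2 * r\<^sup>2" for r
    by (simp add: power2_eq_square algebra_simps)
  from this[of "sqrt (ln (real N))"] show ?thesis
    using assms by simp
qed

text \<open>
  The tilt is \<open>\<beta> sqrt n\<close> and the centre is \<open>2 (Re \<beta>) sqrt n\<close>; their difference is \<open>- cnj \<beta> sqrt n\<close>, of
  modulus \<open>\<bar>\<beta>\<bar> sqrt n\<close>. The exponent is negative precisely outside the unit circle.
\<close>
lemma summand_hermite_mean:
  assumes "N \<ge> 1"
  shows "real N * cmod (LINT x|gauss. summand \<beta> N (hermite k) x)
     = exp ((1 - (cmod \<beta>)\<^sup>2) / 2 * ln (real N)) * (cmod \<beta> * sqrt (ln (real N))) ^ k"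
proof -
  let ?s = "ln (real N)"
  have s: "?s \<ge> 0" using assms by simp
  have "\<beta> * of_real (sqrt ?s) - of_real (drift \<beta> N) = - cnj \<beta> * of_real (sqrt ?s)"
    by (simp add: drift_def complex_eq_iff)
  then have d: "cmod (\<beta> * of_real (sqrt ?s) - of_real (drift \<beta> N)) = cmod \<beta> * sqrt ?s"
    using s by (simp add: norm_mult)
  have "real N * cmod (LINT x|gauss. summand \<beta> N (hermite k) x)
     = exp ?s * (exp (- (1/2 + (Re \<beta>)\<^sup>2) * ?s) * ((cmod \<beta> * sqrt ?s) ^ k * exp (((Re \<beta>)\<^sup>2 - (Im \<beta>)\<^sup>2) / 2 * ?s)))"
    unfolding summand_mean shifted_hermite_def[symmetric] tilt_shifted_hermite norm_mult norm_power d cmod_exp_half_square[OF assms]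
    using assms by simp
  also have "\<dots> = exp (?s + - (1/2 + (Re \<beta>)\<^sup>2) * ?s + ((Re \<beta>)\<^sup>2 - (Im \<beta>)\<^sup>2) / 2 * ?s) * (cmod \<beta> * sqrt ?s) ^ k"
    by (simp only: exp_add mult_ac)
  also have "?s + - (1/2 + (Re \<beta>)\<^sup>2) * ?s + ((Re \<beta>)\<^sup>2 - (Im \<beta>)\<^sup>2) / 2 * ?s = (1 - (cmod \<beta>)\<^sup>2) / 2 * ?s"
    by (simp add: cmod_power2 field_simps)
  finally show ?thesis .
qed

lemma cmod_exp_sqrt_mult:
  "cmod (exp (\<beta> * of_real r * of_real x)) = exp (Re \<beta> * r * x)"
  by simp

text \<open>
  The squared modulus of the exponential is a tilt by exactly the centre of the Hermite polynomials, so
  orthogonality applies and the value is exact for every \<open>N\<close>.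
\<close>
lemma summand_second_moment:
  fixes v :: "nat \<Rightarrow> complex" and m :: nat
  defines "Q \<equiv> hermite_combination m v"
  assumes "N \<ge> 1"
  shows "integrable gauss (\<lambda>x. (cmod (summand \<beta> N Q x))\<^sup>2)" (is ?A)
    and "real N * (LINT x|gauss. (cmod (summand \<beta> N Q x))\<^sup>2) = (\<Sum>k<m. (cmod (v k))\<^sup>2)" (is ?B)
proof -
  let ?s = "ln (real N)" let ?b = "of_real (drift \<beta> N) :: complex"
  define c where "c = exp (- (1/2 + (Re \<beta>)\<^sup>2) * ?s)"
  define Q' where "Q' = hermite_combination m (\<lambda>k. cnj (v k))"
  have s: "?s \<ge> 0" using assms by simp
  have eq: "complex_of_real ((cmod (summand \<beta> N Q x))\<^sup>2) =
     of_real (c\<^sup>2) * (exp (?b * of_real x) * poly (pcompose (Q * Q') [:- ?b, 1:]) (of_real x))" for x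
  proof -
    have "complex_of_real ((cmod (summand \<beta> N Q x))\<^sup>2) =
       of_real (c\<^sup>2) * (of_real ((exp (Re \<beta> * sqrt ?s * x))\<^sup>2) * of_real ((cmod (poly Q (of_real (x - drift \<beta> N))))\<^sup>2))"
      unfolding summand_def norm_mult cmod_exp_sqrt_mult power_mult_distrib by (simp add: c_def)
    also have "of_real ((cmod (poly Q (of_real (x - drift \<beta> N))))\<^sup>2) = poly (pcompose (Q * Q') [:- ?b, 1:]) (of_real x)"
      unfolding complex_norm_square
      by (simp only: cnj_hermite_combination Q_def Q'_def poly_pcompose poly_mult complex_cnj_complex_of_real) simp
    also have "complex_of_real ((exp (Re \<beta> * sqrt ?s * x))\<^sup>2) = exp (?b * of_real x)"
      unfolding exp_double[symmetric] by (simp add: drift_def exp_of_real[symmetric] mult_ac)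
    finally show ?thesis .
  qed
  have int: "integrable gauss (\<lambda>x. complex_of_real ((cmod (summand \<beta> N Q x))\<^sup>2))"
    unfolding eq by (intro integrable_mult_right gauss_integrable)
  show ?A
    using integrable_Re[OF int] by simp
  have "complex_of_real (LINT x|gauss. (cmod (summand \<beta> N Q x))\<^sup>2)
     = (LINT x|gauss. complex_of_real ((cmod (summand \<beta> N Q x))\<^sup>2))"
    by (rule integral_complex_of_real[symmetric])
  also have "\<dots> = of_real (c\<^sup>2) * tilt ?b (pcompose (Q * Q') [:- ?b, 1:])"
    unfolding eq integral_mult_right_zero gauss_integral ..
  also have "\<dots> = of_real (c\<^sup>2) * (exp (?b\<^sup>2 / 2) * of_real (\<Sum>k<m. (cmod (v k))\<^sup>2))"
    unfolding Q_def Q'_def hermite_combination_norm ..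
  also have "\<dots> = of_real (c\<^sup>2 * exp ((drift \<beta> N)\<^sup>2 / 2) * (\<Sum>k<m. (cmod (v k))\<^sup>2))"
    by (simp add: exp_of_real[symmetric])
  finally have I: "(LINT x|gauss. (cmod (summand \<beta> N Q x))\<^sup>2) = c\<^sup>2 * exp ((drift \<beta> N)\<^sup>2 / 2) * (\<Sum>k<m. (cmod (v k))\<^sup>2)"
    by (simp only: of_real_eq_iff)
  have "real N * (c\<^sup>2 * exp ((drift \<beta> N)\<^sup>2 / 2)) = exp ?s * (exp (2 * (- (1/2 + (Re \<beta>)\<^sup>2) * ?s)) * exp (2 * (Re \<beta>)\<^sup>2 * ?s))"
  proof -
    have "(drift \<beta> N)\<^sup>2 / 2 = 2 * (Re \<beta>)\<^sup>2 * ?s"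
      using s by (simp add: drift_def power_mult_distrib)
    moreover have "c\<^sup>2 = exp (2 * (- (1/2 + (Re \<beta>)\<^sup>2) * ?s))"
      unfolding exp_double c_def ..
    moreover have "real N = exp ?s" using assms by simp
    ultimately show ?thesis by (simp only:)
  qed
  also have "\<dots> = exp (?s + 2 * (- (1/2 + (Re \<beta>)\<^sup>2) * ?s) + 2 * (Re \<beta>)\<^sup>2 * ?s)"
    by (simp only: exp_add mult_ac)
  also have "\<dots> = 1" by (simp add: algebra_simps)
  finally show ?B
    unfolding I by (metis mult.assoc mult_1)
qed

text \<open>
  The shape of all error terms: a power of \<open>N\<close> times a polynomial in \<open>sqrt (ln N)\<close>.
\<close>
abbreviation decay :: "real \<Rightarrow> real \<Rightarrow> real \<Rightarrow> nat \<Rightarrow> nat \<Rightarrow> real" where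
  "decay \<kappa> A B d N \<equiv> exp (- \<kappa> * ln (real N)) * (A + B * sqrt (ln (real N))) ^ d"

lemma exp_decay_beats_power:
  fixes \<kappa> A B C :: real
  assumes "\<kappa> > 0"
  shows "(\<lambda>N. C * (decay \<kappa> A B d N)) \<longlonglongrightarrow> 0"
proof -
  have "((\<lambda>s. C * (exp (- \<kappa> * s) * (A + B * sqrt s) ^ d)) \<longlongrightarrow> 0) at_top"
  proof (rule tendsto_mult_right_zero, rule Lim_null_comparison)
    show "\<forall>\<^sub>F s in at_top. norm (exp (- \<kappa> * s) * (A + B * sqrt s) ^ d) \<le> ((\<bar>A\<bar> + \<bar>B\<bar>) / \<kappa>) ^ d * ((\<kappa> * s) ^ d / exp (\<kappa> * s))"
    proof (rule eventually_at_top_linorderI[of 1])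
      fix s :: real assume s: "s \<ge> 1"
      have "sqrt s \<le> s" using s by (simp add: real_le_lsqrt power2_eq_square)
      then have "\<bar>B\<bar> * sqrt s \<le> \<bar>B\<bar> * s" by (intro mult_left_mono) auto
      moreover have "\<bar>A\<bar> * 1 \<le> \<bar>A\<bar> * s" using s by (intro mult_left_mono) auto
      moreover have "\<bar>A + B * sqrt s\<bar> \<le> \<bar>A\<bar> + \<bar>B\<bar> * sqrt s"
        using s abs_triangle_ineq[of A "B * sqrt s"] by (simp add: abs_mult)
      ultimately have "\<bar>A + B * sqrt s\<bar> \<le> (\<bar>A\<bar> + \<bar>B\<bar>) * s" by (simp add: algebra_simps)
      then have "\<bar>A + B * sqrt s\<bar> ^ d \<le> ((\<bar>A\<bar> + \<bar>B\<bar>) * s) ^ d" by (intro power_mono) auto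
      also have "(\<bar>A\<bar> + \<bar>B\<bar>) * s = (\<bar>A\<bar> + \<bar>B\<bar>) / \<kappa> * (\<kappa> * s)" using assms by simp
      finally have "\<bar>A + B * sqrt s\<bar> ^ d \<le> ((\<bar>A\<bar> + \<bar>B\<bar>) / \<kappa>) ^ d * (\<kappa> * s) ^ d"
        by (simp only: power_mult_distrib)
      then have "exp (- \<kappa> * s) * \<bar>A + B * sqrt s\<bar> ^ d \<le> exp (- \<kappa> * s) * (((\<bar>A\<bar> + \<bar>B\<bar>) / \<kappa>) ^ d * (\<kappa> * s) ^ d)"
        by (intro mult_left_mono) auto
      also have "\<dots> = ((\<bar>A\<bar> + \<bar>B\<bar>) / \<kappa>) ^ d * ((\<kappa> * s) ^ d / exp (\<kappa> * s))"
        by (simp add: exp_minus divide_inverse)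
      finally show "norm (exp (- \<kappa> * s) * (A + B * sqrt s) ^ d) \<le> ((\<bar>A\<bar> + \<bar>B\<bar>) / \<kappa>) ^ d * ((\<kappa> * s) ^ d / exp (\<kappa> * s))"
        by (simp add: abs_mult power_abs)
    qed
    have "((\<lambda>s. (\<kappa> * s) ^ d / exp (\<kappa> * s)) \<longlongrightarrow> 0) at_top"
      by (rule filterlim_compose[OF tendsto_power_div_exp_0])
         (intro filterlim_tendsto_pos_mult_at_top[OF tendsto_const assms] filterlim_ident)
    then show "((\<lambda>s. ((\<bar>A\<bar> + \<bar>B\<bar>) / \<kappa>) ^ d * ((\<kappa> * s) ^ d / exp (\<kappa> * s))) \<longlongrightarrow> 0) at_top"
      by (rule tendsto_mult_right_zero)
  qed
  moreover have "filterlim (\<lambda>N. ln (real N)) at_top sequentially"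
    by (rule filterlim_compose[OF ln_at_top filterlim_real_sequentially])
  ultimately show ?thesis by (rule filterlim_compose)
qed

text \<open>
  Without the complex conjugate the phases do not cancel: the tilt \<open>2 \<beta> sqrt n\<close> misses the centre by
  \<open>2 i (Im \<beta>) sqrt n\<close>, which costs a factor \<open>exp (- 2 (Im \<beta>)\<^sup>2 n)\<close>.
\<close>
lemma summand_square_mean:
  "\<exists>C d. \<forall>N\<ge>1. real N * cmod (LINT x|gauss. (summand \<beta> N Q x)\<^sup>2)
      \<le> C * (decay (2 * (Im \<beta>)\<^sup>2) 1 (2 * \<bar>Im \<beta>\<bar>) d N)"
    (is "\<exists>C d. \<forall>N\<ge>1. ?P C d N")
proof -
  obtain C d where C: "C \<ge> 0" "\<And>a b. cmod (tilt a (pcompose (Q * Q) [:- b, 1:])) \<le> C * cmod (exp (a\<^sup>2 / 2)) * (1 + cmod (a - b)) ^ d"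
    using tilt_polynomial_bound by blast
  have "?P C d N" if N: "N \<ge> 1" for N
  proof -
    let ?s = "ln (real N)" let ?b = "of_real (drift \<beta> N) :: complex"
    let ?a = "2 * \<beta> * of_real (sqrt ?s)"
    define c where "c = exp (- (1/2 + (Re \<beta>)\<^sup>2) * ?s)"
    have s: "?s \<ge> 0" using N by simp
    have eq: "(summand \<beta> N Q x)\<^sup>2 = of_real (c\<^sup>2) * (exp (?a * of_real x) * poly (pcompose (Q * Q) [:- ?b, 1:]) (of_real x))" for x
    proof -
      have "(exp (\<beta> * of_real (sqrt ?s) * of_real x))\<^sup>2 = exp (?a * of_real x)"
        unfolding exp_double[symmetric] by (simp add: mult_ac)
      then show ?thesis
        unfolding summand_alt power_mult_distrib by (simp add: c_def pcompose_mult power2_eq_square)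
    qed
    have "?a - ?b = 2 * \<i> * of_real (Im \<beta> * sqrt ?s)"
      by (simp add: drift_def complex_eq_iff)
    then have ab: "cmod (?a - ?b) = 2 * \<bar>Im \<beta>\<bar> * sqrt ?s"
      using s by (simp add: norm_mult abs_mult)
    have "real N * cmod (LINT x|gauss. (summand \<beta> N Q x)\<^sup>2) = real N * (c\<^sup>2 * cmod (tilt ?a (pcompose (Q * Q) [:- ?b, 1:])))"
      unfolding eq integral_mult_right_zero gauss_integral norm_mult by (simp add: norm_power)
    also have "\<dots> \<le> real N * (c\<^sup>2 * (C * cmod (exp (?a\<^sup>2 / 2)) * (1 + cmod (?a - ?b)) ^ d))"
      by (intro mult_left_mono C(2)) auto
    also have "\<dots> = C * ((real N * c\<^sup>2 * cmod (exp (?a\<^sup>2 / 2))) * (1 + 2 * \<bar>Im \<beta>\<bar> * sqrt ?s) ^ d)"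
      unfolding ab by (simp only: mult_ac)
    also have "real N * c\<^sup>2 * cmod (exp (?a\<^sup>2 / 2)) = exp ?s * exp (2 * (- (1/2 + (Re \<beta>)\<^sup>2) * ?s)) * exp (((Re (2 * \<beta>))\<^sup>2 - (Im (2 * \<beta>))\<^sup>2) / 2 * ?s)"
      unfolding cmod_exp_half_square[OF N] using N by (simp add: c_def exp_double)
    also have "\<dots> = exp (?s + 2 * (- (1/2 + (Re \<beta>)\<^sup>2) * ?s) + ((Re (2 * \<beta>))\<^sup>2 - (Im (2 * \<beta>))\<^sup>2) / 2 * ?s)"
      by (simp only: exp_add)
    also have "?s + 2 * (- (1/2 + (Re \<beta>)\<^sup>2) * ?s) + ((Re (2 * \<beta>))\<^sup>2 - (Im (2 * \<beta>))\<^sup>2) / 2 * ?s = - (2 * (Im \<beta>)\<^sup>2) * ?s"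
      by (simp add: power2_eq_square field_simps)
    finally show ?thesis .
  qed
  then show ?thesis by blast
qed

text \<open>
  Bounding \<open>\<bar>Q\<bar>^(2+\<delta>)\<close> by \<open>1 + \<bar>Q\<bar>^4\<close> turns the absolute moment into the tilted expectation of a
  polynomial, since \<open>\<bar>Q\<bar>^4\<close> is a polynomial on the real line.
\<close>
lemma summand_lyapunov:
  fixes v :: "nat \<Rightarrow> complex" and m :: nat and \<delta> :: real
  defines "Q \<equiv> hermite_combination m v"
  assumes \<delta>: "0 < \<delta>" "\<delta> \<le> 1"
  shows "\<exists>C d. \<forall>N\<ge>1. integrable gauss (\<lambda>x. cmod (summand \<beta> N Q x) powr (2 + \<delta>)) \<and>
      real N * (LINT x|gauss. cmod (summand \<beta> N Q x) powr (2 + \<delta>))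
      \<le> C * (decay (\<delta> / 2 * (1 - (2 + \<delta>) * (Re \<beta>)\<^sup>2)) 1 (\<delta> * \<bar>Re \<beta>\<bar>) d N)"
    (is "\<exists>C d. \<forall>N\<ge>1. ?P C d N")
proof -
  define Q' where "Q' = hermite_combination m (\<lambda>k. cnj (v k))"
  define T where "T = 1 + (Q * Q')\<^sup>2"
  have T: "poly T (of_real y) = of_real (1 + (cmod (poly Q (of_real y))) ^ 4)" for y :: real
  proof -
    have "poly Q' (of_real y) = cnj (poly Q (of_real y))"
      by (simp add: Q_def Q'_def cnj_hermite_combination)
    then have "poly T (of_real y) = 1 + (poly Q (of_real y) * cnj (poly Q (of_real y)))\<^sup>2"
      by (simp add: T_def)
    also have "\<dots> = 1 + (of_real ((cmod (poly Q (of_real y)))\<^sup>2))\<^sup>2"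
      unfolding complex_norm_square ..
    also have "\<dots> = of_real (1 + (cmod (poly Q (of_real y))) ^ 4)"
      by (simp flip: power_mult)
    finally show ?thesis .
  qed
  obtain C d where C: "C \<ge> 0" "\<And>a b. cmod (tilt a (pcompose T [:- b, 1:])) \<le> C * cmod (exp (a\<^sup>2 / 2)) * (1 + cmod (a - b)) ^ d"
    using tilt_polynomial_bound by blast
  have "?P C d N" if N: "N \<ge> 1" for N
  proof -
    let ?s = "ln (real N)" let ?b = "of_real (drift \<beta> N) :: complex"
    let ?a = "of_real ((2 + \<delta>) * Re \<beta>) * of_real (sqrt ?s) :: complex"
    define c where "c = exp (- (1/2 + (Re \<beta>)\<^sup>2) * ?s)"
    define g where "g x = c powr (2 + \<delta>) * (exp ((2 + \<delta>) * Re \<beta> * sqrt ?s * x) * (1 + (cmod (poly Q (of_real (x - drift \<beta> N)))) ^ 4))" for x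
    have s: "?s \<ge> 0" using N by simp
    have gc: "complex_of_real (g x) = of_real (c powr (2 + \<delta>)) * (exp (?a * of_real x) * poly (pcompose T [:- ?b, 1:]) (of_real x))" for x
    proof -
      have "poly (pcompose T [:- ?b, 1:]) (of_real x) = poly T (of_real (x - drift \<beta> N))"
        by (simp add: poly_pcompose)
      then show ?thesis unfolding g_def T by (simp add: exp_of_real[symmetric])
    qed
    have int: "integrable gauss (\<lambda>x. complex_of_real (g x))"
      unfolding gc by (intro integrable_mult_right gauss_integrable)
    then have gi: "integrable gauss g" using integrable_Re by fastforce
    have le: "cmod (summand \<beta> N Q x) powr (2 + \<delta>) \<le> g x" for x
    proof -
      define y where "y = cmod (poly Q (of_real (x - drift \<beta> N)))"
      have y: "y \<ge> 0" by (simp add: y_def)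
      have y4: "y powr (2 + \<delta>) \<le> 1 + y ^ 4"
      proof (cases "y \<le> 1")
        case True
        then have "y powr (2 + \<delta>) \<le> 1" using y \<delta> by (intro powr_le1) auto
        then show ?thesis using y by (smt (verit) zero_le_power)
      next
        case False
        then have "y powr (2 + \<delta>) \<le> y powr (real 4)" using \<delta> by (intro powr_mono) auto
        then show ?thesis using False by (subst (asm) powr_realpow) auto
      qed
      have "cmod (summand \<beta> N Q x) = c * (exp (Re \<beta> * sqrt ?s * x) * y)"
        unfolding summand_def norm_mult cmod_exp_sqrt_mult y_def by (simp add: c_def)
      then have "cmod (summand \<beta> N Q x) powr (2 + \<delta>) = c powr (2 + \<delta>) * (exp (Re \<beta> * sqrt ?s * x) powr (2 + \<delta>) * y powr (2 + \<delta>))"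
        using y by (simp add: powr_mult c_def)
      also have "exp (Re \<beta> * sqrt ?s * x) powr (2 + \<delta>) = exp ((2 + \<delta>) * Re \<beta> * sqrt ?s * x)"
        by (simp add: exp_powr_real mult_ac)
      also have "c powr (2 + \<delta>) * (exp ((2 + \<delta>) * Re \<beta> * sqrt ?s * x) * y powr (2 + \<delta>)) \<le> g x"
        unfolding g_def y_def[symmetric] by (intro mult_left_mono y4) auto
      finally show ?thesis .
    qed
    have i: "integrable gauss (\<lambda>x. cmod (summand \<beta> N Q x) powr (2 + \<delta>))"
    proof (rule Bochner_Integration.integrable_bound[OF gi])
      show "AE x in gauss. norm (cmod (summand \<beta> N Q x) powr (2 + \<delta>)) \<le> norm (g x)"
        by (intro AE_I2) (use le in \<open>simp add: order.trans[OF _ abs_ge_self]\<close>)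
    qed simp
    have "real N * (LINT x|gauss. cmod (summand \<beta> N Q x) powr (2 + \<delta>)) \<le> real N * (LINT x|gauss. g x)"
      by (intro mult_left_mono integral_mono i gi le) auto
    also have "(LINT x|gauss. g x) \<le> cmod (of_real (LINT x|gauss. g x))"
      by simp
    also have "complex_of_real (LINT x|gauss. g x) = of_real (c powr (2 + \<delta>)) * tilt ?a (pcompose T [:- ?b, 1:])"
      unfolding integral_complex_of_real[symmetric] gc integral_mult_right_zero gauss_integral ..
    also have "cmod \<dots> \<le> c powr (2 + \<delta>) * (C * cmod (exp (?a\<^sup>2 / 2)) * (1 + cmod (?a - ?b)) ^ d)"
      unfolding norm_mult by (simp only: norm_of_real abs_of_nonneg[OF powr_ge_zero]) (intro mult_left_mono C(2) powr_ge_zero)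
    also have "real N * (c powr (2 + \<delta>) * (C * cmod (exp (?a\<^sup>2 / 2)) * (1 + cmod (?a - ?b)) ^ d))
       = C * ((real N * c powr (2 + \<delta>) * cmod (exp (?a\<^sup>2 / 2))) * (1 + cmod (?a - ?b)) ^ d)"
      by (simp only: mult_ac)
    also have "?a - ?b = of_real (\<delta> * Re \<beta> * sqrt ?s)"
      by (simp add: drift_def algebra_simps)
    also have "cmod (of_real (\<delta> * Re \<beta> * sqrt ?s)) = \<delta> * \<bar>Re \<beta>\<bar> * sqrt ?s"
      using s \<delta> by (simp only: norm_of_real abs_mult) simp
    also have "real N * c powr (2 + \<delta>) * cmod (exp (?a\<^sup>2 / 2))
       = exp ?s * exp ((2 + \<delta>) * (- (1/2 + (Re \<beta>)\<^sup>2) * ?s)) * exp (((2 + \<delta>) * Re \<beta>)\<^sup>2 / 2 * ?s)"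
      unfolding cmod_exp_half_square[OF N] using N by (simp add: c_def exp_powr_real mult.commute)
    also have "\<dots> = exp (?s + (2 + \<delta>) * (- (1/2 + (Re \<beta>)\<^sup>2) * ?s) + ((2 + \<delta>) * Re \<beta>)\<^sup>2 / 2 * ?s)"
      by (simp only: exp_add)
    also have "?s + (2 + \<delta>) * (- (1/2 + (Re \<beta>)\<^sup>2) * ?s) + ((2 + \<delta>) * Re \<beta>)\<^sup>2 / 2 * ?s = - (\<delta> / 2 * (1 - (2 + \<delta>) * (Re \<beta>)\<^sup>2)) * ?s"
      by (simp add: power2_eq_square field_simps)
    finally show ?thesis using i by (simp add: mult_left_mono)
  qed
  then show ?thesis by blast
qed

section \<open>Gaussian laws and characteristic functions\<close>

lemma product_integral:
  fixes f g :: "real \<Rightarrow> 'b::{real_normed_field, banach, second_countable_topology}"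
  assumes f: "integrable lborel f" and g: "integrable lborel g"
  shows product_integrable: "integrable (lborel \<Otimes>\<^sub>M lborel) (\<lambda>(x,y). f x * g y)" (is ?A)
    and product_integral_eq: "(LINT p|(lborel \<Otimes>\<^sub>M lborel). (case p of (x,y) \<Rightarrow> f x * g y)) = (LINT x|lborel. f x) * (LINT y|lborel. g y)" (is ?B)
proof -
  have [measurable]: "f \<in> borel_measurable borel" "g \<in> borel_measurable borel"
    using borel_measurable_integrable[OF f] borel_measurable_integrable[OF g] by simp_all
  show i: ?A
  proof (rule lborel_pair.Fubini_integrable)
    show "integrable lborel (\<lambda>x. LINT y|lborel. norm (case (x, y) of (x, y) \<Rightarrow> f x * g y))"
      using f by (simp add: norm_mult)
    show "AE x in lborel. integrable lborel (\<lambda>y. case (x, y) of (x, y) \<Rightarrow> f x * g y)"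
      using g by simp
  qed measurable
  have "(LINT p|(lborel \<Otimes>\<^sub>M lborel). (case p of (x,y) \<Rightarrow> f x * g y)) = (LINT x|lborel. LINT y|lborel. f x * g y)"
    using lborel_pair.integral_fst'[OF i] by simp
  also have "\<dots> = (LINT x|lborel. f x) * (LINT y|lborel. g y)" by simp
  finally show ?B .
qed

lemma measurable_Complex_pair [measurable]: "(\<lambda>(x,y). Complex x y) \<in> borel_measurable (lborel \<Otimes>\<^sub>M lborel)"
  unfolding Complex_eq by measurable

lemma lborel_complex_eq: "(lborel :: complex measure) = distr (lborel \<Otimes>\<^sub>M lborel) borel (\<lambda>(x,y). Complex x y)"
proof (rule lborel_eqI)
  fix l u :: complex assume le: "\<And>b. b \<in> Basis \<Longrightarrow> l \<bullet> b \<le> u \<bullet> b"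
  have le': "Re l \<le> Re u" "Im l \<le> Im u" using le[of 1] le[of \<i>] by (auto simp: Basis_complex_def)
  have "(\<lambda>(x,y). Complex x y) -` box l u \<inter> space (lborel \<Otimes>\<^sub>M lborel) = {Re l<..<Re u} \<times> {Im l<..<Im u}"
    by (auto simp: box_def Basis_complex_def space_pair_measure)
  then have "emeasure (distr (lborel \<Otimes>\<^sub>M lborel) borel (\<lambda>(x,y). Complex x y)) (box l u)
    = emeasure (lborel \<Otimes>\<^sub>M lborel) ({Re l<..<Re u} \<times> {Im l<..<Im u})"
    by (subst emeasure_distr) auto
  also have "\<dots> = emeasure lborel {Re l<..<Re u} * emeasure lborel {Im l<..<Im u}"
    by (rule lborel.emeasure_pair_measure_Times) auto
  also have "\<dots> = ennreal (\<Prod>b\<in>Basis. (u - l) \<bullet> b)"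
    using le' by (simp add: Basis_complex_def ennreal_mult'[symmetric] algebra_simps)
  finally show "emeasure (distr (lborel \<Otimes>\<^sub>M lborel) borel (\<lambda>(x,y). Complex x y)) (box l u) = ennreal (\<Prod>b\<in>Basis. (u - l) \<bullet> b)" .
qed simp

abbreviation half_normal :: "real \<Rightarrow> real" where
  "half_normal \<equiv> normal_density 0 (1 / sqrt 2)"

lemma std_complex_normal_density_eq: "std_complex_normal_density (Complex x y) = half_normal x * half_normal y"
  by (simp add: std_complex_normal_density_def normal_density_def power_divide cmod_power2
      exp_add[symmetric] real_sqrt_mult[symmetric] power2_eq_square[symmetric] add.commute)

lemma half_normal_char: "(LINT x|lborel. half_normal x *\<^sub>R iexp (t * x)) = of_real (exp (- t\<^sup>2 / 4))"
proof -
  have "(LINT x|lborel. half_normal x *\<^sub>R iexp (t * x))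
     = \<bar>1 / sqrt 2\<bar> *\<^sub>R (LINT x|lborel. half_normal (0 + 1 / sqrt 2 * x) *\<^sub>R iexp (t * (0 + 1 / sqrt 2 * x)))"
    by (rule lborel_integral_real_affine) simp
  also have "\<dots> = (LINT x|lborel. \<bar>1 / sqrt 2\<bar> *\<^sub>R (half_normal (0 + 1 / sqrt 2 * x) *\<^sub>R iexp (t * (0 + 1 / sqrt 2 * x))))"
    by (rule integral_scaleR_right[symmetric])
  also have "\<dots> = (LINT x|lborel. std_normal_density x *\<^sub>R iexp (t / sqrt 2 * x))"
  proof (intro Bochner_Integration.integral_cong refl)
    fix x :: real
    have eq: "\<bar>1 / sqrt 2\<bar> * half_normal (0 + 1 / sqrt 2 * x) = std_normal_density x"
      by (simp add: normal_density_def power_divide real_sqrt_mult field_simps)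
    show "\<bar>1 / sqrt 2\<bar> *\<^sub>R (half_normal (0 + 1 / sqrt 2 * x) *\<^sub>R iexp (t * (0 + 1 / sqrt 2 * x)))
       = std_normal_density x *\<^sub>R iexp (t / sqrt 2 * x)"
      unfolding scaleR_scaleR eq by simp
  qed
  also have "\<dots> = char gauss (t / sqrt 2)"
    unfolding char_def by (subst integral_density) auto
  also have "\<dots> = of_real (exp (- t\<^sup>2 / 4))"
    by (simp add: char_std_normal_distribution power_divide)
  finally show ?thesis .
qed

lemma integrable_scaleR_iexp:
  assumes "integrable lborel f"
  shows "integrable lborel (\<lambda>x. f x *\<^sub>R iexp (t * x))"
proof (rule Bochner_Integration.integrable_bound[OF assms])
  have [measurable]: "f \<in> borel_measurable borel" using borel_measurable_integrable[OF assms] by simp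
  show "(\<lambda>x. f x *\<^sub>R iexp (t * x)) \<in> borel_measurable lborel" by measurable
qed simp

text \<open>
  The density factorises over real and imaginary part into two normal densities of variance 1/2.
\<close>
lemma complex_gaussian_char:
  "(LINT z|lborel. std_complex_normal_density z *\<^sub>R iexp (Re (v * z))) = of_real (exp (- (cmod v)\<^sup>2 / 4))"
proof -
  have [measurable]: "std_complex_normal_density \<in> borel_measurable borel"
    unfolding std_complex_normal_density_def by measurable
  have i: "integrable lborel (\<lambda>x. half_normal x *\<^sub>R iexp (t * x))" for t
    by (intro integrable_scaleR_iexp integrable_normal_density) simp
  have "(LINT z|lborel. std_complex_normal_density z *\<^sub>R iexp (Re (v * z)))
     = (LINT p|(lborel \<Otimes>\<^sub>M lborel). std_complex_normal_density (case p of (x,y) \<Rightarrow> Complex x y) *\<^sub>R iexp (Re (v * (case p of (x,y) \<Rightarrow> Complex x y))))"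
    by (subst lborel_complex_eq, subst integral_distr) auto
  also have "\<dots> = (LINT p|(lborel \<Otimes>\<^sub>M lborel). (case p of (x,y) \<Rightarrow>
      (half_normal x *\<^sub>R iexp (Re v * x)) * (half_normal y *\<^sub>R iexp (- Im v * y))))"
    by (intro Bochner_Integration.integral_cong refl)
       (auto simp: std_complex_normal_density_eq exp_add[symmetric] algebra_simps exp_diff)
  also have "\<dots> = of_real (exp (- (Re v)\<^sup>2 / 4)) * of_real (exp (- (- Im v)\<^sup>2 / 4))"
    by (subst product_integral_eq[OF i i]) (simp only: half_normal_char)
  also have "\<dots> = of_real (exp (- (cmod v)\<^sup>2 / 4))"
    unfolding of_real_mult[symmetric] exp_add[symmetric] by (simp add: cmod_power2 field_simps)
  finally show ?thesis .
qed

lemma complex_gaussian_integrable_square: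
  "integrable lborel (\<lambda>z. std_complex_normal_density z *\<^sub>R (cmod z)\<^sup>2)"
proof -
  have [measurable]: "std_complex_normal_density \<in> borel_measurable borel"
    unfolding std_complex_normal_density_def by measurable
  have i0: "integrable lborel half_normal" by (rule integrable_normal_density) simp
  have i2: "integrable lborel (\<lambda>x. half_normal x * x\<^sup>2)"
    using integrable_normal_moment[of "1 / sqrt 2" 0 2] by simp
  have "integrable (lborel \<Otimes>\<^sub>M lborel) (\<lambda>p. (case p of (x,y) \<Rightarrow> (half_normal x * x\<^sup>2) * half_normal y) +
     (case p of (x,y) \<Rightarrow> half_normal x * (half_normal y * y\<^sup>2)))"
    by (intro Bochner_Integration.integrable_add product_integrable i0 i2)
  also have "(\<lambda>p. (case p of (x,y) \<Rightarrow> (half_normal x * x\<^sup>2) * half_normal y) + (case p of (x,y) \<Rightarrow> half_normal x * (half_normal y * y\<^sup>2)))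
     = (\<lambda>p. std_complex_normal_density (case p of (x,y) \<Rightarrow> Complex x y) *\<^sub>R (cmod (case p of (x,y) \<Rightarrow> Complex x y))\<^sup>2)"
    by (auto simp: fun_eq_iff std_complex_normal_density_eq cmod_power2 algebra_simps)
  finally show ?thesis
    by (subst lborel_complex_eq, subst integrable_distr_eq) auto
qed

lemma (in prob_space) distributed_transfer:
  fixes g :: "'c::euclidean_space \<Rightarrow> 'b::{banach, second_countable_topology}"
  assumes D: "distributed M lborel Y (\<lambda>x. ennreal (d x))" and [measurable]: "d \<in> borel_measurable borel" "\<And>x. d x \<ge> 0"
    and g[measurable]: "g \<in> borel_measurable borel"
  shows distributed_transfer_integrable: "integrable M (\<lambda>\<omega>. g (Y \<omega>)) \<longleftrightarrow> integrable lborel (\<lambda>x. d x *\<^sub>R g x)" (is ?A)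
    and distributed_transfer_integral: "(LINT \<omega>|M. g (Y \<omega>)) = (LINT x|lborel. d x *\<^sub>R g x)" (is ?B)
proof -
  have Y[measurable]: "Y \<in> measurable M lborel" using D by (rule distributed_measurable)
  have distr: "distr M lborel Y = density lborel (\<lambda>x. ennreal (d x))"
    using D by (simp add: distributed_def)
  have "integrable M (\<lambda>\<omega>. g (Y \<omega>)) \<longleftrightarrow> integrable (distr M lborel Y) g"
    by (rule integrable_distr_eq[symmetric]) (use Y in simp_all)
  also have "\<dots> \<longleftrightarrow> integrable lborel (\<lambda>x. d x *\<^sub>R g x)"
    unfolding distr by (rule integrable_density) (use assms in auto)
  finally show ?A .
  have "(LINT \<omega>|M. g (Y \<omega>)) = (LINT x|distr M lborel Y. g x)"
    by (rule integral_distr[symmetric]) (use Y in simp_all)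
  also have "\<dots> = (LINT x|lborel. d x *\<^sub>R g x)"
    unfolding distr by (rule integral_density) (use assms in auto)
  finally show ?B .
qed

lemma (in prob_space) std_normal_transfer:
  fixes g :: "real \<Rightarrow> 'b::{banach, second_countable_topology}"
  assumes D: "distributed M lborel Y (\<lambda>x. ennreal (std_normal_density x))"
    and g[measurable]: "g \<in> borel_measurable borel"
  shows std_normal_transfer_integrable: "integrable M (\<lambda>\<omega>. g (Y \<omega>)) \<longleftrightarrow> integrable gauss g" (is ?A)
    and std_normal_transfer_integral: "(LINT \<omega>|M. g (Y \<omega>)) = (LINT x|gauss. g x)" (is ?B)
proof -
  show ?A
    using distributed_transfer_integrable[OF D _ _ g] by (subst integrable_density) auto
  show ?B
    using distributed_transfer_integral[OF D _ _ g] by (subst integral_density) auto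
qed

text \<open>
  Compare with \<open>exp (z / N)\<close>, whose powers are exactly \<open>exp z\<close>; powers of numbers in the closed unit disc
  differ by at most \<open>N\<close> times the difference of the bases.
\<close>
lemma tendsto_power_exp:
  fixes \<phi> :: "nat \<Rightarrow> complex"
  assumes lim: "(\<lambda>N. of_nat N * (\<phi> N - 1)) \<longlonglongrightarrow> z" and le: "\<And>N. norm (\<phi> N) \<le> 1" and z: "Re z \<le> 0"
  shows "(\<lambda>N. \<phi> N ^ N) \<longlonglongrightarrow> exp z"
proof -
  define \<psi> where "\<psi> N = exp (z * of_real (1 / real N))" for N :: nat
  have psi_le: "norm (\<psi> N) \<le> 1" for N using z by (simp add: \<psi>_def mult_nonpos_nonneg divide_nonpos_nonneg)
  have psi_pow: "\<psi> N ^ N = exp z" if "N \<ge> 1" for N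
    using that by (simp add: \<psi>_def exp_of_nat_mult[symmetric])
  have "((\<lambda>h. exp (z * h)) has_field_derivative z) (at 0)"
    by (auto intro!: derivative_eq_intros)
  then have "((\<lambda>h. (exp (z * h) - 1) / h) \<longlongrightarrow> z) (at 0)"
    by (simp add: DERIV_def)
  moreover have "filterlim (\<lambda>N. complex_of_real (1 / real N)) (at 0) sequentially"
    unfolding filterlim_at
  proof
    show "\<forall>\<^sub>F N in sequentially. complex_of_real (1 / real N) \<in> UNIV \<and> complex_of_real (1 / real N) \<noteq> 0"
      using eventually_gt_at_top[of 0] by eventually_elim simp
    show "(\<lambda>N. complex_of_real (1 / real N)) \<longlonglongrightarrow> 0"
      using tendsto_of_real[OF lim_1_over_n, where 'a = complex] by simp
  qed
  ultimately have "(\<lambda>N. (exp (z * of_real (1 / real N)) - 1) / of_real (1 / real N)) \<longlonglongrightarrow> z"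
    by (rule filterlim_compose)
  then have lim2: "(\<lambda>N. of_nat N * (\<psi> N - 1)) \<longlonglongrightarrow> z"
    by (simp add: \<psi>_def mult.commute)
  have "(\<lambda>N. norm (of_nat N * (\<phi> N - 1) - of_nat N * (\<psi> N - 1))) \<longlonglongrightarrow> norm (z - z)"
    by (intro tendsto_norm tendsto_diff lim lim2)
  then have "(\<lambda>N. norm (of_nat N * (\<phi> N - 1) - of_nat N * (\<psi> N - 1))) \<longlonglongrightarrow> 0" by simp
  then have "(\<lambda>N. \<phi> N ^ N - \<psi> N ^ N) \<longlonglongrightarrow> 0"
  proof (rule Lim_null_comparison[rotated], intro always_eventually allI)
    fix N
    have "norm (\<phi> N ^ N - \<psi> N ^ N) \<le> real N * norm (\<phi> N - \<psi> N)"
      by (intro norm_power_diff le psi_le)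
    also have "\<dots> = norm (of_nat N * (\<phi> N - 1) - of_nat N * (\<psi> N - 1))"
      unfolding right_diff_distrib[symmetric] norm_mult by simp
    finally show "norm (\<phi> N ^ N - \<psi> N ^ N) \<le> norm (of_nat N * (\<phi> N - 1) - of_nat N * (\<psi> N - 1))" .
  qed
  moreover have "(\<lambda>N. \<psi> N ^ N) \<longlonglongrightarrow> exp z"
    by (rule tendsto_eventually, rule eventually_at_top_linorderI[of 1], rule psi_pow)
  ultimately show ?thesis using tendsto_add by fastforce
qed

text \<open>
  The two standard remainder bounds \<open>\<bar>w\<bar>\<^sup>2\<close> and \<open>\<bar>w\<bar>^3 / 6\<close> interpolate, which is how a moment of order
  \<open>2 + \<delta>\<close> replaces a third moment.
\<close>
lemma iexp_taylor_powr:
  assumes "0 < \<delta>" "\<delta> \<le> 1"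
  shows "cmod (iexp w - (1 + \<i> * w - w\<^sup>2 / 2)) \<le> \<bar>w\<bar> powr (2 + \<delta>)"
proof -
  have sum: "(\<Sum>k\<le>2. (\<i> * w)^k / fact k) = 1 + \<i> * w - w\<^sup>2 / 2"
    by (simp add: numeral_2_eq_2 algebra_simps)
  have a1: "cmod (iexp w - (1 + \<i> * w - w\<^sup>2 / 2)) \<le> \<bar>w\<bar> ^ 3 / 6"
    using iexp_approx1[of w 2] unfolding sum by (simp add: fact_numeral numeral_3_eq_3[symmetric])
  have a2: "cmod (iexp w - (1 + \<i> * w - w\<^sup>2 / 2)) \<le> \<bar>w\<bar> ^ 2"
    using iexp_approx2[of w 2] unfolding sum by (simp add: fact_numeral)
  show ?thesis
  proof (cases "\<bar>w\<bar> \<le> 1")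
    case True
    show ?thesis
    proof (cases "w = 0")
      case False
      have "\<bar>w\<bar> ^ 3 / 6 \<le> \<bar>w\<bar> powr real 3" using False by (subst powr_realpow) auto
      also have "\<dots> \<le> \<bar>w\<bar> powr (2 + \<delta>)" using True False assms by (intro powr_mono') auto
      finally show ?thesis using a1 by linarith
    qed simp
  next
    case False
    have "\<bar>w\<bar> ^ 2 = \<bar>w\<bar> powr real 2" using False by (subst powr_realpow) auto
    also have "\<dots> \<le> \<bar>w\<bar> powr (2 + \<delta>)" using False assms by (intro powr_mono) auto
    finally show ?thesis using a2 by linarith
  qed
qed

section \<open>Central limit theorem and tightness for the coefficients\<close>

lemma (in prob_space) second_moment_iid_sum:
  fixes X :: "nat \<Rightarrow> 'a \<Rightarrow> real" and y :: "real \<Rightarrow> complex"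
  assumes ind: "indep_vars (\<lambda>_. borel) X {1..}"
    and D: "\<And>k. k \<ge> 1 \<Longrightarrow> distributed M lborel (X k) (\<lambda>x. ennreal (std_normal_density x))"
    and ym[measurable]: "y \<in> borel_measurable borel"
    and y1: "integrable gauss y"
    and y2: "integrable gauss (\<lambda>x. (cmod (y x))\<^sup>2)"
  shows "integrable M (\<lambda>\<omega>. (cmod (\<Sum>j=1..N. y (X j \<omega>)))\<^sup>2)" (is ?A)
    and "(LINT \<omega>|M. (cmod (\<Sum>j=1..N. y (X j \<omega>)))\<^sup>2)
       \<le> real N * (LINT x|gauss. (cmod (y x))\<^sup>2) + (real N * cmod (LINT x|gauss. y x))\<^sup>2" (is ?B)
proof -
  define e where "e = (LINT x|gauss. y x)"
  define s where "s = (LINT x|gauss. (cmod (y x))\<^sup>2)"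
  have cross: "integrable M (\<lambda>\<omega>. y (X i \<omega>) * cnj (y (X j \<omega>))) \<and>
      (LINT \<omega>|M. y (X i \<omega>) * cnj (y (X j \<omega>))) = (if i = j then of_real s else e * cnj e)"
    if ij: "i \<ge> 1" "j \<ge> 1" for i j
  proof (cases "i = j")
    case True
    have eq: "y (X i \<omega>) * cnj (y (X j \<omega>)) = complex_of_real ((cmod (y (X i \<omega>)))\<^sup>2)" for \<omega>
      unfolding True complex_norm_square ..
    have "integrable M (\<lambda>\<omega>. (cmod (y (X i \<omega>)))\<^sup>2)"
      using y2 by (subst std_normal_transfer_integrable[OF D[OF ij(1)]]) auto
    moreover have "(LINT \<omega>|M. (cmod (y (X i \<omega>)))\<^sup>2) = s"
      unfolding s_def by (rule std_normal_transfer_integral[OF D[OF ij(1)]]) simp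
    ultimately show ?thesis unfolding eq using True by (simp del: of_real_power)
  next
    case False
    define g where "g l = (if l = i then y else (\<lambda>x. cnj (y x)))" for l
    have [measurable]: "cnj \<in> borel_measurable borel"
      by (intro borel_measurable_continuous_onI continuous_intros)
    have gm[measurable]: "g l \<in> borel_measurable borel" for l
      by (cases "l = i") (simp_all add: g_def)
    have "indep_vars (\<lambda>_. borel) (\<lambda>l \<omega>. g l (X l \<omega>)) {i, j}"
      by (rule indep_vars_compose2[OF indep_vars_subset[OF ind]]) (use ij gm in auto)
    moreover have int: "integrable M (\<lambda>\<omega>. g l (X l \<omega>))" if "l \<in> {i,j}" for l
    proof -
      have "integrable gauss (g l)" using y1 by (simp add: g_def)
      then show ?thesis using ij that by (subst std_normal_transfer_integrable[OF D]) auto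
    qed
    ultimately have "(LINT \<omega>|M. (\<Prod>l\<in>{i,j}. g l (X l \<omega>))) = (\<Prod>l\<in>{i,j}. LINT \<omega>|M. g l (X l \<omega>))"
        "integrable M (\<lambda>\<omega>. (\<Prod>l\<in>{i,j}. g l (X l \<omega>)))"
      by (intro indep_vars_lebesgue_integral indep_vars_integrable; simp)+
    moreover have "(LINT \<omega>|M. y (X i \<omega>)) = e"
      unfolding e_def by (rule std_normal_transfer_integral[OF D[OF ij(1)] ym])
    moreover have "(LINT \<omega>|M. y (X j \<omega>)) = e"
      unfolding e_def by (rule std_normal_transfer_integral[OF D[OF ij(2)] ym])
    ultimately show ?thesis using False by (simp add: g_def)
  qed
  have expand: "complex_of_real ((cmod (\<Sum>j=1..N. y (X j \<omega>)))\<^sup>2) = (\<Sum>i=1..N. \<Sum>j=1..N. y (X i \<omega>) * cnj (y (X j \<omega>)))" for \<omega>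
    unfolding complex_norm_square cnj_sum sum_product ..
  have int: "integrable M (\<lambda>\<omega>. complex_of_real ((cmod (\<Sum>j=1..N. y (X j \<omega>)))\<^sup>2))"
    unfolding expand using cross by (intro Bochner_Integration.integrable_sum) auto
  show ?A
    using integrable_Re[OF int] by simp
  have "complex_of_real (LINT \<omega>|M. (cmod (\<Sum>j=1..N. y (X j \<omega>)))\<^sup>2)
     = (LINT \<omega>|M. (\<Sum>i=1..N. \<Sum>j=1..N. y (X i \<omega>) * cnj (y (X j \<omega>))))"
    unfolding integral_complex_of_real[symmetric] expand ..
  also have "\<dots> = (\<Sum>i=1..N. \<Sum>j=1..N. LINT \<omega>|M. y (X i \<omega>) * cnj (y (X j \<omega>)))"
    using cross by (subst Bochner_Integration.integral_sum, force intro: Bochner_Integration.integrable_sum,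
       intro sum.cong refl Bochner_Integration.integral_sum) auto
  also have "\<dots> = (\<Sum>i=1..N. \<Sum>j=1..N. (if i = j then of_real s else e * cnj e))"
    using cross by (intro sum.cong refl) auto
  also have "\<dots> = of_real (\<Sum>i=1..N. \<Sum>j=1..N. (if i = j then s else (cmod e)\<^sup>2))"
    unfolding of_real_sum by (intro sum.cong refl) (auto simp: complex_norm_square simp del: of_real_power)
  finally have "(LINT \<omega>|M. (cmod (\<Sum>j=1..N. y (X j \<omega>)))\<^sup>2) = (\<Sum>i=1..N. \<Sum>j=1..N. (if i = j then s else (cmod e)\<^sup>2))"
    by (simp only: of_real_eq_iff)
  also have "\<dots> \<le> (\<Sum>i=1..N. \<Sum>j=1..N. (if i = j then s else 0) + (cmod e)\<^sup>2)"
    by (intro sum_mono) auto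
  also have "\<dots> = real N * s + (real N * cmod e)\<^sup>2"
    by (simp add: sum.distrib power2_eq_square algebra_simps)
  finally show ?B
    by (simp add: s_def e_def)
qed

lemma (in prob_space) char_iid_sum:
  fixes X :: "nat \<Rightarrow> 'a \<Rightarrow> real" and w :: "real \<Rightarrow> real"
  assumes ind: "indep_vars (\<lambda>_. borel) X {1..}"
    and D: "\<And>k. k \<ge> 1 \<Longrightarrow> distributed M lborel (X k) (\<lambda>x. ennreal (std_normal_density x))"
    and w[measurable]: "w \<in> borel_measurable borel"
  shows "(LINT \<omega>|M. iexp (\<Sum>j=1..N. w (X j \<omega>))) = (LINT x|gauss. iexp (w x)) ^ N"
proof -
  have X[measurable]: "random_variable borel (X k)" if "k \<ge> 1" for k
    using distributed_measurable[OF D[OF that]] by simp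
  have iexp_m: "(\<lambda>x. iexp (w x)) \<in> borel_measurable borel" by measurable
  have "(LINT \<omega>|M. iexp (\<Sum>j=1..N. w (X j \<omega>))) = (LINT \<omega>|M. (\<Prod>j=1..N. iexp (w (X j \<omega>))))"
    by (simp add: exp_sum sum_distrib_left)
  also have "\<dots> = (\<Prod>j=1..N. LINT \<omega>|M. iexp (w (X j \<omega>)))"
  proof (rule indep_vars_lebesgue_integral)
    show "indep_vars (\<lambda>_. borel) (\<lambda>l \<omega>. iexp (w (X l \<omega>))) {1..N}"
      by (rule indep_vars_compose2[OF indep_vars_subset[OF ind]]) (use iexp_m in auto)
    show "integrable M (\<lambda>\<omega>. iexp (w (X l \<omega>)))" if "l \<in> {1..N}" for l
    proof (rule integrable_const_bound[of _ 1])
      have [measurable]: "random_variable borel (X l)" using X that by simp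
      show "(\<lambda>\<omega>. iexp (w (X l \<omega>))) \<in> borel_measurable M" by measurable
    qed simp
  qed simp
  also have "\<dots> = (\<Prod>j=1..N. LINT x|gauss. iexp (w x))"
    by (intro prod.cong refl std_normal_transfer_integral[OF D iexp_m]) simp
  finally show ?thesis by simp
qed

text \<open>
  The coefficients of the zoomed partition function in the normalisation of \<open>weighted_series\<close>.
\<close>
definition rescaled_coeffs :: "complex \<Rightarrow> (nat \<Rightarrow> 'a \<Rightarrow> real) \<Rightarrow> nat \<Rightarrow> 'a \<Rightarrow> nat \<Rightarrow> complex" where
  "rescaled_coeffs \<beta> X N \<omega> k = (\<Sum>j=1..N. summand \<beta> N (hermite k) (X j \<omega>)) / of_real (sqrt (fact k))"

lemma summand_hermite_combination:
  "summand \<beta> N (hermite_combination m v) x = (\<Sum>k<m. v k / of_real (sqrt (fact k)) * summand \<beta> N (hermite k) x)"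
  by (simp add: summand_def hermite_combination_def poly_sum sum_distrib_left mult_ac)

lemma lin_form_rescaled_coeffs:
  "lin_form m v (rescaled_coeffs \<beta> X N \<omega>) = (\<Sum>j=1..N. Re (summand \<beta> N (hermite_combination m v) (X j \<omega>)))"
proof -
  have "(\<Sum>k<m. v k * rescaled_coeffs \<beta> X N \<omega> k) = (\<Sum>k<m. \<Sum>j=1..N. v k / of_real (sqrt (fact k)) * summand \<beta> N (hermite k) (X j \<omega>))"
    by (simp add: rescaled_coeffs_def sum_distrib_left sum_divide_distrib)
  also have "\<dots> = (\<Sum>j=1..N. summand \<beta> N (hermite_combination m v) (X j \<omega>))"
    unfolding summand_hermite_combination by (rule sum.swap)
  finally show ?thesis by (simp add: lin_form_def)
qed

lemma B3_facts:
  assumes "\<beta> \<in> B3"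
  shows "(cmod \<beta>)\<^sup>2 > 1" "Im \<beta> \<noteq> 0" "2 * (Re \<beta>)\<^sup>2 < 1"
  using assms by (auto simp: B3_def cmod_power2)

lemma summand_mean_limit:
  assumes "\<beta> \<in> B3"
  shows "(\<lambda>N. of_nat N * (LINT x|gauss. summand \<beta> N (hermite_combination m v) x)) \<longlonglongrightarrow> 0"
proof -
  have "(\<lambda>N. of_nat N * (LINT x|gauss. summand \<beta> N (hermite k) x)) \<longlonglongrightarrow> 0" for k
  proof (rule Lim_null_comparison)
    show "\<forall>\<^sub>F N in sequentially. norm (of_nat N * (LINT x|gauss. summand \<beta> N (hermite k) x))
        \<le> 1 * (decay (((cmod \<beta>)\<^sup>2 - 1) / 2) 0 (cmod \<beta>) k N)"
      using eventually_ge_at_top[of 1]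
    proof eventually_elim
      case (elim N)
      have eq: "- (((cmod \<beta>)\<^sup>2 - 1) / 2) = (1 - (cmod \<beta>)\<^sup>2) / 2"
        by (simp only: minus_divide_left minus_diff_eq)
      show ?case unfolding norm_mult norm_of_nat summand_hermite_mean[OF elim] eq by simp
    qed
    show "(\<lambda>N. 1 * (decay (((cmod \<beta>)\<^sup>2 - 1) / 2) 0 (cmod \<beta>) k N)) \<longlonglongrightarrow> 0"
      by (rule exp_decay_beats_power) (use B3_facts(1)[OF assms] in simp)
  qed
  then have "(\<lambda>N. \<Sum>k<m. v k / of_real (sqrt (fact k)) * (of_nat N * (LINT x|gauss. summand \<beta> N (hermite k) x))) \<longlonglongrightarrow> 0"
    by (intro tendsto_null_sum tendsto_mult_right_zero)
  moreover have "(LINT x|gauss. summand \<beta> N (hermite_combination m v) x)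
     = (\<Sum>k<m. v k / of_real (sqrt (fact k)) * (LINT x|gauss. summand \<beta> N (hermite k) x))" for N
    unfolding summand_hermite_combination
    by (subst Bochner_Integration.integral_sum) (intro integrable_mult_right summand_integrable, simp)
  ultimately show ?thesis by (simp add: sum_distrib_left mult.left_commute)
qed

text \<open>
  For a complex variable \<open>(Re z)\<^sup>2 = (\<bar>z\<bar>\<^sup>2 + Re (z\<^sup>2)) / 2\<close>; the first part has a fixed expectation, the
  second one is the pseudo-covariance and disappears.
\<close>
lemma summand_variance_limit:
  fixes v :: "nat \<Rightarrow> complex" and m :: nat
  assumes "\<beta> \<in> B3"
  shows "\<And>N. N \<ge> 1 \<Longrightarrow> integrable gauss (\<lambda>x. (Re (summand \<beta> N (hermite_combination m v) x))\<^sup>2)"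
    and "(\<lambda>N. real N * (LINT x|gauss. (Re (summand \<beta> N (hermite_combination m v) x))\<^sup>2))
      \<longlonglongrightarrow> (\<Sum>k<m. (cmod (v k))\<^sup>2) / 2"
proof -
  let ?Q = "hermite_combination m v" and ?V = "\<Sum>k<m. (cmod (v k))\<^sup>2"
  have sq: "(Re z)\<^sup>2 = ((cmod z)\<^sup>2 + Re (z\<^sup>2)) / 2" for z :: complex
    unfolding cmod_power2 by (simp add: power2_eq_square)
  have int2: "integrable gauss (\<lambda>x. (summand \<beta> N ?Q x)\<^sup>2)" if "N \<ge> 1" for N
    by (rule Bochner_Integration.integrable_bound[OF summand_second_moment(1)[OF that, of \<beta> m v]]) (auto simp: norm_power)
  have int: "integrable gauss (\<lambda>x. (cmod (summand \<beta> N ?Q x))\<^sup>2)"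
       "integrable gauss (\<lambda>x. Re ((summand \<beta> N ?Q x)\<^sup>2))" if "N \<ge> 1" for N
    using summand_second_moment(1)[OF that] integrable_Re[OF int2[OF that]] by auto
  show "integrable gauss (\<lambda>x. (Re (summand \<beta> N ?Q x))\<^sup>2)" if "N \<ge> 1" for N
    unfolding sq using int[OF that] by auto
  have val: "real N * (LINT x|gauss. (Re (summand \<beta> N ?Q x))\<^sup>2)
     = (?V + Re (of_nat N * (LINT x|gauss. (summand \<beta> N ?Q x)\<^sup>2))) / 2" if N: "N \<ge> 1" for N
  proof -
    have "real N * (LINT x|gauss. (Re (summand \<beta> N ?Q x))\<^sup>2)
      = (real N * (LINT x|gauss. (cmod (summand \<beta> N ?Q x))\<^sup>2) + real N * (LINT x|gauss. Re ((summand \<beta> N ?Q x)\<^sup>2))) / 2"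
      unfolding sq using int[OF N] by (simp add: algebra_simps)
    also have "(LINT x|gauss. Re ((summand \<beta> N ?Q x)\<^sup>2)) = Re (LINT x|gauss. (summand \<beta> N ?Q x)\<^sup>2)"
      by (rule integral_Re[OF int2[OF N]])
    finally show ?thesis unfolding summand_second_moment(2)[OF N] by simp
  qed
  obtain C d where Cd: "\<And>N. N \<ge> 1 \<Longrightarrow> real N * cmod (LINT x|gauss. (summand \<beta> N ?Q x)\<^sup>2)
      \<le> C * (decay (2 * (Im \<beta>)\<^sup>2) 1 (2 * \<bar>Im \<beta>\<bar>) d N)"
    using summand_square_mean by blast
  have "(\<lambda>N. of_nat N * (LINT x|gauss. (summand \<beta> N ?Q x)\<^sup>2)) \<longlonglongrightarrow> 0"
  proof (rule Lim_null_comparison)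
    show "\<forall>\<^sub>F N in sequentially. norm (of_nat N * (LINT x|gauss. (summand \<beta> N ?Q x)\<^sup>2))
       \<le> C * (decay (2 * (Im \<beta>)\<^sup>2) 1 (2 * \<bar>Im \<beta>\<bar>) d N)"
      using eventually_ge_at_top[of 1] by eventually_elim (use Cd in \<open>simp add: norm_mult\<close>)
    show "(\<lambda>N. C * (decay (2 * (Im \<beta>)\<^sup>2) 1 (2 * \<bar>Im \<beta>\<bar>) d N)) \<longlonglongrightarrow> 0"
      by (rule exp_decay_beats_power) (use B3_facts(2)[OF assms] in simp)
  qed
  then have "(\<lambda>N. (?V + Re (of_nat N * (LINT x|gauss. (summand \<beta> N ?Q x)\<^sup>2))) / 2) \<longlonglongrightarrow> (?V + Re 0) / 2"
    by (intro tendsto_intros) auto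
  then have "(\<lambda>N. (?V + Re (of_nat N * (LINT x|gauss. (summand \<beta> N ?Q x)\<^sup>2))) / 2) \<longlonglongrightarrow> ?V / 2"
    by simp
  then show "(\<lambda>N. real N * (LINT x|gauss. (Re (summand \<beta> N ?Q x))\<^sup>2)) \<longlonglongrightarrow> ?V / 2"
    by (rule Lim_transform_eventually) (rule eventually_at_top_linorderI[of 1], simp only: val)
qed

text \<open>
  The Lyapunov central limit theorem for the triangular array of real parts. The summands are not
  centred, so the expansion of the characteristic function keeps a first-order term; the sum of the
  means tends to 0 and does not affect the limit.
\<close>
lemma summand_char_limit:
  fixes v :: "nat \<Rightarrow> complex" and m :: nat
  assumes "\<beta> \<in> B3"
  shows "(\<lambda>N. (LINT x|gauss. iexp (Re (summand \<beta> N (hermite_combination m v) x))) ^ N)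
      \<longlonglongrightarrow> of_real (exp (- (\<Sum>k<m. (cmod (v k))\<^sup>2) / 4))"
proof -
  let ?Q = "hermite_combination m v" and ?V = "\<Sum>k<m. (cmod (v k))\<^sup>2" and ?G = gauss
  interpret G: real_distribution ?G by (rule real_dist_normal_dist)
  define W where "W N x = Re (summand \<beta> N ?Q x)" for N x
  have Wm[measurable]: "W N \<in> borel_measurable borel" for N unfolding W_def by measurable
  define \<phi> where "\<phi> N = (LINT x|?G. iexp (W N x))" for N
  \<comment> \<open>Small enough for \<open>(2 + \<delta>) (Re \<beta>)\<^sup>2 < 1\<close>, because \<open>2 (Re \<beta>)\<^sup>2 < 1\<close>.\<close>
  define \<delta> where "\<delta> = 1 - 2 * (Re \<beta>)\<^sup>2"
  have \<delta>: "0 < \<delta>" "\<delta> \<le> 1" using B3_facts(3)[OF assms] by (auto simp: \<delta>_def)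
  have \<kappa>: "\<delta> / 2 * (1 - (2 + \<delta>) * (Re \<beta>)\<^sup>2) > 0"
  proof -
    have "\<delta> * (Re \<beta>)\<^sup>2 \<le> \<delta> * (1 / 2)" using \<delta> B3_facts(3)[OF assms] by (intro mult_left_mono) auto
    then have "(2 + \<delta>) * (Re \<beta>)\<^sup>2 < 1" using \<delta> by (simp add: algebra_simps \<delta>_def)
    then show ?thesis using \<delta> by simp
  qed
  obtain C d where Cd: "\<And>N. N \<ge> 1 \<Longrightarrow> integrable ?G (\<lambda>x. cmod (summand \<beta> N ?Q x) powr (2 + \<delta>))"
      "\<And>N. N \<ge> 1 \<Longrightarrow> real N * (LINT x|?G. cmod (summand \<beta> N ?Q x) powr (2 + \<delta>))
      \<le> C * (decay (\<delta> / 2 * (1 - (2 + \<delta>) * (Re \<beta>)\<^sup>2)) 1 (\<delta> * \<bar>Re \<beta>\<bar>) d N)"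
    using summand_lyapunov[OF \<delta>, of \<beta> m v] by blast
  have iexp_int: "integrable ?G (\<lambda>x. iexp (W N x))" for N
    by (rule G.integrable_const_bound[of _ 1]) auto
  have W1: "integrable ?G (W N)" for N
    unfolding W_def by (rule integrable_Re[OF summand_integrable])
  have W2: "integrable ?G (\<lambda>x. (W N x)\<^sup>2)" if "N \<ge> 1" for N
    unfolding W_def using summand_variance_limit(1)[OF assms that] .
  \<comment> \<open>The remainder of the second-order expansion of the characteristic function.\<close>
  define r where "r N = \<phi> N - (1 + \<i> * of_real (LINT x|?G. W N x) - of_real (LINT x|?G. (W N x)\<^sup>2) / 2)" for N
  have r_bound: "cmod (r N) \<le> (LINT x|?G. cmod (summand \<beta> N ?Q x) powr (2 + \<delta>))" if N: "N \<ge> 1" for N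
  proof -
    have i1: "integrable ?G (\<lambda>x. \<i> * complex_of_real (W N x))" using W1 by auto
    have i2: "integrable ?G (\<lambda>x. (complex_of_real (W N x))\<^sup>2 / 2)"
      using integrable_of_real[OF W2[OF N], where 'a = complex] by auto
    have "r N = (LINT x|?G. iexp (W N x) - (1 + \<i> * W N x - (W N x)\<^sup>2 / 2))"
    proof -
      have "(LINT x|?G. iexp (W N x) - (1 + \<i> * W N x - (W N x)\<^sup>2 / 2))
        = \<phi> N - ((LINT x|?G. 1) + (LINT x|?G. \<i> * complex_of_real (W N x)) - (LINT x|?G. (complex_of_real (W N x))\<^sup>2 / 2))"
        unfolding \<phi>_def using i1 i2 iexp_int by simp
      also have "(LINT x|?G. \<i> * complex_of_real (W N x)) = \<i> * of_real (LINT x|?G. W N x)" by simp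
      also have "(LINT x|?G. (complex_of_real (W N x))\<^sup>2 / 2) = of_real (LINT x|?G. (W N x)\<^sup>2) / 2"
        by (simp flip: of_real_power)
      finally show ?thesis using G.prob_space by (simp add: r_def)
    qed
    also have "cmod \<dots> \<le> (LINT x|?G. cmod (iexp (W N x) - (1 + \<i> * W N x - (W N x)\<^sup>2 / 2)))"
      by (rule integral_norm_bound)
    also have "\<dots> \<le> (LINT x|?G. cmod (summand \<beta> N ?Q x) powr (2 + \<delta>))"
    proof (rule integral_mono[OF _ Cd(1)[OF N]])
      show "integrable ?G (\<lambda>x. cmod (iexp (W N x) - (1 + \<i> * W N x - (W N x)\<^sup>2 / 2)))"
        using i1 i2 iexp_int by (intro integrable_norm Bochner_Integration.integrable_diff Bochner_Integration.integrable_add) auto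
      fix x
      have "cmod (iexp (W N x) - (1 + \<i> * W N x - (W N x)\<^sup>2 / 2)) \<le> \<bar>W N x\<bar> powr (2 + \<delta>)"
        by (rule iexp_taylor_powr[OF \<delta>])
      also have "\<dots> \<le> cmod (summand \<beta> N ?Q x) powr (2 + \<delta>)"
        using \<delta> abs_Re_le_cmod by (intro powr_mono2) (auto simp: W_def)
      finally show "cmod (iexp (W N x) - (1 + \<i> * W N x - (W N x)\<^sup>2 / 2)) \<le> cmod (summand \<beta> N ?Q x) powr (2 + \<delta>)" .
    qed
    finally show ?thesis .
  qed
  have rem: "(\<lambda>N. of_nat N * r N) \<longlonglongrightarrow> 0"
  proof (rule Lim_null_comparison)
    show "\<forall>\<^sub>F N in sequentially. norm (of_nat N * r N)
       \<le> C * (decay (\<delta> / 2 * (1 - (2 + \<delta>) * (Re \<beta>)\<^sup>2)) 1 (\<delta> * \<bar>Re \<beta>\<bar>) d N)"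
      using eventually_ge_at_top[of 1]
    proof eventually_elim
      case (elim N)
      have "norm (of_nat N * r N) \<le> real N * (LINT x|?G. cmod (summand \<beta> N ?Q x) powr (2 + \<delta>))"
        unfolding norm_mult norm_of_nat by (intro mult_left_mono r_bound[OF elim]) simp
      then show ?case using Cd(2)[OF elim] by linarith
    qed
    show "(\<lambda>N. C * (decay (\<delta> / 2 * (1 - (2 + \<delta>) * (Re \<beta>)\<^sup>2)) 1 (\<delta> * \<bar>Re \<beta>\<bar>) d N)) \<longlonglongrightarrow> 0"
      by (rule exp_decay_beats_power[OF \<kappa>])
  qed
  have mean: "(\<lambda>N. \<i> * of_real (real N * (LINT x|?G. W N x))) \<longlonglongrightarrow> \<i> * of_real (Re 0)"
  proof -
    have eq: "real N * (LINT x|?G. W N x) = Re (of_nat N * (LINT x|?G. summand \<beta> N ?Q x))" for N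
      unfolding W_def using integral_Re[OF summand_integrable[of \<beta> N ?Q]] by simp
    show ?thesis unfolding eq by (intro tendsto_intros summand_mean_limit[OF assms])
  qed
  have var: "(\<lambda>N. of_real (real N * (LINT x|?G. (W N x)\<^sup>2)) / 2) \<longlonglongrightarrow> complex_of_real (?V / 2) / 2"
    unfolding W_def by (intro tendsto_intros summand_variance_limit(2)[OF assms]) auto
  have "(\<lambda>N. of_nat N * r N + \<i> * of_real (real N * (LINT x|?G. W N x)) - of_real (real N * (LINT x|?G. (W N x)\<^sup>2)) / 2)
      \<longlonglongrightarrow> 0 + \<i> * of_real (Re 0) - complex_of_real (?V / 2) / 2"
    by (intro tendsto_add tendsto_diff rem mean var)
  moreover have "of_nat N * r N + \<i> * of_real (real N * (LINT x|?G. W N x)) - of_real (real N * (LINT x|?G. (W N x)\<^sup>2)) / 2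
      = of_nat N * (\<phi> N - 1)" for N
    by (simp add: r_def algebra_simps)
  ultimately have lim: "(\<lambda>N. of_nat N * (\<phi> N - 1)) \<longlonglongrightarrow> of_real (- ?V / 4)"
    by simp
  have "cmod (\<phi> N) \<le> 1" for N
  proof -
    have "cmod (\<phi> N) \<le> (LINT x|?G. cmod (iexp (W N x)))" unfolding \<phi>_def by (rule integral_norm_bound)
    then show ?thesis using G.prob_space by simp
  qed
  then have "(\<lambda>N. \<phi> N ^ N) \<longlonglongrightarrow> exp (of_real (- ?V / 4))"
    by (rule tendsto_power_exp[OF lim]) (simp add: sum_nonneg)
  then show ?thesis unfolding \<phi>_def W_def by (simp only: exp_of_real)
qed

lemma (in prob_space) expectation_cos_eq:
  assumes [measurable]: "Y \<in> borel_measurable M"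
  shows "(LINT \<omega>|M. cos (Y \<omega> + \<theta>)) = Re (iexp \<theta> * (LINT \<omega>|M. iexp (Y \<omega>)))"
proof -
  have i: "integrable M (\<lambda>\<omega>. iexp \<theta> * iexp (Y \<omega>))" by (rule integrable_const_bound[of _ 1]) (auto simp: norm_mult)
  have "Re (iexp \<theta> * (LINT \<omega>|M. iexp (Y \<omega>))) = Re (LINT \<omega>|M. iexp \<theta> * iexp (Y \<omega>))" by simp
  also have "\<dots> = (LINT \<omega>|M. Re (iexp \<theta> * iexp (Y \<omega>)))" by (rule integral_Re[OF i, symmetric])
  also have "\<dots> = (LINT \<omega>|M. cos (Y \<omega> + \<theta>))"
    by (intro Bochner_Integration.integral_cong refl) (simp add: exp_add[symmetric] Re_exp add.commute)
  finally show ?thesis ..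
qed

lemma measurable_rescaled_coeffs:
  assumes "\<And>k. k \<ge> 1 \<Longrightarrow> X k \<in> borel_measurable M"
  shows "rescaled_coeffs \<beta> X N \<in> borel_measurable M"
proof (rule measurable_coordinatewise_then_product)
  fix k
  have "(\<lambda>\<omega>. summand \<beta> N (hermite k) (X j \<omega>)) \<in> borel_measurable M" if "j \<in> {1..N}" for j
  proof -
    have [measurable]: "X j \<in> borel_measurable M" using assms that by simp
    show ?thesis by measurable
  qed
  then show "(\<lambda>\<omega>. rescaled_coeffs \<beta> X N \<omega> k) \<in> borel_measurable M"
    unfolding rescaled_coeffs_def by (intro borel_measurable_divide borel_measurable_sum) auto
qed

lemma measurable_lin_form [measurable]: "lin_form m v \<in> borel_measurable borel"
  by (rule borel_measurable_continuous_onI[OF continuous_on_lin_form])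

lemma (in prob_space) rescaled_coeffs_cos_limit:
  fixes X :: "nat \<Rightarrow> 'a \<Rightarrow> real"
  assumes ind: "indep_vars (\<lambda>_. borel) X {1..}"
    and D: "\<And>k. k \<ge> 1 \<Longrightarrow> distributed M lborel (X k) (\<lambda>x. ennreal (std_normal_density x))"
    and \<beta>: "\<beta> \<in> B3"
  shows "(\<lambda>N. LINT \<omega>|M. cos (lin_form m v (rescaled_coeffs \<beta> X N \<omega>) + \<theta>))
     \<longlonglongrightarrow> Re (iexp \<theta> * of_real (exp (- (\<Sum>k<m. (cmod (v k))\<^sup>2) / 4)))"
proof -
  have X: "X k \<in> borel_measurable M" if "k \<ge> 1" for k
    using distributed_measurable[OF D[OF that]] by simp
  have [measurable]: "rescaled_coeffs \<beta> X N \<in> borel_measurable M" for N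
    using X by (rule measurable_rescaled_coeffs)
  have "(LINT \<omega>|M. cos (lin_form m v (rescaled_coeffs \<beta> X N \<omega>) + \<theta>))
     = Re (iexp \<theta> * (LINT x|gauss. iexp (Re (summand \<beta> N (hermite_combination m v) x))) ^ N)" for N
  proof -
    have "(LINT \<omega>|M. iexp (lin_form m v (rescaled_coeffs \<beta> X N \<omega>))) = (LINT x|gauss. iexp (Re (summand \<beta> N (hermite_combination m v) x))) ^ N"
      unfolding lin_form_rescaled_coeffs by (rule char_iid_sum[OF ind D]) auto
    then show ?thesis by (subst expectation_cos_eq) auto
  qed
  then show ?thesis by (simp only:) (intro tendsto_intros summand_char_limit[OF \<beta>])
qed

lemma (in prob_space) gaussian_coeffs_cos:
  fixes \<xi> :: "nat \<Rightarrow> 'a \<Rightarrow> complex"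
  assumes ind: "indep_vars (\<lambda>_. borel) \<xi> UNIV"
    and D: "\<And>k. distributed M lborel (\<xi> k) (\<lambda>z. ennreal (std_complex_normal_density z))"
  shows "(LINT \<omega>|M. cos (lin_form m v (\<lambda>k. \<xi> k \<omega>) + \<theta>))
     = Re (iexp \<theta> * of_real (exp (- (\<Sum>k<m. (cmod (v k))\<^sup>2) / 4)))"
proof -
  have [measurable]: "\<xi> k \<in> borel_measurable M" for k
    using distributed_measurable[OF D] by simp
  have dm: "std_complex_normal_density \<in> borel_measurable borel" "std_complex_normal_density z \<ge> 0" for z
    unfolding std_complex_normal_density_def by measurable
  have gm: "(\<lambda>z. iexp (Re (c * z))) \<in> borel_measurable borel" for c by measurable
  have [measurable]: "(\<lambda>\<omega>. lin_form m v (\<lambda>k. \<xi> k \<omega>)) \<in> borel_measurable M"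
    unfolding lin_form_def by measurable
  have "(LINT \<omega>|M. iexp (lin_form m v (\<lambda>k. \<xi> k \<omega>))) = (LINT \<omega>|M. (\<Prod>k<m. iexp (Re (v k * \<xi> k \<omega>))))"
    by (simp add: lin_form_def exp_sum sum_distrib_left)
  also have "\<dots> = (\<Prod>k<m. LINT \<omega>|M. iexp (Re (v k * \<xi> k \<omega>)))"
  proof (rule indep_vars_lebesgue_integral)
    show "indep_vars (\<lambda>_. borel) (\<lambda>k \<omega>. iexp (Re (v k * \<xi> k \<omega>))) {..<m}"
      by (rule indep_vars_compose2[OF indep_vars_subset[OF ind]]) (use gm in auto)
    show "integrable M (\<lambda>\<omega>. iexp (Re (v k * \<xi> k \<omega>)))" for k
      by (rule integrable_const_bound[of _ 1]) auto
  qed simp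
  also have "\<dots> = (\<Prod>k<m. of_real (exp (- (cmod (v k))\<^sup>2 / 4)))"
    by (intro prod.cong refl) (simp only: distributed_transfer_integral[OF D dm gm] complex_gaussian_char)
  also have "\<dots> = of_real (exp (- (\<Sum>k<m. (cmod (v k))\<^sup>2) / 4))"
    by (simp add: exp_sum[symmetric] sum_negf sum_divide_distrib flip: of_real_prod)
  finally show ?thesis by (subst expectation_cos_eq) auto
qed

text \<open>
  Markov's inequality for each coordinate and the union bound. The geometric growth of the second
  moments is absorbed by the factorials, and the sum over all coordinates is an exponential series.
\<close>
lemma (in prob_space) coeff_box_tail:
  fixes Y :: "'a \<Rightarrow> nat \<Rightarrow> complex"
  assumes Y[measurable]: "Y \<in> borel_measurable M"
    and int: "\<And>k. integrable M (\<lambda>\<omega>. (cmod (Y \<omega> k))\<^sup>2)"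
    and le: "\<And>k. (LINT \<omega>|M. (cmod (Y \<omega> k))\<^sup>2) \<le> D * q ^ k"
    and pos: "R > 0" "L > 0"
  shows "prob {\<omega>\<in>space M. Y \<omega> \<notin> coeff_box R L} \<le> D * exp (q * R\<^sup>2) / L\<^sup>2"
proof -
  have [measurable]: "(\<lambda>\<omega>. Y \<omega> k) \<in> borel_measurable M" for k
    by (rule measurable_product_then_coordinatewise[OF Y])
  define E where "E k = {\<omega>\<in>space M. (cmod (Y \<omega> k))\<^sup>2 \<ge> L\<^sup>2 * fact k / R ^ (2 * k)}" for k
  define t where "t k = D / L\<^sup>2 * ((q * R\<^sup>2) ^ k /\<^sub>R fact k)" for k
  have Em: "E k \<in> sets M" for k unfolding E_def by measurable
  have E_le: "prob (E k) \<le> t k" for k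
  proof -
    have "prob (E k) \<le> (LINT \<omega>|M. (cmod (Y \<omega> k))\<^sup>2) / (L\<^sup>2 * fact k / R ^ (2 * k))"
      unfolding E_def by (rule integral_Markov_inequality_measure[OF int, of "{}"]) (use pos in auto)
    also have "\<dots> \<le> D * q ^ k / (L\<^sup>2 * fact k / R ^ (2 * k))"
      using pos by (intro divide_right_mono le) auto
    also have "\<dots> = t k" by (simp add: t_def power_mult power_mult_distrib power2_eq_square field_simps)
    finally show ?thesis .
  qed
  have t_sums: "t sums (D / L\<^sup>2 * exp (q * R\<^sup>2))"
    unfolding t_def by (intro sums_mult exp_converges)
  have summ: "summable (\<lambda>k. prob (E k))"
    by (rule summable_comparison_test[OF _ sums_summable[OF t_sums]]) (use E_le in auto)
  have sub: "{\<omega>\<in>space M. Y \<omega> \<notin> coeff_box R L} \<subseteq> (\<Union>k. E k)"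
  proof
    fix \<omega> assume "\<omega> \<in> {\<omega>\<in>space M. Y \<omega> \<notin> coeff_box R L}"
    then obtain k where k: "\<omega> \<in> space M" "cmod (Y \<omega> k) * R ^ k / sqrt (fact k) > L"
      by (auto simp: coeff_box_def not_le)
    then have "L * sqrt (fact k) / R ^ k \<le> cmod (Y \<omega> k)" using pos by (simp add: field_simps)
    then have "(L * sqrt (fact k) / R ^ k)\<^sup>2 \<le> (cmod (Y \<omega> k))\<^sup>2" using pos by (intro power_mono) auto
    then have "L\<^sup>2 * fact k / R ^ (2 * k) \<le> (cmod (Y \<omega> k))\<^sup>2"
      by (simp add: power_mult_distrib power_divide power_mult[symmetric] mult.commute)
    then show "\<omega> \<in> (\<Union>k. E k)" using k(1) by (auto simp: E_def)
  qed
  have "prob {\<omega>\<in>space M. Y \<omega> \<notin> coeff_box R L} \<le> prob (\<Union>k. E k)"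
    by (rule finite_measure_mono[OF sub]) (use Em in auto)
  also have "\<dots> \<le> (\<Sum>k. prob (E k))"
    by (rule finite_measure_subadditive_countably) (use Em summ in auto)
  also have "\<dots> \<le> (\<Sum>k. t k)"
    by (rule suminf_le[OF E_le summ sums_summable[OF t_sums]])
  also have "\<dots> = D * exp (q * R\<^sup>2) / L\<^sup>2" using sums_unique[OF t_sums] by simp
  finally show ?thesis .
qed

text \<open>
  The diagonal terms \<open>i = j\<close> of the double sum contribute 1, the other terms at most the squared mean,
  which is \<open>exp ((1 - \<bar>\<beta>\<bar>\<^sup>2) n) (\<bar>\<beta>\<bar>\<^sup>2 n)^k / k!\<close> with \<open>n = ln N\<close>. For
  \<open>q = 1 - 1 / \<bar>\<beta>\<bar>\<^sup>2\<close> the bound \<open>x^k / k! \<le> exp (q x) / q^k\<close> cancels the exponential completely. The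
  result does not depend on \<open>N\<close>, which is what tightness needs.
\<close>
lemma (in prob_space) rescaled_coeffs_second_moment:
  fixes X :: "nat \<Rightarrow> 'a \<Rightarrow> real"
  assumes ind: "indep_vars (\<lambda>_. borel) X {1..}"
    and D: "\<And>k. k \<ge> 1 \<Longrightarrow> distributed M lborel (X k) (\<lambda>x. ennreal (std_normal_density x))"
    and \<beta>: "\<beta> \<in> B3"
  shows "integrable M (\<lambda>\<omega>. (cmod (rescaled_coeffs \<beta> X N \<omega> k))\<^sup>2)"
    and "(LINT \<omega>|M. (cmod (rescaled_coeffs \<beta> X N \<omega> k))\<^sup>2) \<le> 2 * (1 / (1 - 1 / (cmod \<beta>)\<^sup>2)) ^ k"
proof -
  define q where "q = 1 - 1 / (cmod \<beta>)\<^sup>2"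
  have b: "(cmod \<beta>)\<^sup>2 > 1" by (rule B3_facts(1)[OF \<beta>])
  have "1 / (cmod \<beta>)\<^sup>2 < 1" using b by (subst divide_less_eq_1_pos) auto
  then have q: "0 < q" "q < 1" using b by (auto simp: q_def)
  define v where "v j = (if j = k then 1 else 0 :: complex)" for j
  let ?Q = "hermite_combination (Suc k) v"
  have hc: "summand \<beta> N ?Q x = summand \<beta> N (hermite k) x / of_real (sqrt (fact k))" for x
    unfolding summand_hermite_combination by (simp add: v_def)
  have coeff: "rescaled_coeffs \<beta> X N \<omega> k = (\<Sum>j=1..N. summand \<beta> N ?Q (X j \<omega>))" for \<omega>
    by (simp add: rescaled_coeffs_def hc sum_divide_distrib)
  have "integrable M (\<lambda>\<omega>. (cmod (rescaled_coeffs \<beta> X N \<omega> k))\<^sup>2) \<and>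
     (LINT \<omega>|M. (cmod (rescaled_coeffs \<beta> X N \<omega> k))\<^sup>2) \<le> 2 * (1 / q) ^ k"
  proof (cases "N \<ge> 1")
    case False
    then show ?thesis using q by (simp add: rescaled_coeffs_def)
  next
    case N: True
    note iid = second_moment_iid_sum[OF ind D summand_measurable summand_integrable summand_second_moment(1)[OF N], of \<beta> "Suc k" v N]
    let ?s = "ln (real N)"
    have s: "?s \<ge> 0" using N by simp
    have "(\<Sum>j<Suc k. (cmod (v j))\<^sup>2) = 1" by (simp add: v_def)
    then have one: "real N * (LINT x|gauss. (cmod (summand \<beta> N ?Q x))\<^sup>2) = 1"
      using summand_second_moment(2)[OF N, of \<beta> "Suc k" v] by simp
    have "real N * cmod (LINT x|gauss. summand \<beta> N ?Q x)
        = exp ((1 - (cmod \<beta>)\<^sup>2) / 2 * ?s) * (cmod \<beta> * sqrt ?s) ^ k / sqrt (fact k)"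
      unfolding hc summand_hermite_mean[OF N, symmetric] by (simp add: norm_divide)
    then have "(real N * cmod (LINT x|gauss. summand \<beta> N ?Q x))\<^sup>2
        = (exp ((1 - (cmod \<beta>)\<^sup>2) / 2 * ?s))\<^sup>2 * ((cmod \<beta> * sqrt ?s)\<^sup>2) ^ k / fact k"
      by (simp add: power_mult_distrib power_divide mult.commute flip: power_mult)
    also have "(exp ((1 - (cmod \<beta>)\<^sup>2) / 2 * ?s))\<^sup>2 = exp ((1 - (cmod \<beta>)\<^sup>2) * ?s)"
      unfolding exp_double[symmetric] by simp
    also have "(cmod \<beta> * sqrt ?s)\<^sup>2 = (q * (cmod \<beta>)\<^sup>2 * ?s) / q"
      using s q by (simp add: power_mult_distrib)
    also have "exp ((1 - (cmod \<beta>)\<^sup>2) * ?s) * ((q * (cmod \<beta>)\<^sup>2 * ?s) / q) ^ k / fact k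
       = exp ((1 - (cmod \<beta>)\<^sup>2) * ?s) * ((q * (cmod \<beta>)\<^sup>2 * ?s) ^ k / fact k) * (1 / q) ^ k"
      unfolding power_divide[of "q * (cmod \<beta>)\<^sup>2 * ?s"] power_divide[of 1] by (simp only: power_one times_divide_eq_right times_divide_eq_left divide_divide_eq_left mult_1_right mult.commute)
    also have "\<dots> \<le> exp ((1 - (cmod \<beta>)\<^sup>2) * ?s) * exp (q * (cmod \<beta>)\<^sup>2 * ?s) * (1 / q) ^ k"
    proof (intro mult_right_mono mult_left_mono)
      show "(q * (cmod \<beta>)\<^sup>2 * ?s) ^ k / fact k \<le> exp (q * (cmod \<beta>)\<^sup>2 * ?s)"
      proof -
        let ?x = "q * (cmod \<beta>)\<^sup>2 * ?s"
        have x: "?x \<ge> 0" using q s by simp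
        have "(\<Sum>j\<in>{k}. ?x ^ j /\<^sub>R fact j) \<le> (\<Sum>j. ?x ^ j /\<^sub>R fact j)"
          by (rule sum_le_suminf) (use x in \<open>auto simp: summable_exp\<close>)
        then show ?thesis by (simp add: exp_def divide_inverse mult.commute)
      qed
    qed (use q in auto)
    also have "exp ((1 - (cmod \<beta>)\<^sup>2) * ?s) * exp (q * (cmod \<beta>)\<^sup>2 * ?s) = 1"
    proof -
      have "\<beta> \<noteq> 0" using b by auto
      then have "q * (cmod \<beta>)\<^sup>2 = (cmod \<beta>)\<^sup>2 - 1" by (simp add: q_def field_simps)
      then have "(1 - (cmod \<beta>)\<^sup>2) * ?s + q * (cmod \<beta>)\<^sup>2 * ?s = 0"
        by (simp only:) (simp add: algebra_simps)
      then show ?thesis by (simp only: exp_add[symmetric] exp_zero)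
    qed
    finally have "(real N * cmod (LINT x|gauss. summand \<beta> N ?Q x))\<^sup>2 \<le> (1 / q) ^ k"
      by simp
    moreover have "1 \<le> (1 / q) ^ k" using q by (intro one_le_power) simp
    ultimately show ?thesis using iid unfolding one coeff by auto
  qed
  then show "integrable M (\<lambda>\<omega>. (cmod (rescaled_coeffs \<beta> X N \<omega> k))\<^sup>2)"
    "(LINT \<omega>|M. (cmod (rescaled_coeffs \<beta> X N \<omega> k))\<^sup>2) \<le> 2 * (1 / (1 - 1 / (cmod \<beta>)\<^sup>2)) ^ k"
    by (auto simp: q_def)
qed

section \<open>The zoomed partition function as a Hermite series\<close>

text \<open>
  The recursion for the Hermite polynomials is the recursion for the derivatives of
  \<open>t \<mapsto> exp (t y - t\<^sup>2 / 2)\<close>, so this is the Taylor series at 0.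
\<close>
lemma hermite_generating_function:
  "(\<lambda>k. poly (hermite k) y * t ^ k / fact k) sums exp (t * y - t\<^sup>2 / 2)"
proof -
  define f where "f t = exp (t * y - t\<^sup>2 / 2)" for t
  have der: "((\<lambda>t. poly p (y - t) * f t) has_field_derivative poly ([:0, 1:] * p - pderiv p) (y - t) * f t) (at t)" for p t
    unfolding f_def by (auto intro!: derivative_eq_intros simp: field_simps)
  have iter: "(deriv ^^ k) f = (\<lambda>t. poly (hermite k) (y - t) * f t)" for k
  proof (induction k)
    case (Suc k)
    have "(deriv ^^ Suc k) f = deriv (\<lambda>t. poly (hermite k) (y - t) * f t)" by (simp add: Suc)
    also have "\<dots> = (\<lambda>t. poly (hermite (Suc k)) (y - t) * f t)"
      unfolding hermite.simps by (rule ext, rule DERIV_imp_deriv, rule der)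
    finally show ?case .
  qed simp
  have "f holomorphic_on ball 0 (norm t + 1)" unfolding f_def by (intro holomorphic_intros) auto
  then have "(\<lambda>n. (deriv ^^ n) f 0 / fact n * (t - 0) ^ n) sums f t"
    by (rule holomorphic_power_series) simp
  then show ?thesis unfolding iter by (simp add: f_def)
qed

text \<open>
  The zero-free factor that normalises the zoomed partition function; the Gaussian term \<open>t\<^sup>2 / 2\<close> turns
  the exponentials into Hermite generating functions.
\<close>
definition zoom_factor :: "complex \<Rightarrow> nat \<Rightarrow> complex \<Rightarrow> complex" where
  "zoom_factor \<beta> N t = of_real (exp (- (1/2 + (Re \<beta>)\<^sup>2) * ln (real N))) * exp (- of_real (drift \<beta> N) * t - t\<^sup>2 / 2)"

lemma weighted_series_rescaled_coeffs_sums: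
  assumes "N \<ge> 2"
  shows "(\<lambda>k. rescaled_coeffs \<beta> X N \<omega> k * t ^ k / of_real (sqrt (fact k)))
    sums (zoom_factor \<beta> N t * partition_function X N \<omega> (\<beta> + t / of_real (sqrt (ln (real N)))))"
proof -
  let ?r = "sqrt (ln (real N))"
  have r: "?r > 0" using assms by simp
  define c where "c = exp (- (1/2 + (Re \<beta>)\<^sup>2) * ln (real N))"
  let ?w = "\<lambda>j. of_real c * exp (\<beta> * of_real ?r * of_real (X j \<omega>))"
  let ?y = "\<lambda>j. complex_of_real (X j \<omega> - drift \<beta> N)"
  have "(\<lambda>k. \<Sum>j=1..N. ?w j * (poly (hermite k) (?y j) * t ^ k / fact k))
     sums (\<Sum>j=1..N. ?w j * exp (t * ?y j - t\<^sup>2 / 2))"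
    by (intro sums_sum sums_mult hermite_generating_function)
  also have "(\<lambda>k. \<Sum>j=1..N. ?w j * (poly (hermite k) (?y j) * t ^ k / fact k))
     = (\<lambda>k. rescaled_coeffs \<beta> X N \<omega> k * t ^ k / of_real (sqrt (fact k)))"
  proof
    fix k
    have "complex_of_real (sqrt (fact k)) * of_real (sqrt (fact k)) = of_real (sqrt (fact k) * sqrt (fact k))"
      by (simp only: of_real_mult)
    then have w: "complex_of_real (sqrt (fact k)) * of_real (sqrt (fact k)) = fact k" by simp
    have "rescaled_coeffs \<beta> X N \<omega> k * t ^ k / of_real (sqrt (fact k))
       = (\<Sum>j=1..N. summand \<beta> N (hermite k) (X j \<omega>)) * t ^ k / (of_real (sqrt (fact k)) * of_real (sqrt (fact k)))"
      by (simp add: rescaled_coeffs_def)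
    then show "(\<Sum>j=1..N. ?w j * (poly (hermite k) (?y j) * t ^ k / fact k))
      = rescaled_coeffs \<beta> X N \<omega> k * t ^ k / of_real (sqrt (fact k))"
      unfolding w by (simp add: summand_def c_def sum_distrib_left sum_distrib_right sum_divide_distrib mult_ac)
  qed
  also have "(\<Sum>j=1..N. ?w j * exp (t * ?y j - t\<^sup>2 / 2))
     = zoom_factor \<beta> N t * partition_function X N \<omega> (\<beta> + t / of_real ?r)"
    unfolding partition_function_def sum_distrib_left
  proof (intro sum.cong refl)
    fix j
    have "\<beta> * of_real ?r * of_real (X j \<omega>) + (t * ?y j - t\<^sup>2 / 2)
       = (- of_real (drift \<beta> N) * t - t\<^sup>2 / 2) + (\<beta> + t / of_real ?r) * of_real (?r * X j \<omega>)"
      using r by (simp add: field_simps)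
    then have "exp (\<beta> * of_real ?r * of_real (X j \<omega>)) * exp (t * ?y j - t\<^sup>2 / 2)
       = exp (- of_real (drift \<beta> N) * t - t\<^sup>2 / 2) * exp ((\<beta> + t / of_real ?r) * of_real (?r * X j \<omega>))"
      by (simp only: exp_add[symmetric])
    then show "?w j * exp (t * ?y j - t\<^sup>2 / 2)
       = zoom_factor \<beta> N t * exp ((\<beta> + t / of_real ?r) * of_real (?r * X j \<omega>))"
      by (simp only: zoom_factor_def c_def mult.assoc)
  qed
  finally show ?thesis .
qed

lemma rescaled_coeffs_entire:
  assumes "N \<ge> 2"
  shows "rescaled_coeffs \<beta> X N \<omega> \<in> entire_coeffs"
proof -
  have "summable (\<lambda>k. rescaled_coeffs \<beta> X N \<omega> k * t ^ k / of_real (sqrt (fact k)))" for t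
    by (rule sums_summable[OF weighted_series_rescaled_coeffs_sums[OF assms]])
  then show ?thesis by (simp add: entire_coeffs_def)
qed

lemma sum_over_zeros_rescale:
  fixes Z u :: "complex \<Rightarrow> complex" and r :: real
  assumes Z: "Z holomorphic_on UNIV" "\<exists>z. Z z \<noteq> 0"
    and u: "u holomorphic_on UNIV" "\<And>t. u t \<noteq> 0" and r: "r > 0"
  shows "sum_over_zeros Z (\<lambda>z. f (of_real r * (z - \<beta>))) = sum_over_zeros (\<lambda>t. u t * Z (\<beta> + t / of_real r)) f"
proof -
  define \<phi> where "\<phi> t = \<beta> + t / of_real r" for t
  have r0: "complex_of_real r \<noteq> 0" using r by simp
  have inj: "inj_on \<phi> A" for A using r0 by (auto simp: inj_on_def \<phi>_def)
  have img: "{z. Z z = 0} = \<phi> ` {t. u t * Z (\<phi> t) = 0}"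
  proof (intro equalityI subsetI)
    fix z assume "z \<in> {z. Z z = 0}"
    moreover have "z = \<phi> (of_real r * (z - \<beta>))" using r0 by (simp add: \<phi>_def)
    ultimately show "z \<in> \<phi> ` {t. u t * Z (\<phi> t) = 0}" by (intro image_eqI[of _ _ "of_real r * (z - \<beta>)"]) auto
  qed (use u(2) in auto)
  have zo: "zorder (\<lambda>t. u t * Z (\<phi> t)) t = zorder Z (\<phi> t)" for t
  proof -
    let ?n = "zorder Z (\<phi> t)" and ?g = "zor_poly Z (\<phi> t)"
    have ex: "(if Z (\<phi> t) = 0 then ?n > 0 else ?n = 0) \<and> (\<exists>s. s > 0 \<and> cball (\<phi> t) s \<subseteq> UNIV \<and> ?g holomorphic_on cball (\<phi> t) s
      \<and> (\<forall>w\<in>cball (\<phi> t) s. Z w = ?g w * (w - \<phi> t) ^ nat ?n \<and> ?g w \<noteq> 0))"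
      by (rule zorder_exist_zero[OF Z(1) open_UNIV connected_UNIV UNIV_I]) (use Z(2) in blast)
    have n: "?n \<ge> 0" using conjunct1[OF ex] by (cases "Z (\<phi> t) = 0") simp_all
    obtain s where s: "s > 0" "?g holomorphic_on cball (\<phi> t) s"
       "\<And>w. w \<in> cball (\<phi> t) s \<Longrightarrow> Z w = ?g w * (w - \<phi> t) ^ nat ?n \<and> ?g w \<noteq> 0"
      using conjunct2[OF ex] by metis
    have \<phi>_ball: "\<phi> w \<in> cball (\<phi> t) s" if "w \<in> ball t (r * s)" for w
    proof -
      have "dist (\<phi> t) (\<phi> w) = dist t w / r"
        using r by (simp add: \<phi>_def dist_norm norm_divide flip: diff_divide_distrib)
      moreover have "dist t w / r \<le> s" using that r by (simp add: field_simps)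
      ultimately show ?thesis by simp
    qed
    show ?thesis
    proof (rule zorder_eqI)
      show "open (ball t (r * s))" "t \<in> ball t (r * s)" using r s by auto
      have "(?g \<circ> \<phi>) holomorphic_on ball t (r * s)"
        by (rule holomorphic_on_compose_gen[OF _ s(2)])
           (use \<phi>_ball r0 in \<open>auto simp: \<phi>_def[abs_def] intro!: holomorphic_intros\<close>)
      then show "(\<lambda>w. u w * (?g (\<phi> w) / of_real r ^ nat ?n)) holomorphic_on ball t (r * s)"
        using r0 unfolding comp_def
        by (intro holomorphic_intros holomorphic_on_subset[OF u(1)]) auto
      show "u t * (?g (\<phi> t) / of_real r ^ nat ?n) \<noteq> 0"
        using u(2) s(3)[of "\<phi> t"] s(1) r0 by simp
      fix w assume w: "w \<in> ball t (r * s)" "w \<noteq> t"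
      have "\<phi> w - \<phi> t = (w - t) / of_real r" by (simp add: \<phi>_def diff_divide_distrib)
      then have "Z (\<phi> w) = ?g (\<phi> w) * ((w - t) / of_real r) ^ nat ?n"
        using s(3)[OF \<phi>_ball[OF w(1)]] by simp
      then show "u w * Z (\<phi> w) = u w * (?g (\<phi> w) / of_real r ^ nat ?n) * (w - t) powi ?n"
        using n by (simp add: power_divide power_int_def)
    qed
  qed
  have "sum_over_zeros Z (\<lambda>z. f (of_real r * (z - \<beta>)))
     = (\<Sum>\<^sub>\<infinity>t\<in>{t. u t * Z (\<phi> t) = 0}. of_int (zorder Z (\<phi> t)) * f (of_real r * (\<phi> t - \<beta>)))"
    unfolding sum_over_zeros_def img infsum_reindex[OF inj] by (simp add: comp_def)
  also have "\<dots> = (\<Sum>\<^sub>\<infinity>t\<in>{t. u t * Z (\<phi> t) = 0}. of_int (zorder (\<lambda>t. u t * Z (\<phi> t)) t) * f t)"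
    unfolding zo using r0 by (simp add: \<phi>_def)
  finally show ?thesis by (simp add: sum_over_zeros_def \<phi>_def)
qed

lemma sum_over_zeros_partition_function:
  assumes N: "N \<ge> 2"
  shows "sum_over_zeros (partition_function X N \<omega>) (\<lambda>z. f (of_real (sqrt (ln (real N))) * (z - \<beta>)))
     = sum_over_zeros (weighted_series (rescaled_coeffs \<beta> X N \<omega>)) f"
proof -
  have "weighted_series (rescaled_coeffs \<beta> X N \<omega>) = (\<lambda>t. zoom_factor \<beta> N t * partition_function X N \<omega> (\<beta> + t / of_real (sqrt (ln (real N)))))"
    unfolding weighted_series_def
    by (rule ext, rule sums_unique[OF weighted_series_rescaled_coeffs_sums[OF N], symmetric])
  moreover have "partition_function X N \<omega> 0 \<noteq> 0" using N by (simp add: partition_function_def)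
  moreover have "partition_function X N \<omega> holomorphic_on UNIV"
    unfolding partition_function_def by (intro holomorphic_intros)
  moreover have "zoom_factor \<beta> N holomorphic_on UNIV"
    unfolding zoom_factor_def by (intro holomorphic_intros) auto
  moreover have "zoom_factor \<beta> N t \<noteq> 0" for t by (simp add: zoom_factor_def)
  ultimately show ?thesis
    using N by (simp only:) (intro sum_over_zeros_rescale; auto)
qed

section \<open>Convergence of the zero statistics\<close>

text \<open>
  The factor tends to 0 at the zero sequence, so boundedness of \<open>h\<close> is enough there; elsewhere \<open>h\<close> is
  continuous, as removing one point does not affect the neighbourhoods of another.
\<close>
lemma continuous_on_damped_functional:
  fixes h :: "(nat \<Rightarrow> complex) \<Rightarrow> real"
  assumes cont: "continuous_on (S - {\<lambda>_. 0}) h" and bdd: "\<And>a. \<bar>h a\<bar> \<le> 1" and \<delta>: "\<delta> > 0"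
  shows "continuous_on S (\<lambda>a. h a * min 1 (cmod (a 0) / \<delta>))"
  unfolding continuous_on_def
proof
  fix a assume a: "a \<in> S"
  let ?\<eta> = "\<lambda>a. min 1 (cmod (a 0) / \<delta>)" and ?T = "at a within S"
  have "continuous_on S (\<lambda>a. a 0)"
    by (rule continuous_on_subset[OF continuous_on_product_coordinates]) simp
  then have "continuous_on S ?\<eta>" using \<delta> by (intro continuous_intros) auto
  then have \<eta>: "(?\<eta> \<longlongrightarrow> ?\<eta> a) ?T" using a by (auto simp: continuous_on_def)
  show "((\<lambda>a. h a * ?\<eta> a) \<longlongrightarrow> h a * ?\<eta> a) ?T"
  proof (cases "a = (\<lambda>_. 0)")
    case True
    then have "(?\<eta> \<longlongrightarrow> 0) ?T" using \<eta> by simp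
    then have "((\<lambda>a. h a * ?\<eta> a) \<longlongrightarrow> 0) ?T"
    proof (rule Lim_null_comparison[rotated], intro always_eventually allI)
      fix b
      have "\<bar>h b\<bar> * ?\<eta> b \<le> 1 * ?\<eta> b" using \<delta> by (intro mult_right_mono bdd) auto
      then show "norm (h b * ?\<eta> b) \<le> ?\<eta> b" using \<delta> by (simp add: abs_mult)
    qed
    then show ?thesis using True by simp
  next
    case False
    have "at a within S = at a within (S - {\<lambda>_. 0})"
      by (rule at_within_nhd[of _ "- {\<lambda>_. 0}"]) (use False in \<open>auto intro: open_Compl\<close>)
    then have "(h \<longlongrightarrow> h a) ?T" using cont a False by (auto simp: continuous_on_def)
    then show ?thesis using \<eta> by (rule tendsto_mult)
  qed
qed

lemma tail_threshold:
  fixes K \<epsilon> :: real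
  assumes "\<epsilon> > 0"
  shows "\<exists>L0>0. \<forall>L\<ge>L0. K / L\<^sup>2 \<le> \<epsilon>"
proof (intro exI conjI allI impI)
  let ?L = "sqrt (\<bar>K\<bar> / \<epsilon>) + 1"
  have s: "sqrt (\<bar>K\<bar> / \<epsilon>) \<ge> 0" using assms by simp
  then show "?L > 0" by linarith
  fix L assume L: "L \<ge> ?L"
  have "(sqrt (\<bar>K\<bar> / \<epsilon>))\<^sup>2 \<le> L\<^sup>2" using s L by (intro power_mono) linarith+
  then have "\<bar>K\<bar> / \<epsilon> \<le> L\<^sup>2" using assms by simp
  then have "\<bar>K\<bar> \<le> \<epsilon> * L\<^sup>2" using assms by (simp add: field_simps)
  then have "K \<le> \<epsilon> * L\<^sup>2" by linarith
  moreover have "L\<^sup>2 > 0" using L s by (intro zero_less_power) linarith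
  ultimately show "K / L\<^sup>2 \<le> \<epsilon>" by (simp add: field_simps)
qed

lemma (in prob_space) gaussian_coeffs_second_moment:
  fixes \<xi> :: "nat \<Rightarrow> 'a \<Rightarrow> complex"
  assumes D: "distributed M lborel (\<xi> k) (\<lambda>z. ennreal (std_complex_normal_density z))"
  shows "integrable M (\<lambda>\<omega>. (cmod (\<xi> k \<omega>))\<^sup>2)" (is ?A)
    and "(LINT \<omega>|M. (cmod (\<xi> k \<omega>))\<^sup>2) = (LINT z|lborel. std_complex_normal_density z *\<^sub>R (cmod z)\<^sup>2)" (is ?B)
proof -
  have dm: "std_complex_normal_density \<in> borel_measurable borel" "std_complex_normal_density z \<ge> 0" for z
    unfolding std_complex_normal_density_def by measurable
  have gm: "(\<lambda>z. (cmod z)\<^sup>2) \<in> borel_measurable borel" by measurable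
  show ?A
    using complex_gaussian_integrable_square by (subst distributed_transfer_integrable[OF D dm gm])
  show ?B
    by (rule distributed_transfer_integral[OF D dm gm])
qed

lemma (in prob_space) gaussian_coeffs_nonzero:
  assumes D: "distributed M lborel \<xi> (\<lambda>z::complex. ennreal (std_complex_normal_density z))"
  shows "AE \<omega> in M. \<xi> \<omega> \<noteq> 0"
proof -
  have \<xi>: "\<xi> \<in> measurable M lborel" by (rule distributed_measurable[OF D])
  have dm: "(\<lambda>z. ennreal (std_complex_normal_density z)) \<in> borel_measurable lborel"
    unfolding std_complex_normal_density_def by measurable
  have "AE z in lborel. (z::complex) \<noteq> 0"
    by (rule AE_I'[of "{0}"]) (auto simp: null_sets_def)
  then have "AE z in density lborel (\<lambda>z. ennreal (std_complex_normal_density z)). z \<noteq> 0"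
    unfolding AE_density[OF dm] by eventually_elim simp
  moreover have "distr M lborel \<xi> = density lborel (\<lambda>z. ennreal (std_complex_normal_density z))"
    using D by (simp add: distributed_def)
  ultimately have "AE z in distr M lborel \<xi>. z \<noteq> 0" by (simp only:)
  then show ?thesis by (subst (asm) AE_distr_iff[OF \<xi>]) auto
qed

text \<open>
  The tail estimate for the boxes with a fixed radius tends to 0 as the bound grows.
\<close>
lemma (in prob_space) gaussian_coeffs_entire:
  fixes \<xi> :: "nat \<Rightarrow> 'a \<Rightarrow> complex"
  assumes D: "\<And>k. distributed M lborel (\<xi> k) (\<lambda>z. ennreal (std_complex_normal_density z))"
  shows "AE \<omega> in M. (\<lambda>k. \<xi> k \<omega>) \<in> entire_coeffs"
proof -
  define v where "v = (LINT z|lborel. std_complex_normal_density z *\<^sub>R (cmod z)\<^sup>2)"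
  note v = gaussian_coeffs_second_moment[where \<xi> = \<xi>, OF D, folded v_def]
  have [measurable]: "\<xi> k \<in> borel_measurable M" for k
    using distributed_measurable[OF D] by simp
  have Y[measurable]: "(\<lambda>\<omega> k. \<xi> k \<omega>) \<in> borel_measurable M"
    by (rule measurable_coordinatewise_then_product) simp
  have "AE \<omega> in M. (\<lambda>k. \<xi> k \<omega>) \<in> coeff_tame (real (Suc n))" for n
  proof (rule AE_I')
    let ?E = "{\<omega>\<in>space M. (\<lambda>k. \<xi> k \<omega>) \<notin> coeff_tame (real (Suc n))}"
    have E: "?E \<in> sets M" by measurable
    have "prob ?E \<le> \<epsilon>" if \<epsilon>: "\<epsilon> > 0" for \<epsilon>
    proof -
      obtain L where L: "L > 0" "v * exp (1 * (real (Suc n))\<^sup>2) / L\<^sup>2 \<le> \<epsilon>"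
        using tail_threshold[OF \<epsilon>] by blast
      have "prob ?E \<le> prob {\<omega>\<in>space M. (\<lambda>k. \<xi> k \<omega>) \<notin> coeff_box (real (Suc n)) L}"
        using coeff_box_subset_tame by (intro finite_measure_mono) auto
      also have "\<dots> \<le> v * exp (1 * (real (Suc n))\<^sup>2) / L\<^sup>2"
        by (rule coeff_box_tail[OF Y]) (use v L in auto)
      finally show ?thesis using L by linarith
    qed
    then have "prob ?E \<le> 0" by (rule field_le_epsilon[of _ 0, simplified])
    then have "prob ?E = 0" using measure_nonneg[of M ?E] by linarith
    then show "?E \<in> null_sets M" using E by (simp add: null_sets_def emeasure_eq_measure)
  qed auto
  then show ?thesis unfolding entire_coeffs_eq by (simp add: AE_all_countable)
qed

lemma cts_step_properties:
  assumes "x < y"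
  shows "\<bar>cts_step x y s\<bar> \<le> 1" "continuous_on S (cts_step x y)"
proof -
  show "\<bar>cts_step x y s\<bar> \<le> 1" using assms by (auto simp: cts_step_def field_simps)
  show "continuous_on S (cts_step x y)"
    using uniformly_continuous_imp_continuous[OF cts_step_uniformly_continuous[OF assms]]
    by (rule continuous_on_subset) simp
qed

text \<open>
  The right-hand side involves only the cutoff \<open>d\<close>. In the application it is an expectation whose limit
  along the sequence is known, so the error is controlled uniformly.
\<close>
lemma (in prob_space) damping_error:
  fixes Y :: "'a \<Rightarrow> 'b::topological_space" and g d :: "'b \<Rightarrow> real"
  assumes [measurable]: "Y \<in> borel_measurable M" "g \<in> borel_measurable borel" "d \<in> borel_measurable borel"
    and g: "\<And>a. \<bar>g a\<bar> \<le> 1" and d: "\<And>a. 0 \<le> d a" "\<And>a. d a \<le> 1"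
  shows "\<bar>(LINT \<omega>|M. g (Y \<omega>)) - (LINT \<omega>|M. g (Y \<omega>) * d (Y \<omega>))\<bar> \<le> 1 - (LINT \<omega>|M. d (Y \<omega>))"
proof -
  have gd: "\<bar>g a * (1 - d a)\<bar> \<le> 1 * (1 - d a)" for a
    unfolding abs_mult using g d by (intro mult_mono) auto
  have i: "integrable M (\<lambda>\<omega>. g (Y \<omega>))" "integrable M (\<lambda>\<omega>. d (Y \<omega>))"
    by (rule integrable_const_bound[of _ 1]; use g d in simp)+
  have i2: "integrable M (\<lambda>\<omega>. g (Y \<omega>) * d (Y \<omega>))"
  proof (rule Bochner_Integration.integrable_bound[OF i(2)])
    show "AE \<omega> in M. norm (g (Y \<omega>) * d (Y \<omega>)) \<le> norm (d (Y \<omega>))"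
      using g d by (intro AE_I2) (simp add: abs_mult mult_left_le_one_le)
  qed measurable
  have "\<bar>(LINT \<omega>|M. g (Y \<omega>)) - (LINT \<omega>|M. g (Y \<omega>) * d (Y \<omega>))\<bar> = \<bar>LINT \<omega>|M. g (Y \<omega>) - g (Y \<omega>) * d (Y \<omega>)\<bar>"
    using i i2 by simp
  also have "\<dots> \<le> (LINT \<omega>|M. \<bar>g (Y \<omega>) - g (Y \<omega>) * d (Y \<omega>)\<bar>)" by (rule integral_abs_bound)
  also have "\<dots> \<le> (LINT \<omega>|M. 1 - d (Y \<omega>))"
    by (rule integral_mono) (use i i2 gd in \<open>auto simp: algebra_simps\<close>)
  also have "\<dots> = 1 - (LINT \<omega>|M. d (Y \<omega>))" using i by (simp add: prob_space)
  finally show ?thesis .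
qed

text \<open>
  The cutoff \<open>min 1 (\<bar>a_0\<bar> / \<delta>)\<close> removes the discontinuity at the zero sequence. Its own expectation
  converges by the same weak convergence result, hence it changes the expectations for large \<open>N\<close> about as
  little as it changes the limit; there the change is small for small \<open>\<delta>\<close>, because the coefficient of
  order 0 is almost surely not 0.
\<close>
lemma zero_functional_convergence:
  fixes M :: "'a measure" and M' :: "'b measure" and h :: "complex \<Rightarrow> real"
  assumes M: "prob_space M" and M': "prob_space M'"
    and A[measurable]: "\<And>N. A N \<in> borel_measurable M" and B[measurable]: "B \<in> borel_measurable M'"
    and char: "\<And>m v \<theta>. (\<lambda>N. LINT \<omega>|M. cos (lin_form m v (A N \<omega>) + \<theta>)) \<longlonglongrightarrow> (LINT \<omega>|M'. cos (lin_form m v (B \<omega>) + \<theta>))"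
    and tight: "\<And>\<epsilon>. \<epsilon> > 0 \<Longrightarrow> \<exists>L. (\<forall>N. measure M {\<omega>\<in>space M. A N \<omega> \<notin> coeff_box R L} \<le> \<epsilon>)
                  \<and> measure M' {\<omega>\<in>space M'. B \<omega> \<notin> coeff_box R L} \<le> \<epsilon>"
    and nz: "AE \<omega> in M'. B \<omega> 0 \<noteq> 0"
    and h: "continuous_on UNIV h" "\<And>z. norm z \<ge> R0 \<Longrightarrow> h z = 0" "0 < R0" "R0 < R"
    and xy: "x < y"
  defines "\<Psi> \<equiv> (\<lambda>a. if a \<in> coeff_tame R then sum_over_zeros (weighted_series a) h else 0)"
  shows "(\<lambda>N. LINT \<omega>|M. cts_step x y (\<Psi> (A N \<omega>))) \<longlonglongrightarrow> (LINT \<omega>|M'. cts_step x y (\<Psi> (B \<omega>)))"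
proof -
  interpret M: prob_space M by fact
  interpret M': prob_space M' by fact
  have R: "R > 0" using h by linarith
  have [measurable]: "\<Psi> \<in> borel_measurable borel"
    unfolding \<Psi>_def by (rule measurable_zero_functional[OF h])
  have [measurable]: "cts_step x y \<in> borel_measurable borel"
    by (rule borel_measurable_continuous_onI[OF cts_step_properties(2)[OF xy]])
  define g where "g a = cts_step x y (\<Psi> a)" for a
  have gm[measurable]: "g \<in> borel_measurable borel" unfolding g_def by measurable
  have g1: "\<bar>g a\<bar> \<le> 1" for a unfolding g_def by (rule cts_step_properties(1)[OF xy])
  have gc: "continuous_on (coeff_box R L - {\<lambda>_. 0}) g" for L
  proof -
    have "continuous_on (coeff_box R L - {\<lambda>_. 0}) \<Psi>"
      by (rule continuous_on_eq[OF continuous_on_zero_functional[OF h]])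
         (use coeff_box_subset_tame in \<open>auto simp: \<Psi>_def\<close>)
    then show ?thesis
      unfolding g_def by (rule continuous_on_compose2[OF cts_step_properties(2)[OF xy, of UNIV]]) simp
  qed
  define \<eta> where "\<eta> \<delta> a = min 1 (cmod (a 0) / \<delta>)" for \<delta> :: real and a :: "nat \<Rightarrow> complex"
  have \<eta>m[measurable]: "\<eta> \<delta> \<in> borel_measurable borel" for \<delta> unfolding \<eta>_def by measurable
  have \<eta>01: "0 \<le> \<eta> \<delta> a" "\<eta> \<delta> a \<le> 1" if "\<delta> > 0" for \<delta> a using that by (auto simp: \<eta>_def)
  have conv: "(\<lambda>N. LINT \<omega>|M. f (A N \<omega>) * \<eta> \<delta> (A N \<omega>)) \<longlonglongrightarrow> (LINT \<omega>|M'. f (B \<omega>) * \<eta> \<delta> (B \<omega>))"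
    if [measurable]: "f \<in> borel_measurable borel" and f1: "\<And>a. \<bar>f a\<bar> \<le> 1"
      and fc: "\<And>L. continuous_on (coeff_box R L - {\<lambda>_. 0}) f" and \<delta>: "\<delta> > 0" for f :: "(nat \<Rightarrow> complex) \<Rightarrow> real" and \<delta>
  proof (rule coeff_weak_convergence[OF M M' A B char R tight])
    show "(\<lambda>a. f a * \<eta> \<delta> a) \<in> borel_measurable borel" by measurable
    show "\<bar>f a * \<eta> \<delta> a\<bar> \<le> 1" for a
      using mult_mono[OF f1[of a] \<eta>01(2)[OF \<delta>, of a]] \<eta>01(1)[OF \<delta>, of a] by (simp add: abs_mult)
    show "continuous_on (coeff_box R L) (\<lambda>a. f a * \<eta> \<delta> a)" for L
      unfolding \<eta>_def by (rule continuous_on_damped_functional[OF fc f1 \<delta>])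
  qed
  have diffM: "\<bar>(LINT \<omega>|M. g (A N \<omega>)) - (LINT \<omega>|M. g (A N \<omega>) * \<eta> \<delta> (A N \<omega>))\<bar> \<le> 1 - (LINT \<omega>|M. \<eta> \<delta> (A N \<omega>))"
    if "\<delta> > 0" for N \<delta>
    by (rule M.damping_error[OF A gm \<eta>m g1]) (use \<eta>01[OF that] in auto)
  have diffM': "\<bar>(LINT \<omega>|M'. g (B \<omega>)) - (LINT \<omega>|M'. g (B \<omega>) * \<eta> \<delta> (B \<omega>))\<bar> \<le> 1 - (LINT \<omega>|M'. \<eta> \<delta> (B \<omega>))"
    if "\<delta> > 0" for \<delta>
    by (rule M'.damping_error[OF B gm \<eta>m g1]) (use \<eta>01[OF that] in auto)
  have "(\<lambda>n. LINT \<omega>|M'. \<eta> (1 / real (Suc n)) (B \<omega>)) \<longlonglongrightarrow> (LINT \<omega>|M'. 1)"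
  proof (rule integral_dominated_convergence[where w = "\<lambda>_. 1"])
    show "AE \<omega> in M'. (\<lambda>n. \<eta> (1 / real (Suc n)) (B \<omega>)) \<longlonglongrightarrow> 1"
      using nz
    proof eventually_elim
      case (elim \<omega>)
      obtain n0 where n0: "inverse (real (Suc n0)) < cmod (B \<omega> 0)"
        using reals_Archimedean[of "cmod (B \<omega> 0)"] elim by auto
      have "\<eta> (1 / real (Suc n)) (B \<omega>) = 1" if "n \<ge> n0" for n
      proof -
        have "1 / real (Suc n) \<le> 1 / real (Suc n0)" using that by (intro divide_left_mono) auto
        then have "1 / real (Suc n) \<le> cmod (B \<omega> 0)" using n0 by (simp add: inverse_eq_divide)
        then have "1 \<le> cmod (B \<omega> 0) / (1 / real (Suc n))" by (simp add: field_simps)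
        then show ?thesis by (simp add: \<eta>_def)
      qed
      then show ?case by (intro tendsto_eventually eventually_at_top_linorderI[of n0]) auto
    qed
  qed (use \<eta>01 in \<open>auto simp: abs_le_iff\<close>)
  then have \<eta>lim: "(\<lambda>n. LINT \<omega>|M'. \<eta> (1 / real (Suc n)) (B \<omega>)) \<longlonglongrightarrow> 1" by (simp add: M'.prob_space)
  have "(\<lambda>N. LINT \<omega>|M. g (A N \<omega>)) \<longlonglongrightarrow> (LINT \<omega>|M'. g (B \<omega>))"
  proof (rule LIMSEQ_I)
    fix e :: real assume e: "e > 0"
    then have e5: "e / 5 > 0" by simp
    obtain n where n: "\<bar>(LINT \<omega>|M'. \<eta> (1 / real (Suc n)) (B \<omega>)) - 1\<bar> < e / 5"
      using LIMSEQ_D[OF \<eta>lim e5] by auto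
    define \<delta> where "\<delta> = 1 / real (Suc n)"
    have \<delta>: "\<delta> > 0" by (simp add: \<delta>_def)
    have l1: "(\<lambda>N. LINT \<omega>|M. \<eta> \<delta> (A N \<omega>)) \<longlonglongrightarrow> (LINT \<omega>|M'. \<eta> \<delta> (B \<omega>))"
      using conv[of "\<lambda>_. 1" \<delta>] \<delta> by simp
    have l2: "(\<lambda>N. LINT \<omega>|M. g (A N \<omega>) * \<eta> \<delta> (A N \<omega>)) \<longlonglongrightarrow> (LINT \<omega>|M'. g (B \<omega>) * \<eta> \<delta> (B \<omega>))"
      by (rule conv[OF gm g1 gc \<delta>])
    obtain N1 where N1: "\<And>N. N \<ge> N1 \<Longrightarrow> \<bar>(LINT \<omega>|M. \<eta> \<delta> (A N \<omega>)) - (LINT \<omega>|M'. \<eta> \<delta> (B \<omega>))\<bar> < e / 5"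
      using LIMSEQ_D[OF l1 e5] by auto
    obtain N2 where N2: "\<And>N. N \<ge> N2 \<Longrightarrow> \<bar>(LINT \<omega>|M. g (A N \<omega>) * \<eta> \<delta> (A N \<omega>)) - (LINT \<omega>|M'. g (B \<omega>) * \<eta> \<delta> (B \<omega>))\<bar> < e / 5"
      using LIMSEQ_D[OF l2 e5] by auto
    have tri: "\<bar>u - u'\<bar> < e"
      if "\<bar>u - w\<bar> \<le> 1 - c" "\<bar>u' - w'\<bar> \<le> 1 - c'" "\<bar>c - c'\<bar> < e / 5" "\<bar>w - w'\<bar> < e / 5" "\<bar>c' - 1\<bar> < e / 5" for u u' w w' c c' :: real
      using that by linarith
    show "\<exists>no. \<forall>N\<ge>no. norm ((LINT \<omega>|M. g (A N \<omega>)) - (LINT \<omega>|M'. g (B \<omega>))) < e"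
      unfolding real_norm_def
      using tri[OF diffM[OF \<delta>] diffM'[OF \<delta>] N1 N2 n[folded \<delta>_def]] by (intro exI[of _ "max N1 N2"]) auto
  qed
  then show ?thesis by (simp add: g_def)
qed

lemma gaussian_analytic_function_alt:
  "gaussian_analytic_function \<xi> \<omega> = (if (\<lambda>k. \<xi> k \<omega>) \<in> entire_coeffs then weighted_series (\<lambda>k. \<xi> k \<omega>) else (\<lambda>_. 0))"
  by (auto simp: gaussian_analytic_function_def entire_coeffs_def weighted_series_def fun_eq_iff)

theorem theorem2p3:
  fixes M :: "'a measure" and X :: "nat \<Rightarrow> 'a \<Rightarrow> real"
    and M' :: "'b measure" and \<xi> :: "nat \<Rightarrow> 'b \<Rightarrow> complex"
    and \<beta>\<^sub>0 :: complex and f :: "complex \<Rightarrow> real"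
  assumes "prob_space M"
    and "prob_space.indep_vars M (\<lambda>_. borel) X {1..}"
    and "\<And>k. k \<ge> 1 \<Longrightarrow> distributed M lborel (X k) (\<lambda>x. ennreal (std_normal_density x))"
    and "prob_space M'"
    and "prob_space.indep_vars M' (\<lambda>_. borel) \<xi> UNIV"
    and "\<And>k. distributed M' lborel (\<xi> k) (\<lambda>z. ennreal (std_complex_normal_density z))"
    and "\<beta>\<^sub>0 \<in> B3"
    and "continuous_on UNIV f"
    and "compact (closure {z. f z \<noteq> 0})"
  shows "converges_in_distribution
           M (\<lambda>N \<omega>. sum_over_zeros (partition_function X N \<omega>)
                      (\<lambda>\<beta>. f (of_real (sqrt (ln (real N))) * (\<beta> - \<beta>\<^sub>0))))
           M' (\<lambda>\<omega>. sum_over_zeros (gaussian_analytic_function \<xi> \<omega>) f)"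
proof -
  interpret M: prob_space M by fact
  interpret M': prob_space M' by fact
  have "bounded {z. f z \<noteq> 0}"
    by (rule bounded_subset[OF compact_imp_bounded[OF assms(9)] closure_subset])
  then obtain B0 where B0: "B0 > 0" "\<And>z. f z \<noteq> 0 \<Longrightarrow> norm z \<le> B0"
    unfolding bounded_pos by auto
  \<comment> \<open>Room for a radius strictly between the support of \<open>f\<close> and the radius of the boxes.\<close>
  define R where "R = B0 + 2"
  have f: "continuous_on UNIV f" "\<And>z. norm z \<ge> B0 + 1 \<Longrightarrow> f z = 0" "0 < B0 + 1" "B0 + 1 < R"
    using assms(8) B0 by (auto simp: R_def) (smt (verit))
  have R: "R > 0" using B0 by (simp add: R_def)
  define A where "A N = rescaled_coeffs \<beta>\<^sub>0 X N" for N
  define B where "B \<omega> = (\<lambda>k. \<xi> k \<omega>)" for \<omega>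
  define S where "S N \<omega> = sum_over_zeros (partition_function X N \<omega>) (\<lambda>\<beta>. f (of_real (sqrt (ln (real N))) * (\<beta> - \<beta>\<^sub>0)))" for N \<omega>
  define T where "T \<omega> = sum_over_zeros (gaussian_analytic_function \<xi> \<omega>) f" for \<omega>
  define \<Psi> where "\<Psi> = (\<lambda>a. if a \<in> coeff_tame R then sum_over_zeros (weighted_series a) f else 0)"
  have Am[measurable]: "A N \<in> borel_measurable M" for N
    unfolding A_def using distributed_measurable[OF assms(3)] by (intro measurable_rescaled_coeffs) simp
  have [measurable]: "\<xi> k \<in> borel_measurable M'" for k
    using distributed_measurable[OF assms(6)] by simp
  have Bm[measurable]: "B \<in> borel_measurable M'"
    unfolding B_def by (rule measurable_coordinatewise_then_product) simp
  have [measurable]: "\<Psi> \<in> borel_measurable borel"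
    unfolding \<Psi>_def by (rule measurable_zero_functional[OF f])
  have S_eq: "S N \<omega> = \<Psi> (A N \<omega>)" if "N \<ge> 2" for N \<omega>
  proof -
    have "A N \<omega> \<in> coeff_tame R"
      unfolding A_def by (rule subsetD[OF entire_coeffs_subset_tame[OF R] rescaled_coeffs_entire[OF that]])
    then show ?thesis
      by (simp add: S_def A_def \<Psi>_def sum_over_zeros_partition_function[OF that])
  qed
  have T_eq: "T \<omega> = (if B \<omega> \<in> entire_coeffs then \<Psi> (B \<omega>) else sum_over_zeros (\<lambda>_. 0) f)" for \<omega>
    using entire_coeffs_subset_tame[OF R]
    by (auto simp: T_def B_def \<Psi>_def gaussian_analytic_function_alt)
  have Sm[measurable]: "S N \<in> borel_measurable M" for N
  proof (cases "N \<ge> 2")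
    case True
    then show ?thesis using S_eq[OF True] by (simp add: measurable_cong[of M "S N" "\<lambda>\<omega>. \<Psi> (A N \<omega>)"])
  next
    case False
    \<comment> \<open>Here \<open>ln N = 0\<close>, so the partition function is a constant that does not depend on the sample.\<close>
    then have "N = 0 \<or> N = 1" by auto
    then have const: "partition_function X N \<omega> = partition_function X N undefined" for \<omega>
      by (auto simp: partition_function_def fun_eq_iff)
    have "S N \<omega> = S N undefined" for \<omega> unfolding S_def const[of \<omega>] ..
    then have "S N = (\<lambda>_. S N undefined)" by (rule ext)
    then show ?thesis by (metis borel_measurable_const)
  qed
  have Tm[measurable]: "T \<in> borel_measurable M'" unfolding T_eq[abs_def] by measurable
  have tight: "\<exists>L. (\<forall>N. measure M {\<omega>\<in>space M. A N \<omega> \<notin> coeff_box R L} \<le> \<epsilon>)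
                  \<and> measure M' {\<omega>\<in>space M'. B \<omega> \<notin> coeff_box R L} \<le> \<epsilon>" if \<epsilon>: "\<epsilon> > 0" for \<epsilon>
  proof -
    define q where "q = 1 / (1 - 1 / (cmod \<beta>\<^sub>0)\<^sup>2)"
    define v where "v = (LINT z|lborel. std_complex_normal_density z *\<^sub>R (cmod z)\<^sup>2)"
    obtain L1 where L1: "L1 > 0" "\<And>L. L \<ge> L1 \<Longrightarrow> 2 * exp (q * R\<^sup>2) / L\<^sup>2 \<le> \<epsilon>"
      using tail_threshold[OF \<epsilon>] by blast
    obtain L2 where L2: "L2 > 0" "\<And>L. L \<ge> L2 \<Longrightarrow> v * exp (1 * R\<^sup>2) / L\<^sup>2 \<le> \<epsilon>"
      using tail_threshold[OF \<epsilon>] by blast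
    define L where "L = max L1 L2"
    have L: "L > 0" using L1 by (simp add: L_def)
    have "measure M {\<omega>\<in>space M. A N \<omega> \<notin> coeff_box R L} \<le> 2 * exp (q * R\<^sup>2) / L\<^sup>2" for N
      by (rule M.coeff_box_tail[OF Am _ _ R L])
         (use M.rescaled_coeffs_second_moment[OF assms(2,3,7)] in \<open>simp_all add: A_def q_def\<close>)
    moreover have "measure M' {\<omega>\<in>space M'. B \<omega> \<notin> coeff_box R L} \<le> v * exp (1 * R\<^sup>2) / L\<^sup>2"
      by (rule M'.coeff_box_tail[OF Bm _ _ R L])
         (use M'.gaussian_coeffs_second_moment[where \<xi> = \<xi>, OF assms(6)] in \<open>simp_all add: B_def v_def\<close>)
    ultimately show ?thesis
      using L1(2)[of L] L2(2)[of L] by (intro exI[of _ L]) (auto simp: L_def intro: order.trans)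
  qed
  have char: "(\<lambda>N. LINT \<omega>|M. cos (lin_form m v (A N \<omega>) + \<theta>)) \<longlonglongrightarrow> (LINT \<omega>|M'. cos (lin_form m v (B \<omega>) + \<theta>))" for m v \<theta>
    unfolding A_def B_def M'.gaussian_coeffs_cos[OF assms(5,6)]
    by (rule M.rescaled_coeffs_cos_limit[OF assms(2,3,7)])
  have nz: "AE \<omega> in M'. B \<omega> 0 \<noteq> 0"
    unfolding B_def by (rule M'.gaussian_coeffs_nonzero[of "\<xi> 0", OF assms(6)])
  have T_ae: "AE \<omega> in M'. T \<omega> = \<Psi> (B \<omega>)"
    using M'.gaussian_coeffs_entire[where \<xi> = \<xi>, OF assms(6)] by eventually_elim (simp add: T_eq B_def)
  have "weak_conv_m (\<lambda>N. distr M borel (S N)) (distr M' borel T)"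
  proof (rule integral_cts_step_conv_imp_weak_conv)
    show "real_distribution (distr M borel (S N))" for N by (rule M.real_distribution_distr) measurable
    show "real_distribution (distr M' borel T)" by (rule M'.real_distribution_distr) measurable
    fix x y :: real assume xy: "x < y"
    have [measurable]: "cts_step x y \<in> borel_measurable borel"
      by (rule borel_measurable_continuous_onI[OF cts_step_properties(2)[OF xy]])
    have "(\<lambda>N. LINT \<omega>|M. cts_step x y (\<Psi> (A N \<omega>))) \<longlonglongrightarrow> (LINT \<omega>|M'. cts_step x y (\<Psi> (B \<omega>)))"
      unfolding \<Psi>_def by (rule zero_functional_convergence[OF assms(1,4) Am Bm char tight nz f xy])
    moreover have "(LINT \<omega>|M'. cts_step x y (\<Psi> (B \<omega>))) = (LINT \<omega>|M'. cts_step x y (T \<omega>))"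
      by (rule integral_cong_AE) (use T_ae in auto)
    moreover have "\<forall>\<^sub>F N in sequentially. (LINT \<omega>|M. cts_step x y (\<Psi> (A N \<omega>))) = (LINT \<omega>|M. cts_step x y (S N \<omega>))"
      by (rule eventually_at_top_linorderI[of 2]) (simp add: S_eq)
    ultimately have "(\<lambda>N. LINT \<omega>|M. cts_step x y (S N \<omega>)) \<longlonglongrightarrow> (LINT \<omega>|M'. cts_step x y (T \<omega>))"
      using Lim_transform_eventually by fastforce
    then show "(\<lambda>N. integral\<^sup>L (distr M borel (S N)) (cts_step x y)) \<longlonglongrightarrow> integral\<^sup>L (distr M' borel T) (cts_step x y)"
      by (simp add: integral_distr)
  qed
  then show ?thesis
    using Sm Tm unfolding converges_in_distribution_def S_def[abs_def] T_def[abs_def] by blast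
qed

end
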